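(* If $K\subset\mathbb R^2$ is a self-similar set with $\mathcal H^1(K)>0$, then $\dim D(K)=1$.
   Context: A self-similar set in the plane is the unique non-empty compact set $K$ with $K=\bigcup_{i=1}^NS_i(K)$ for some finite family of contracting similarity maps $S_i:\mathbb R^2\to\mathbb R^2$ (no separation condition is assumed). $\mathcal H^1$ is $1$-dimensional Hausdorff measure, $\dim$ is Hausdorff dimension, and $D(K)=\{|x-y|:x,y\in K\}$ is the distance set. *)

theory Defs
  imports "HOL-Analysis.Analysis"
begin

text \<open>The \<open>s\<close>-th power of the diameter of a bounded set, with the usual conventions
  that the empty set contributes 0 for every \<open>s\<close>, and that a nonempty set contributes 1
  for \<open>s = 0\<close> (whereas \<open>0 powr 0 = 0\<close> in the library).\<close>

definition diam_pow :: "real \<Rightarrow> 'a::metric_space set \<Rightarrow> ennreal" where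
  "diam_pow s U = (if U = {} then 0 else if s = 0 then 1 else ennreal (diameter U powr s))"

text \<open>Covers are countable families of arbitrary sets; finite covers are included by padding
  with the empty set. Boundedness has to be demanded separately, because the library's
  \<open>diameter\<close> has no meaningful value on unbounded sets. The infimum over no covers is \<open>\<infinity>\<close>.\<close>

definition hausdorff_premeasure :: "real \<Rightarrow> real \<Rightarrow> 'a::metric_space set \<Rightarrow> ennreal" where
  "hausdorff_premeasure s \<delta> A =
     (INF U \<in> {U :: nat \<Rightarrow> 'a set. A \<subseteq> (\<Union>n. U n) \<and> (\<forall>n. bounded (U n) \<and> diameter (U n) \<le> \<delta>)}.
        (\<Sum>n. diam_pow s (U n)))"

definition hausdorff_measure :: "real \<Rightarrow> 'a::metric_space set \<Rightarrow> ennreal" where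
  "hausdorff_measure s A = (SUP \<delta> \<in> {0<..}. hausdorff_premeasure s \<delta> A)"

definition hausdorff_dim :: "'a::metric_space set \<Rightarrow> ennreal" where
  "hausdorff_dim A = Inf {ennreal s | s. 0 \<le> s \<and> hausdorff_measure s A = 0}"

definition contracting_similarity :: "('a::metric_space \<Rightarrow> 'a) \<Rightarrow> bool" where
  "contracting_similarity f \<longleftrightarrow> (\<exists>r. 0 < r \<and> r < 1 \<and> (\<forall>x y. dist (f x) (f y) = r * dist x y))"

text \<open>In a complete space such as the plane, a finite nonempty family of contractions has exactly
  one nonempty compact invariant set (Hutchinson), so being that set is the same as being
  nonempty, compact and invariant. The maps need not be distinct and their images may overlap;
  \<open>N = 0\<close> is excluded by \<open>K \<noteq> {}\<close>.\<close>

definition self_similar_set :: "'a::metric_space set \<Rightarrow> bool" where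
  "self_similar_set K \<longleftrightarrow>
     K \<noteq> {} \<and> compact K \<and>
     (\<exists>(N::nat) S. (\<forall>i\<in>{1..N}. contracting_similarity (S i)) \<and> K = (\<Union>i\<in>{1..N}. S i ` K))"

definition distance_set :: "'a::metric_space set \<Rightarrow> real set" where
  "distance_set K = {dist x y | x y. x \<in> K \<and> y \<in> K}"

end

theory Submission
  imports Defs
begin

text \<open>
  Identify the plane with \<open>\<complex>\<close>, so that the maps of the iterated function system are
  \<open>z \<mapsto> a z + b\<close> or \<open>z \<mapsto> a (cnj z) + b\<close>. Since a subset of a bounded interval has dimension at most
  1, the task is to show that \<open>D(K)\<close> has positive \<open>s\<close>-dimensional measure for every \<open>s < 1\<close>. Fix a
  point \<open>y\<^sub>0\<close> of \<open>K\<close> and a small piece of \<open>K\<close> around another point \<open>x\<^sub>0\<close>. On that piece the distance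
  to \<open>y\<^sub>0\<close> is, up to a small relative error, the orthogonal projection to the line in direction
  \<open>x\<^sub>0 - y\<^sub>0\<close>. It is therefore enough to find inside the piece a tree of subpieces whose
  projections are separated at every scale and which has about \<open>r powr -s\<close> branches at scale \<open>r\<close>
  (\<open>distance_set_from_separated_tree\<close>). Because separation at all scales leaves some room, the error
  in the linearisation does no harm.

  No separation condition is assumed, so separated pieces have to be selected. The words of length
  \<open>n\<close> have only polynomially many different linear parts, because a linear part is a monomial in the
  coefficients of the system and their conjugates. As \<open>K\<close> has positive length, one class of words with
  a common linear part contains almost \<open>1 / \<bar>a\<bar>\<close> pieces that are \<open>\<bar>a\<bar>\<close>-separated, where \<open>\<bar>a\<bar>\<close>
  is the common contraction ratio (\<open>homogeneous_family\<close>). Composing with one of finitely many words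
  changes the common rotation at bounded cost.

  Suppose first that the rotations of the words are infinitely many. Then the common linear part can be
  arranged to have a rotation \<open>\<zeta>\<close> of infinite order, and a level-\<open>k\<close> subpiece is projected in a
  direction that is rotated by \<open>\<zeta> ^ k\<close>. Iterating the homogeneous family makes its discrete energy
  almost as small as possible, and since the rotations \<open>\<zeta> ^ k\<close> equidistribute, Marstrand's
  projection argument applies to the average over \<open>k\<close> in place of the average over all directions
  (\<open>iterate_with_few_close_pairs\<close>). By the inequality of the means the product of the numbers
  of separated projections over the first \<open>N\<close> levels is large for all large \<open>N\<close>, in every direction.

  If the rotations are finitely many, all pieces can be taken to be positively homothetic to \<open>K\<close>. Then
  the direction stays fixed and it suffices to find one chord of \<open>K\<close> in whose direction the
  projections of many pieces are separated (\<open>positively_homothetic_family\<close>). If the directions of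
  chords are dense, Marstrand's argument gives a good direction, and a nearby chord does as well. If
  not, \<open>K\<close> is a Lipschitz graph over a subset \<open>A\<close> of the line with positive Lebesgue measure; near a
  density point of \<open>A\<close> one sees that, of two chords that are not parallel, at least one has a projection
  of positive length (\<open>chord_with_positive_projection\<close>).
\<close>

section \<open>Hausdorff measure and sets of positive length\<close>

text \<open>Positivity of the 1-dimensional Hausdorff content. It is equivalent to positivity of the
  1-dimensional Hausdorff measure, and it needs no restriction on the size of the covering sets.\<close>

definition positive_length :: "'a::metric_space set \<Rightarrow> bool" where
  "positive_length A \<longleftrightarrow> (\<exists>c>0. \<forall>U :: nat \<Rightarrow> 'a set. A \<subseteq> (\<Union>n. U n) \<longrightarrow> (\<forall>n. bounded (U n)) \<longrightarrow>
     ennreal c \<le> (\<Sum>n. ennreal (diameter (U n))))"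

text \<open>A cover that contains a set of diameter more than \<open>\<delta>\<close> costs at least \<open>\<delta>\<close>; all other covers
  are admissible for the premeasure at scale \<open>\<delta>\<close>.\<close>

lemma positive_length_if_hausdorff_measure_pos:
  assumes "hausdorff_measure 1 A > 0"
  shows "positive_length A"
proof -
  obtain \<delta> :: real where \<delta>: "\<delta> > 0" "hausdorff_premeasure 1 \<delta> A > 0"
    using assms unfolding hausdorff_measure_def less_SUP_iff by auto
  obtain c where c: "0 < c" "ennreal c \<le> hausdorff_premeasure 1 \<delta> A" "c \<le> \<delta>"
  proof -
    define p where "p = hausdorff_premeasure 1 \<delta> A"
    define m where "m = min p (ennreal \<delta>)"
    have "m \<le> ennreal \<delta>" unfolding m_def by simp
    then have "m \<noteq> top" by (metis ennreal_neq_top top.extremum_unique)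
    then obtain c where c: "m = ennreal c" "c \<ge> 0" by (cases m) auto
    have "0 < c"
      using \<delta> c unfolding m_def p_def
      by (metis ennreal_0 ennreal_less_zero_iff less_le min_less_iff_conj order_le_less)
    moreover have "c \<le> \<delta>" using c \<delta> m_def
      by (metis ennreal_le_iff less_imp_le min.cobounded2)
    ultimately show ?thesis using that c m_def p_def by (metis min.cobounded1)
  qed
  have "ennreal c \<le> (\<Sum>n. ennreal (diameter (U n)))"
    if U: "A \<subseteq> (\<Union>n. U n)" "\<And>n. bounded (U n)" for U :: "nat \<Rightarrow> _ set"
  proof (cases "\<forall>n. diameter (U n) \<le> \<delta>")
    case True
    have "ennreal c \<le> hausdorff_premeasure 1 \<delta> A" by (rule c)
    also have "\<dots> \<le> (\<Sum>n. diam_pow 1 (U n))"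
      unfolding hausdorff_premeasure_def by (rule INF_lower) (use U True in auto)
    also have "\<dots> \<le> (\<Sum>n. ennreal (diameter (U n)))"
      by (intro suminf_le summableI) (auto simp: diam_pow_def diameter_ge_0 U)
    finally show ?thesis .
  next
    case False
    then obtain n where n: "diameter (U n) > \<delta>" by (auto simp: not_le)
    have "ennreal c \<le> ennreal (diameter (U n))" using n c by (intro ennreal_leI) auto
    also have "\<dots> = (\<Sum>k\<in>{n}. ennreal (diameter (U k)))" by simp
    also have "\<dots> \<le> (\<Sum>n. ennreal (diameter (U n)))" by (rule sum_le_suminf) auto
    finally show ?thesis .
  qed
  then show ?thesis unfolding positive_length_def using c(1) by blast
qed

text \<open>Pulling a cover of the image back to \<open>A\<close> multiplies diameters by at most \<open>L\<close>.\<close>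

lemma positive_length_image:
  assumes A: "positive_length A" and L: "L > 0"
    and f: "\<And>x y. x \<in> A \<Longrightarrow> y \<in> A \<Longrightarrow> dist x y \<le> L * dist (f x) (f y)"
  shows "positive_length (f ` A)"
proof -
  obtain c where c: "c > 0" and cov: "\<And>U :: nat \<Rightarrow> _ set. A \<subseteq> (\<Union>n. U n) \<Longrightarrow> (\<And>n. bounded (U n)) \<Longrightarrow>
     ennreal c \<le> (\<Sum>n. ennreal (diameter (U n)))"
    using A unfolding positive_length_def by blast
  have "ennreal (c / L) \<le> (\<Sum>n. ennreal (diameter (V n)))"
    if V: "f ` A \<subseteq> (\<Union>n. V n)" "\<And>n. bounded (V n)" for V :: "nat \<Rightarrow> _ set"
  proof -
    define U where "U n = A \<inter> f -` V n" for n
    have d: "dist x y \<le> L * diameter (V n)" if "x \<in> U n" "y \<in> U n" for x y n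
    proof -
      have "dist x y \<le> L * dist (f x) (f y)" using that f unfolding U_def by auto
      also have "\<dots> \<le> L * diameter (V n)"
        using that L V(2) unfolding U_def by (intro mult_left_mono diameter_bounded_bound) auto
      finally show ?thesis .
    qed
    have b: "bounded (U n)" for n
      using d unfolding bounded_two_points by blast
    have dd: "diameter (U n) \<le> L * diameter (V n)" for n
    proof (cases "U n = {}")
      case True then show ?thesis using L diameter_ge_0[OF V(2)] by simp
    next
      case False
      then show ?thesis unfolding diameter_def[of "U n"] by (auto intro!: cSUP_least d)
    qed
    have "ennreal c \<le> (\<Sum>n. ennreal (diameter (U n)))"
      by (rule cov) (use V(1) b in \<open>auto simp: U_def image_subset_iff\<close>)
    also have "\<dots> \<le> (\<Sum>n. ennreal L * ennreal (diameter (V n)))"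
      by (intro suminf_le summableI)
         (use dd L diameter_ge_0[OF V(2)] in \<open>auto simp flip: ennreal_mult intro!: ennreal_leI\<close>)
    also have "\<dots> = ennreal L * (\<Sum>n. ennreal (diameter (V n)))" by simp
    finally have *: "ennreal c \<le> ennreal L * (\<Sum>n. ennreal (diameter (V n)))" .
    have "ennreal (c / L) = ennreal (1 / L) * ennreal c"
      using c L by (simp flip: ennreal_mult)
    also have "\<dots> \<le> ennreal (1 / L) * (ennreal L * (\<Sum>n. ennreal (diameter (V n))))"
      by (intro mult_left_mono *) auto
    also have "\<dots> = (\<Sum>n. ennreal (diameter (V n)))"
      using L by (simp flip: ennreal_mult mult.assoc)
    finally show ?thesis .
  qed
  then show ?thesis unfolding positive_length_def using c L by (metis divide_pos_pos)
qed

lemma positive_length_finite_cover: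
  assumes "positive_length A"
  shows "\<exists>c>0. \<forall>(I :: 'i set) U. finite I \<longrightarrow> A \<subseteq> (\<Union>i\<in>I. U i) \<longrightarrow> (\<forall>i\<in>I. bounded (U i)) \<longrightarrow>
       c \<le> (\<Sum>i\<in>I. diameter (U i))"
proof -
  obtain c where c: "c > 0" and cov: "\<And>U :: nat \<Rightarrow> _ set. A \<subseteq> (\<Union>n. U n) \<Longrightarrow> (\<And>n. bounded (U n)) \<Longrightarrow>
     ennreal c \<le> (\<Sum>n. ennreal (diameter (U n)))"
    using assms unfolding positive_length_def by blast
  have "c \<le> (\<Sum>i\<in>I. diameter (U i))"
    if I: "finite I" "A \<subseteq> (\<Union>i\<in>I. U i)" "\<And>i. i \<in> I \<Longrightarrow> bounded (U i)" for I :: "'i set" and U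
  proof -
    obtain h where h: "bij_betw h {0..<card I} I" using ex_bij_betw_nat_finite[OF I(1)] by blast
    define V where "V n = (if n < card I then U (h n) else {})" for n
    have "A \<subseteq> (\<Union>n. V n)"
    proof
      fix x assume "x \<in> A"
      then obtain i where i: "i \<in> I" "x \<in> U i" using I by auto
      then obtain n where "n < card I" "h n = i"
        using h by (metis atLeastLessThan_iff bij_betw_imp_surj_on image_iff)
      then show "x \<in> (\<Union>n. V n)" using i by (auto simp: V_def)
    qed
    moreover have hI: "h n \<in> I" if "n < card I" for n using h that bij_betwE by fastforce
    then have bV: "bounded (V n)" for n using I by (auto simp: V_def)
    ultimately have "ennreal c \<le> (\<Sum>n. ennreal (diameter (V n)))" by (rule cov)
    also have "\<dots> = (\<Sum>n\<in>{0..<card I}. ennreal (diameter (V n)))"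
      by (rule suminf_finite) (auto simp: V_def)
    also have "\<dots> = ennreal (\<Sum>n\<in>{0..<card I}. diameter (V n))"
      by (rule sum_ennreal) (auto intro: diameter_ge_0 bV)
    also have "(\<Sum>n\<in>{0..<card I}. diameter (V n)) = (\<Sum>n\<in>{0..<card I}. diameter (U (h n)))"
      by (rule sum.cong) (auto simp: V_def)
    also have "\<dots> = (\<Sum>i\<in>I. diameter (U i))" by (rule sum.reindex_bij_betw[OF h])
    finally show ?thesis
      using diameter_ge_0 I by (subst (asm) ennreal_le_iff) (auto intro!: sum_nonneg)
  qed
  then show ?thesis by (intro exI[of _ c] conjI c allI impI) (simp only: Ball_def)
qed

lemma positive_length_not_subset_singleton:
  assumes "positive_length A"
  shows "\<not> A \<subseteq> {x}"
proof
  assume *: "A \<subseteq> {x}"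
  obtain c where c: "c > 0" and cov: "\<And>U :: nat \<Rightarrow> _ set. A \<subseteq> (\<Union>n. U n) \<Longrightarrow> (\<And>n. bounded (U n)) \<Longrightarrow>
     ennreal c \<le> (\<Sum>n. ennreal (diameter (U n)))"
    using assms unfolding positive_length_def by blast
  have "ennreal c \<le> (\<Sum>n. ennreal (diameter ((\<lambda>n::nat. {x}) n)))"
    by (rule cov) (use * in auto)
  then show False using c by simp
qed

text \<open>A bounded set of reals lies in an interval centred at one of its points, of twice its diameter;
  this is where the factor 2 comes from.\<close>

lemma cover_measurable_hull:
  fixes U :: "nat \<Rightarrow> real set"
  assumes "\<And>n. bounded (U n)"
  shows "\<exists>X\<in>sets lborel. (\<Union>n. U n) \<subseteq> X \<and> emeasure lborel X \<le> 2 * (\<Sum>n. ennreal (diameter (U n)))"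
proof -
  define I where "I n = (if U n = {} then {} else
      {(SOME x. x \<in> U n) - diameter (U n)..(SOME x. x \<in> U n) + diameter (U n)})" for n
  have sub: "U n \<subseteq> I n" for n
  proof
    fix y assume y: "y \<in> U n"
    then have "(SOME x. x \<in> U n) \<in> U n" by (rule someI)
    then have "\<bar>(SOME x. x \<in> U n) - y\<bar> \<le> diameter (U n)"
      using diameter_bounded_bound[OF assms] y by (metis dist_real_def)
    then show "y \<in> I n" using y unfolding I_def by auto
  qed
  have m: "emeasure lborel (I n) \<le> 2 * ennreal (diameter (U n))" for n
  proof -
    have "emeasure lborel (I n) \<le> ennreal (2 * diameter (U n))"
      using diameter_ge_0[OF assms, of n] by (auto simp: I_def)
    then show ?thesis using diameter_ge_0[OF assms, of n] by (simp add: ennreal_mult)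
  qed
  have Ib: "I n \<in> sets lborel" for n by (simp add: I_def)
  have "emeasure lborel (\<Union>n. I n) \<le> (\<Sum>n. emeasure lborel (I n))"
    by (rule emeasure_subadditive_countably) (use Ib in auto)
  also have "\<dots> \<le> (\<Sum>n. 2 * ennreal (diameter (U n)))"
    by (intro suminf_le summableI m)
  finally have "emeasure lborel (\<Union>n. I n) \<le> 2 * (\<Sum>n. ennreal (diameter (U n)))" by simp
  moreover have "(\<Union>n. I n) \<in> sets lborel" using Ib by blast
  moreover have "(\<Union>n. U n) \<subseteq> (\<Union>n. I n)" using sub by blast
  ultimately show ?thesis by blast
qed

lemma half_length_le_two_cover_diameters:
  fixes U V :: "nat \<Rightarrow> real set"
  assumes cov: "{a..<b} \<subseteq> (\<Union>n. U n) \<union> (\<Union>n. V n)" and "\<And>n. bounded (U n)" "\<And>n. bounded (V n)"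
  shows "ennreal (b - a) \<le> 2 * (\<Sum>n. ennreal (diameter (U n))) + 2 * (\<Sum>n. ennreal (diameter (V n)))"
proof -
  obtain X where X: "X \<in> sets lborel" "(\<Union>n. U n) \<subseteq> X" "emeasure lborel X \<le> 2 * (\<Sum>n. ennreal (diameter (U n)))"
    using cover_measurable_hull[of U] assms(2) by blast
  obtain Y where Y: "Y \<in> sets lborel" "(\<Union>n. V n) \<subseteq> Y" "emeasure lborel Y \<le> 2 * (\<Sum>n. ennreal (diameter (V n)))"
    using cover_measurable_hull[of V] assms(3) by blast
  have "ennreal (b - a) \<le> emeasure lborel {a..<b}"
    by (cases "a \<le> b") (auto simp: ennreal_neg)
  also have "\<dots> \<le> emeasure lborel (X \<union> Y)"
  proof (rule emeasure_mono)
    show "{a..<b} \<subseteq> X \<union> Y" using cov X(2) Y(2) by blast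
  qed (use X Y in auto)
  also have "\<dots> \<le> emeasure lborel X + emeasure lborel Y" using X Y by (intro emeasure_subadditive)
  also have "\<dots> \<le> 2 * (\<Sum>n. ennreal (diameter (U n))) + 2 * (\<Sum>n. ennreal (diameter (V n)))"
    using X Y by (intro add_mono)
  finally show ?thesis .
qed

lemma half_length_le_cover_diameters:
  fixes U :: "nat \<Rightarrow> real set"
  assumes "{a..<b} \<subseteq> (\<Union>n. U n)" "\<And>n. bounded (U n)"
  shows "ennreal (b - a) \<le> 2 * (\<Sum>n. ennreal (diameter (U n)))"
  using half_length_le_two_cover_diameters[of a b U "\<lambda>_. {}"] assms by simp

text \<open>The mass distribution principle, with Lebesgue measure on \<open>[0, 1)\<close> as the mass: the inverse of
  \<open>\<psi>\<close> is Hoelder continuous with exponent \<open>s'\<close>, so a cover of \<open>D\<close> pulls back to a cover of the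
  interval, whose diameters have sum at least 1/2.\<close>

lemma hausdorff_measure_pos_if_expanding_map:
  fixes \<psi> :: "real \<Rightarrow> 'a::metric_space"
  assumes D: "\<And>t. 0 \<le> t \<Longrightarrow> t < 1 \<Longrightarrow> \<psi> t \<in> D"
    and \<psi>: "\<And>t t'. \<lbrakk>0 \<le> t; t < 1; 0 \<le> t'; t' < 1\<rbrakk> \<Longrightarrow> \<bar>t - t'\<bar> \<le> C * dist (\<psi> t) (\<psi> t') powr s'"
    and s: "0 \<le> s" "s \<le> s'" "0 < s'" and C: "C > 0"
  shows "hausdorff_measure s D > 0"
proof -
  have "ennreal (1 / (2 * C)) \<le> (\<Sum>n. diam_pow s (U n))"
    if U: "D \<subseteq> (\<Union>n. U n)" "\<And>n. bounded (U n)" "\<And>n. diameter (U n) \<le> 1" for U :: "nat \<Rightarrow> 'a set"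
  proof -
    define P where "P n = {t. 0 \<le> t \<and> t < 1 \<and> \<psi> t \<in> U n}" for n
    have bP: "bounded (P n)" for n
      by (rule bounded_subset[of "{0..1}"]) (auto simp: P_def)
    have dP: "ennreal (diameter (P n)) \<le> ennreal C * diam_pow s (U n)" for n
    proof (cases "P n = {}")
      case False
      then have ne: "U n \<noteq> {}" by (auto simp: P_def)
      have d0: "0 \<le> diameter (U n)" by (rule diameter_ge_0[OF U(2)])
      have "diameter (P n) \<le> C * diameter (U n) powr s'"
        unfolding diameter_def[of "P n"] if_not_P[OF False]
      proof (rule cSUP_least)
        show "P n \<times> P n \<noteq> {}" using False by simp
        fix z assume "z \<in> P n \<times> P n"
        then obtain t t' where z: "z = (t, t')" "t \<in> P n" "t' \<in> P n" by auto
        have "\<bar>t - t'\<bar> \<le> C * dist (\<psi> t) (\<psi> t') powr s'" using z by (intro \<psi>) (auto simp: P_def)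
        also have "\<dots> \<le> C * diameter (U n) powr s'"
          using z C s U(2) by (intro mult_left_mono powr_mono2 diameter_bounded_bound) (auto simp: P_def)
        finally show "(case z of (x, y) \<Rightarrow> dist x y) \<le> C * diameter (U n) powr s'" using z by (simp add: dist_real_def)
      qed
      also have "diameter (U n) powr s' \<le> (if s = 0 then 1 else diameter (U n) powr s)"
        using d0 U(3)[of n] s by (auto intro: powr_le1 powr_mono')
      finally have "diameter (P n) \<le> C * (if s = 0 then 1 else diameter (U n) powr s)"
        using C by simp
      then have "ennreal (diameter (P n)) \<le> ennreal (C * (if s = 0 then 1 else diameter (U n) powr s))"
        by (rule ennreal_leI)
      also have "\<dots> = ennreal C * diam_pow s (U n)"
        using C ne by (simp add: diam_pow_def ennreal_mult)
      finally show ?thesis .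
    qed simp
    have "ennreal (1 - 0) \<le> 2 * (\<Sum>n. ennreal (diameter (P n)))"
    proof (rule half_length_le_cover_diameters)
      show "{0..<1} \<subseteq> (\<Union>n. P n)"
      proof
        fix t :: real assume t: "t \<in> {0..<1}"
        then have "\<psi> t \<in> D" using D by auto
        then obtain n where "\<psi> t \<in> U n" using U(1) by blast
        then show "t \<in> (\<Union>n. P n)" using t by (auto simp: P_def)
      qed
    qed (rule bP)
    also have "\<dots> \<le> 2 * (\<Sum>n. ennreal C * diam_pow s (U n))"
      by (intro mult_left_mono suminf_le summableI dP) auto
    also have "\<dots> = ennreal (2 * C) * (\<Sum>n. diam_pow s (U n))"
      using C by (simp add: ennreal_mult mult.assoc)
    finally have *: "1 \<le> ennreal (2 * C) * (\<Sum>n. diam_pow s (U n))" by simp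
    have "ennreal (1 / (2 * C)) \<le> ennreal (1 / (2 * C)) * (ennreal (2 * C) * (\<Sum>n. diam_pow s (U n)))"
      using mult_left_mono[OF *, of "ennreal (1 / (2 * C))"] by simp
    also have "\<dots> = (\<Sum>n. diam_pow s (U n))"
      using C by (simp flip: ennreal_mult mult.assoc)
    finally show ?thesis .
  qed
  then have "ennreal (1 / (2 * C)) \<le> hausdorff_premeasure s 1 D"
    unfolding hausdorff_premeasure_def by (intro INF_greatest) auto
  also have "\<dots> \<le> hausdorff_measure s D"
    unfolding hausdorff_measure_def by (rule SUP_upper) auto
  finally show ?thesis using C
    by (metis divide_pos_pos ennreal_less_zero_iff less_le_trans mult_pos_pos zero_less_numeral zero_less_one)
qed

lemma hausdorff_measure_bounded_real_eq_0:
  fixes D :: "real set"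
  assumes D: "D \<subseteq> {0..R}" and s: "s > 1" and R: "R \<ge> 0"
  shows "hausdorff_measure s D = 0"
proof -
  have "hausdorff_premeasure s \<delta> D = 0" if \<delta>: "\<delta> > 0" for \<delta>
  proof -
    have ev: "eventually (\<lambda>n::nat. hausdorff_premeasure s \<delta> D \<le> ennreal (real n * (R / n) powr s)) sequentially"
    proof -
      have "(\<lambda>n::nat. R / real n) \<longlonglongrightarrow> 0" by (rule lim_const_over_n)
      then have "eventually (\<lambda>n::nat. R / n < \<delta>) sequentially"
        using \<delta> by (rule order_tendstoD)
      then show ?thesis using eventually_gt_at_top[of 0]
      proof eventually_elim
        case (elim n)
        define U where "U k = (if k < n then {R / n * k .. R / n * (k + 1)} else {})" for k :: nat
        have dU: "diameter (U k) = (if k < n then R / n else 0)" for k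
        proof -
          have "\<not> R / real n < 0" using R by (simp add: not_less)
          then show ?thesis by (auto simp: U_def distrib_left add_divide_distrib)
        qed
        have "D \<subseteq> (\<Union>k. U k)"
        proof
          fix x assume x: "x \<in> D"
          then have x: "0 \<le> x" "x \<le> R" using D by auto
          show "x \<in> (\<Union>k. U k)"
          proof (cases "x = R")
            case True
            then have "x \<in> U (n - 1)" using elim x by (auto simp: U_def field_simps of_nat_diff)
            then show ?thesis by blast
          next
            case False
            then have R0: "R > 0" "x < R" using x by auto
            define k where "k = nat \<lfloor>x * n / R\<rfloor>"
            have k: "real k \<le> x * n / R" "x * n / R < real k + 1"
              unfolding k_def using x R0 elim by (auto simp: of_nat_nat)
            have "x * n / R < n" using x R0 elim by (simp add: field_simps)
            then have "k < n" using k by linarith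
            then have "x \<in> U k" using k R0 elim by (auto simp: U_def field_simps)
            then show ?thesis by blast
          qed
        qed
        moreover have "\<forall>k. bounded (U k) \<and> diameter (U k) \<le> \<delta>"
          using dU elim \<delta> by (auto simp: U_def)
        ultimately have "hausdorff_premeasure s \<delta> D \<le> (\<Sum>k. diam_pow s (U k))"
          unfolding hausdorff_premeasure_def by (intro INF_lower) auto
        also have "\<dots> = (\<Sum>k<n. diam_pow s (U k))"
          by (rule suminf_finite) (auto simp: U_def diam_pow_def)
        also have "\<dots> \<le> (\<Sum>k<n. ennreal ((R / n) powr s))"
          by (rule sum_mono) (use s dU in \<open>auto simp: diam_pow_def\<close>)
        also have "\<dots> = ennreal (real n * (R / n) powr s)"
          by (simp add: ennreal_mult ennreal_of_nat_eq_real_of_nat)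
        finally show ?case .
      qed
    qed
    have "(\<lambda>n::nat. real n * (R / n) powr s) \<longlonglongrightarrow> 0"
    proof -
      have "(\<lambda>n::nat. R powr s * real n powr (1 - s)) \<longlonglongrightarrow> R powr s * 0"
        by (intro tendsto_intros tendsto_neg_powr filterlim_real_sequentially) (use s in auto)
      moreover have "eventually (\<lambda>n::nat. R powr s * real n powr (1 - s) = real n * (R / n) powr s) sequentially"
        using eventually_gt_at_top[of 0]
        by eventually_elim (use R in \<open>simp add: powr_divide powr_diff\<close>)
      ultimately show ?thesis by (simp add: tendsto_cong)
    qed
    then have "(\<lambda>n::nat. ennreal (real n * (R / n) powr s)) \<longlonglongrightarrow> ennreal 0"
      by (rule tendsto_ennrealI)
    then have "hausdorff_premeasure s \<delta> D \<le> ennreal 0"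
      using ev by (intro tendsto_lowerbound[where F=sequentially]) auto
    then show ?thesis by simp
  qed
  then show ?thesis unfolding hausdorff_measure_def by (simp add: image_constant_conv)
qed

lemma hausdorff_dim_eq_1I:
  fixes D :: "real set"
  assumes "D \<subseteq> {0..R}" "R \<ge> 0"
    and "\<And>s. 0 \<le> s \<Longrightarrow> s < 1 \<Longrightarrow> hausdorff_measure s D > 0"
  shows "hausdorff_dim D = 1"
proof (rule antisym)
  show "1 \<le> hausdorff_dim D"
    unfolding hausdorff_dim_def
  proof (rule Inf_greatest)
    fix x assume "x \<in> {ennreal s |s. 0 \<le> s \<and> hausdorff_measure s D = 0}"
    then obtain s where s: "x = ennreal s" "0 \<le> s" "hausdorff_measure s D = 0" by auto
    then have "s \<ge> 1" using assms(3)[of s] by force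
    then show "1 \<le> x" using s by simp
  qed
  show "hausdorff_dim D \<le> 1"
  proof (rule ennreal_le_epsilon)
    fix e :: real assume e: "0 < e"
    have "hausdorff_dim D \<le> ennreal (1 + e)"
      unfolding hausdorff_dim_def
    proof (rule Inf_lower)
      have "hausdorff_measure (1 + e) D = 0"
        using e by (intro hausdorff_measure_bounded_real_eq_0[OF assms(1) _ assms(2)]) auto
      then show "ennreal (1 + e) \<in> {ennreal s |s. 0 \<le> s \<and> hausdorff_measure s D = 0}"
        using e by (intro CollectI exI[of _ "1 + e"]) auto
    qed
    then show "hausdorff_dim D \<le> 1 + ennreal e" using e by (simp add: ennreal_plus)
  qed
qed

section \<open>Iterated function systems of planar similarities\<close>

text \<open>The triple \<open>(p, a, b)\<close> stands for \<open>z \<mapsto> a z + b\<close>, preceded by complex conjugation if \<open>p\<close>. Working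
  with triples rather than with functions makes the linear part \<open>(p, a)\<close> of a composition
  computable from the linear parts of its factors.\<close>

type_synonym planar_sim = "bool \<times> complex \<times> complex"

definition cnj_if :: "bool \<Rightarrow> complex \<Rightarrow> complex" where
  "cnj_if p z = (if p then cnj z else z)"

fun sim_app :: "planar_sim \<Rightarrow> complex \<Rightarrow> complex" where
  "sim_app (p, a, b) z = a * cnj_if p z + b"

fun sim_lin :: "planar_sim \<Rightarrow> bool \<times> complex" where
  "sim_lin (p, a, b) = (p, a)"

fun sim_comp :: "planar_sim \<Rightarrow> planar_sim \<Rightarrow> planar_sim" where
  "sim_comp (p, a, b) (q, c, d) = (p \<noteq> q, a * cnj_if p c, a * cnj_if p d + b)"

fun lin_comp :: "bool \<times> complex \<Rightarrow> bool \<times> complex \<Rightarrow> bool \<times> complex" where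
  "lin_comp (p, a) (q, c) = (p \<noteq> q, a * cnj_if p c)"

definition sim_ratio :: "planar_sim \<Rightarrow> real" where
  "sim_ratio f = norm (snd (sim_lin f))"

definition sim_id :: planar_sim where
  "sim_id = (False, 1, 0)"

lemma cnj_if_simps [simp]:
  "cnj_if False z = z" "cnj_if True z = cnj z" "norm (cnj_if p z) = norm z"
  "cnj_if p (z + w) = cnj_if p z + cnj_if p w" "cnj_if p (z - w) = cnj_if p z - cnj_if p w"
  "cnj_if p (z * w) = cnj_if p z * cnj_if p w" "cnj_if p 1 = 1" "cnj_if p 0 = 0"
  "cnj_if p (z ^ n) = cnj_if p z ^ n"
  by (auto simp: cnj_if_def)

lemma sim_app_comp: "sim_app (sim_comp f g) z = sim_app f (sim_app g z)"
  by (cases f; cases g) (auto simp: cnj_if_def algebra_simps)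

lemma sim_lin_comp: "sim_lin (sim_comp f g) = lin_comp (sim_lin f) (sim_lin g)"
  by (cases f; cases g) auto

lemma sim_comp_assoc: "sim_comp (sim_comp f g) h = sim_comp f (sim_comp g h)"
  by (cases f; cases g; cases h) (auto simp: cnj_if_def algebra_simps)

lemma sim_comp_id [simp]: "sim_comp sim_id f = f" "sim_comp f sim_id = f"
  by (cases f; auto simp: sim_id_def)+

lemma sim_app_id [simp]: "sim_app sim_id z = z"
  by (simp add: sim_id_def)

lemma sim_ratio_comp: "sim_ratio (sim_comp f g) = sim_ratio f * sim_ratio g"
  by (cases f; cases g) (auto simp: sim_ratio_def norm_mult)

lemma dist_sim_app: "dist (sim_app f z) (sim_app f w) = sim_ratio f * dist z w"
proof (cases f)
  case (fields p a b)
  have "sim_app f z - sim_app f w = a * cnj_if p (z - w)"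
    using fields by (simp add: algebra_simps)
  then show ?thesis using fields
    by (simp only: dist_norm norm_mult cnj_if_simps(3) sim_ratio_def sim_lin.simps snd_conv)
qed

text \<open>After normalisation to an isometry \<open>g\<close> with \<open>g 0 = 0\<close> and \<open>g 1 = 1\<close>, the distances to 0 and 1
  fix the real part and the square of the imaginary part of \<open>g z\<close>; the distance to \<open>g \<i>\<close> shows that
  the sign of the imaginary part does not depend on \<open>z\<close>.\<close>

lemma similarity_imp_sim_app:
  fixes f :: "complex \<Rightarrow> complex"
  assumes r: "r > 0" and f: "\<And>x y. dist (f x) (f y) = r * dist x y"
  obtains p a b where "norm a = r" "f = sim_app (p, a, b)"
proof -
  define b where "b = f 0"
  define a where "a = f 1 - b"
  have na: "norm a = r" using f[of 1 0] by (simp add: a_def b_def dist_norm)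
  then have a0: "a \<noteq> 0" using r by auto
  define g where "g z = (f z - b) / a" for z
  have g: "norm (g z - g w) = norm (z - w)" for z w
  proof -
    have "g z - g w = (f z - f w) / a" by (simp add: g_def diff_divide_distrib)
    then show ?thesis using f[of z w] na r by (simp add: norm_divide dist_norm)
  qed
  have g0: "g 0 = 0" by (simp add: g_def b_def)
  have g1: "g 1 = 1" using a0 by (simp add: g_def a_def)
  have sq: "(Re (g z - g w))\<^sup>2 + (Im (g z - g w))\<^sup>2 = (Re (z - w))\<^sup>2 + (Im (z - w))\<^sup>2" for z w
    using g[of z w] by (simp add: cmod_def)
  have Re: "Re (g z) = Re z" for z
    using sq[of z 0] sq[of z 1] g0 g1 by (simp add: power2_eq_square algebra_simps)
  have Im2: "(Im (g z))\<^sup>2 = (Im z)\<^sup>2" for z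
    using sq[of z 0] g0 Re[of z] by simp
  have Imi: "Im (g z) * Im (g w) = Im z * Im w" for z w
  proof -
    have "(Im (g z) - Im (g w))\<^sup>2 = (Im z - Im w)\<^sup>2"
      using sq[of z w] Re[of z] Re[of w] by simp
    then show ?thesis using Im2[of z] Im2[of w] by (simp add: power2_eq_square algebra_simps)
  qed
  have "Im (g \<i>) = 1 \<or> Im (g \<i>) = -1"
    using Im2[of \<i>] by (simp add: power2_eq_1_iff)
  then show thesis
  proof
    assume "Im (g \<i>) = 1"
    then have "g z = z" for z using Imi[of z \<i>] Re[of z] by (simp add: complex_eq_iff)
    then have "f z = sim_app (False, a, b) z" for z
      using a0 unfolding g_def by (simp add: field_simps)
    then show thesis using that na by blast
  next
    assume "Im (g \<i>) = -1"
    then have "g z = cnj z" for z using Imi[of z \<i>] Re[of z] by (simp add: complex_eq_iff)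
    then have "f z = sim_app (True, a, b) z" for z
      using a0 unfolding g_def by (simp add: field_simps)
    then show thesis using that na by blast
  qed
qed

definition to_complex :: "real ^ 2 \<Rightarrow> complex" where
  "to_complex x = Complex (x $ 1) (x $ 2)"

definition of_complex :: "complex \<Rightarrow> real ^ 2" where
  "of_complex z = vector [Re z, Im z]"

lemma to_of_complex [simp]: "to_complex (of_complex z) = z" "of_complex (to_complex x) = x"
  by (auto simp: to_complex_def of_complex_def vec_eq_iff forall_2)

lemma dist_to_complex [simp]: "dist (to_complex x) (to_complex y) = dist x y"
  by (simp add: to_complex_def dist_norm norm_vec_def L2_set_def sum_2 cmod_def)

lemma dist_of_complex [simp]: "dist (of_complex z) (of_complex w) = dist z w"
  using dist_to_complex[of "of_complex z" "of_complex w"] by simp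

fun sim_words :: "planar_sim set \<Rightarrow> nat \<Rightarrow> planar_sim set" where
  "sim_words F 0 = {sim_id}"
| "sim_words F (Suc n) = (\<lambda>(f, g). sim_comp f g) ` (F \<times> sim_words F n)"

definition sim_semigroup :: "planar_sim set \<Rightarrow> planar_sim set" where
  "sim_semigroup F = (\<Union>n. sim_words F n)"

text \<open>The setting of the theorem after transport to the complex plane.\<close>

locale planar_ifs =
  fixes F :: "planar_sim set" and K :: "complex set"
  assumes finite_F: "finite F"
    and ratio_F: "\<And>f. f \<in> F \<Longrightarrow> 0 < sim_ratio f \<and> sim_ratio f < 1"
    and compact_K: "compact K"
    and positive_length_K: "positive_length K"
    and invariant_K: "K = (\<Union>f\<in>F. sim_app f ` K)"

lemma planar_ifs_of_self_similar_set:
  fixes K :: "(real ^ 2) set"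
  assumes K: "self_similar_set K" and "hausdorff_measure 1 K > 0"
  obtains F where "planar_ifs F (to_complex ` K)"
proof -
  from K obtain N :: nat and S where c: "compact K"
    and S: "\<forall>i\<in>{1..N}. contracting_similarity (S i)" and KS: "K = (\<Union>i\<in>{1..N}. S i ` K)"
    unfolding self_similar_set_def by blast
  have "\<exists>f. 0 < sim_ratio f \<and> sim_ratio f < 1 \<and> (\<lambda>z. to_complex (S i (of_complex z))) = sim_app f"
    if i: "i \<in> {1..N}" for i
  proof -
    obtain r where r: "0 < r" "r < 1" "\<And>x y. dist (S i x) (S i y) = r * dist x y"
      using bspec[OF S i] unfolding contracting_similarity_def by auto
    obtain p a b where "norm a = r" "(\<lambda>z. to_complex (S i (of_complex z))) = sim_app (p, a, b)"
      by (rule similarity_imp_sim_app[of r "\<lambda>z. to_complex (S i (of_complex z))"]) (auto simp: r)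
    then show ?thesis using r by (intro exI[of _ "(p, a, b)"]) (auto simp: sim_ratio_def)
  qed
  then obtain f where f: "\<And>i. i \<in> {1..N} \<Longrightarrow> 0 < sim_ratio (f i) \<and> sim_ratio (f i) < 1 \<and>
      (\<lambda>z. to_complex (S i (of_complex z))) = sim_app (f i)" by metis
  have app: "sim_app (f i) (to_complex x) = to_complex (S i x)" if "i \<in> {1..N}" for i x
    using f[OF that] by (metis to_of_complex(2))
  have "planar_ifs (f ` {1..N}) (to_complex ` K)"
  proof
    show "compact (to_complex ` K)"
    proof (rule compact_continuous_image[OF _ c])
      show "continuous_on K to_complex"
        unfolding continuous_on_iff by (metis dist_to_complex)
    qed
    show "positive_length (to_complex ` K)"
      using positive_length_if_hausdorff_measure_pos[OF assms(2)]
      by (rule positive_length_image[where L = 1]) auto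
    have "(\<Union>g\<in>f ` {1..N}. sim_app g ` to_complex ` K) = (\<Union>i\<in>{1..N}. to_complex ` S i ` K)"
      unfolding image_image UN_simps by (intro SUP_cong refl image_cong app)
    also have "\<dots> = to_complex ` (\<Union>i\<in>{1..N}. S i ` K)" by blast
    finally show "to_complex ` K = (\<Union>g\<in>f ` {1..N}. sim_app g ` to_complex ` K)" using KS by simp
  qed (use f in auto)
  then show thesis by (rule that)
qed

lemma distance_set_to_complex: "distance_set (to_complex ` K) = distance_set K"
proof -
  have "{dist x y |x y. x \<in> f ` K \<and> y \<in> f ` K} = {dist (f x) (f y) |x y. x \<in> K \<and> y \<in> K}"
    for f :: "real ^ 2 \<Rightarrow> complex" by blast
  then show ?thesis unfolding distance_set_def by simp
qed

context planar_ifs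
begin

abbreviation "G \<equiv> sim_semigroup F"

definition "diam_K = diameter K"

lemma K_nonempty: "K \<noteq> {}"
  using positive_length_not_subset_singleton[OF positive_length_K] by auto

lemma F_nonempty: "F \<noteq> {}"
  using K_nonempty invariant_K by auto

lemma bounded_K: "bounded K"
  by (rule compact_imp_bounded[OF compact_K])

lemma dist_le_diam_K: "x \<in> K \<Longrightarrow> y \<in> K \<Longrightarrow> dist x y \<le> diam_K"
  unfolding diam_K_def by (rule diameter_bounded_bound[OF bounded_K])

lemma diam_K_nonneg: "0 \<le> diam_K"
  unfolding diam_K_def by (rule diameter_ge_0[OF bounded_K])

lemma two_points_K: obtains x y where "x \<in> K" "y \<in> K" "x \<noteq> y"
proof -
  obtain x where "x \<in> K" using K_nonempty by auto
  with positive_length_not_subset_singleton[OF positive_length_K, of x] that show thesis by blast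
qed

lemma sim_words_cover: "K = (\<Union>f\<in>sim_words F n. sim_app f ` K)"
proof (induction n)
  case (Suc n)
  have "K = (\<Union>f\<in>F. sim_app f ` K)" by (rule invariant_K)
  also have "\<dots> = (\<Union>f\<in>F. sim_app f ` (\<Union>g\<in>sim_words F n. sim_app g ` K))"
    using Suc by simp
  also have "\<dots> = (\<Union>f\<in>F. \<Union>g\<in>sim_words F n. sim_app (sim_comp f g) ` K)"
    by (simp add: image_UN image_image sim_app_comp)
  also have "\<dots> = (\<Union>f\<in>sim_words F (Suc n). sim_app f ` K)"
  proof (intro equalityI subsetI)
    fix x assume "x \<in> (\<Union>f\<in>F. \<Union>g\<in>sim_words F n. sim_app (sim_comp f g) ` K)"
    then obtain f g where fg: "f \<in> F" "g \<in> sim_words F n" "x \<in> sim_app (sim_comp f g) ` K" by blast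
    then have "sim_comp f g \<in> sim_words F (Suc n)" by force
    then show "x \<in> (\<Union>f\<in>sim_words F (Suc n). sim_app f ` K)" using fg(3) by blast
  next
    fix x assume "x \<in> (\<Union>f\<in>sim_words F (Suc n). sim_app f ` K)"
    then obtain h where h: "h \<in> sim_words F (Suc n)" "x \<in> sim_app h ` K" by blast
    then obtain f g where "f \<in> F" "g \<in> sim_words F n" "h = sim_comp f g" by force
    then show "x \<in> (\<Union>f\<in>F. \<Union>g\<in>sim_words F n. sim_app (sim_comp f g) ` K)"
      using h(2) by blast
  qed
  finally show ?case .
qed simp

lemma finite_sim_words: "finite (sim_words F n)"
  by (induction n) (auto simp: finite_F)

lemma sim_words_subset_G: "sim_words F n \<subseteq> G"
  unfolding sim_semigroup_def by auto

lemma F_subset_G: "F \<subseteq> G"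
proof -
  have "F \<subseteq> sim_words F (Suc 0)" by force
  then show ?thesis using sim_words_subset_G by blast
qed

lemma sim_id_in_G: "sim_id \<in> G"
  using sim_words_subset_G[of 0] by simp

lemma sim_words_comp: "f \<in> sim_words F m \<Longrightarrow> g \<in> sim_words F n \<Longrightarrow> sim_comp f g \<in> sim_words F (m + n)"
proof (induction m arbitrary: f)
  case (Suc m)
  from Suc.prems(1) obtain fg where "fg \<in> F \<times> sim_words F m" "f = (case fg of (f, g) \<Rightarrow> sim_comp f g)"
    unfolding sim_words.simps by (rule imageE)
  then obtain f1 f2 where "f = sim_comp f1 f2" "f1 \<in> F" "f2 \<in> sim_words F m"
    by (cases fg) simp
  moreover have "sim_comp f2 g \<in> sim_words F (m + n)"
    by (rule Suc.IH) fact+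
  ultimately show ?case by (force simp: sim_comp_assoc)
qed simp

lemma G_comp: "f \<in> G \<Longrightarrow> g \<in> G \<Longrightarrow> sim_comp f g \<in> G"
  unfolding sim_semigroup_def UN_iff by (metis UNIV_I sim_words_comp)

lemma G_induct [consumes 1, case_names id comp]:
  assumes "f \<in> G" "P sim_id" "\<And>f g. f \<in> F \<Longrightarrow> g \<in> G \<Longrightarrow> P g \<Longrightarrow> P (sim_comp f g)"
  shows "P f"
proof -
  obtain n where "f \<in> sim_words F n" using assms(1) unfolding sim_semigroup_def by auto
  then show ?thesis
  proof (induction n arbitrary: f)
    case (Suc n)
    then obtain f1 f2 where "f = sim_comp f1 f2" "f1 \<in> F" "f2 \<in> sim_words F n" by auto
    then show ?case using assms(3)[of f1 f2] sim_words_subset_G Suc.IH[of f2] by blast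
  qed (use assms in auto)
qed

lemma G_app: "f \<in> G \<Longrightarrow> x \<in> K \<Longrightarrow> sim_app f x \<in> K"
  unfolding sim_semigroup_def using sim_words_cover by blast

lemma G_ratio: assumes "f \<in> G" shows "0 < sim_ratio f" "sim_ratio f \<le> 1"
proof -
  have "0 < sim_ratio f \<and> sim_ratio f \<le> 1" using assms
  proof (induction rule: G_induct)
    case id
    show ?case by (simp add: sim_id_def sim_ratio_def)
  next
    case (comp f g)
    then show ?case using ratio_F[of f] by (auto simp: sim_ratio_comp intro: mult_le_one)
  qed
  then show "0 < sim_ratio f" "sim_ratio f \<le> 1" by auto
qed

lemma sim_words_ratio_le:
  obtains R where "0 < R" "R < 1" "\<And>n f. f \<in> sim_words F n \<Longrightarrow> sim_ratio f \<le> R ^ n"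
proof -
  define R where "R = Max (sim_ratio ` F)"
  have "R \<in> sim_ratio ` F" unfolding R_def using finite_F F_nonempty by (intro Max_in) auto
  then have R: "0 < R" "R < 1" using ratio_F by auto
  have RF: "sim_ratio f \<le> R" if "f \<in> F" for f
    unfolding R_def using finite_F that by (intro Max_ge) auto
  have "sim_ratio f \<le> R ^ n" if "f \<in> sim_words F n" for f n
    using that
  proof (induction n arbitrary: f)
    case (Suc n)
    then obtain f1 f2 where f: "f = sim_comp f1 f2" "f1 \<in> F" "f2 \<in> sim_words F n" by auto
    have "0 < sim_ratio f2" using f sim_words_subset_G G_ratio(1) by blast
    then have "sim_ratio f1 * sim_ratio f2 \<le> R * R ^ n"
      using RF[OF f(2)] Suc.IH[OF f(3)] R by (intro mult_mono) auto
    then show ?case using f by (simp add: sim_ratio_comp)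
  qed (simp add: sim_ratio_def sim_id_def)
  with R that show thesis by blast
qed

lemma G_power:
  assumes "(False, a, b) \<in> G"
  shows "\<exists>b'. (False, a ^ n, b') \<in> G"
proof (induction n)
  case 0
  then show ?case using sim_id_in_G by (auto simp: sim_id_def)
next
  case (Suc n)
  then obtain b' where "(False, a ^ n, b') \<in> G" by blast
  from G_comp[OF assms this] show ?case by auto
qed

end

section \<open>Rotations and close pairs\<close>

text \<open>Rotations of infinite order, that is, by an irrational multiple of \<open>\<pi>\<close>.\<close>

definition non_torsion :: "complex \<Rightarrow> bool" where
  "non_torsion \<zeta> \<longleftrightarrow> norm \<zeta> = 1 \<and> (\<forall>m>0. \<zeta> ^ m \<noteq> 1)"

text \<open>Dirichlet approximation of the angle by multiples of \<open>2 \<pi>\<close>; the angle \<open>\<beta>\<close> is not 0 because the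
  rotation has infinite order.\<close>

lemma non_torsion_power_near_1:
  assumes "non_torsion \<zeta>" and \<eta>: "\<eta> > 0"
  obtains q \<beta> where "\<zeta> ^ q = cis \<beta>" "\<beta> \<noteq> 0" "\<bar>\<beta>\<bar> < \<eta>"
proof -
  have \<zeta>: "norm \<zeta> = 1" "\<And>m. m > 0 \<Longrightarrow> \<zeta> ^ m \<noteq> 1"
    using assms(1) unfolding non_torsion_def by auto
  define \<theta> where "\<theta> = Arg \<zeta>"
  have z: "\<zeta> = cis \<theta>" using \<zeta>(1) by (metis \<theta>_def complex_eqI cis_Arg norm_zero sgn_eq zero_neq_one div_by_1 of_real_1)
  obtain N :: nat where N: "2 * pi / \<eta> < N" using reals_Archimedean2 by blast
  then have N0: "N > 0" using \<eta> by (metis divide_pos_pos gr0I less_asym mult_pos_pos of_nat_0 pi_gt_zero zero_less_numeral)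
  obtain h k :: int where hk: "0 < k" "\<bar>of_int k * (\<theta> / (2 * pi)) - of_int h\<bar> < 1 / N"
    using Dirichlet_approx[OF N0] by metis
  define \<beta> where "\<beta> = of_int k * \<theta> - 2 * pi * of_int h"
  have "\<beta> = 2 * pi * (of_int k * (\<theta> / (2 * pi)) - of_int h)"
    by (simp add: \<beta>_def field_simps)
  then have "\<bar>\<beta>\<bar> = 2 * pi * \<bar>of_int k * (\<theta> / (2 * pi)) - of_int h\<bar>"
    by (simp add: abs_mult)
  also have "\<dots> < 2 * pi * (1 / N)" using hk by (intro mult_strict_left_mono) auto
  also have "\<dots> < \<eta>" using N N0 \<eta> by (simp add: field_simps)
  finally have b: "\<bar>\<beta>\<bar> < \<eta>" .
  have "\<zeta> ^ nat k = cis (of_int k * \<theta>)" unfolding z Complex.DeMoivre using hk by simp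
  also have "\<dots> = cis \<beta> * cis (2 * pi * of_int h)" by (simp only: cis_mult \<beta>_def diff_add_cancel)
  also have "cis (2 * pi * of_int h) = 1" by (simp add: cis_multiple_2pi)
  finally have c: "\<zeta> ^ nat k = cis \<beta>" by simp
  have "\<zeta> ^ nat k \<noteq> 1" using \<zeta>(2)[of "nat k"] hk by simp
  then have "\<beta> \<noteq> 0" using c by auto
  with b c that show thesis by blast
qed

lemma strip_sin_bound:
  assumes "norm u = 1" "\<bar>Re (u * cis x)\<bar> \<le> l" "\<bar>Re (u * cis y)\<bar> \<le> l"
  shows "\<bar>sin (x - y)\<bar> \<le> 2 * l"
proof -
  obtain t where u: "u = cis t"
    using assms(1) by (metis complex_norm_eq_1_exp cis_conv_exp)
  have c: "\<bar>cos (t + x)\<bar> \<le> l" "\<bar>cos (t + y)\<bar> \<le> l" using assms u by (simp_all add: cis_mult)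
  have "sin (x - y) = sin ((t + x) - (t + y))" by simp
  also have "\<dots> = sin (t + x) * cos (t + y) - cos (t + x) * sin (t + y)" by (rule sin_diff)
  also have "\<bar>\<dots>\<bar> \<le> \<bar>sin (t + x)\<bar> * \<bar>cos (t + y)\<bar> + \<bar>cos (t + x)\<bar> * \<bar>sin (t + y)\<bar>"
    by (metis abs_mult abs_triangle_ineq4)
  also have "\<dots> \<le> 1 * l + l * 1" using c by (intro add_mono mult_mono) auto
  finally show ?thesis by simp
qed

lemma sin_ge_half:
  fixes x :: real
  assumes "0 < x" "x \<le> 1" shows "x / 2 < sin x"
proof -
  have "\<exists>z>0. z < x \<and> sin x - sin 0 = (x - 0) * cos z"
    using MVT2[OF assms(1), of sin cos] by auto
  then obtain z where z: "0 < z" "z < x" "sin x = x * cos z" by auto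
  have "cos (pi / 3) < cos z"
    using z assms pi_gt3 by (intro cos_monotone_0_pi) auto
  then have "1 / 2 < cos z" by (simp add: cos_60)
  then show ?thesis using z assms by simp
qed

text \<open>The quantitative equidistribution that replaces averaging over all directions: the orbit visits
  the strip \<open>\<bar>Re z\<bar> \<le> l\<close> with frequency \<open>O(l)\<close>, with an error that does not depend on the starting
  point. The reason is that about \<open>1 / (5 l)\<close> rotated copies of the strip, by powers of \<open>\<zeta>\<close>, are
  disjoint on the unit circle, so that their numbers of visits add up to at most \<open>n\<close>, while each copy
  receives as many visits as the strip itself up to a bounded delay.\<close>

lemma rotation_strip_frequency:
  assumes \<zeta>: "non_torsion \<zeta>" and l: "l > 0"
  shows "\<exists>L. \<forall>u n. norm u = 1 \<longrightarrow> real (card {j. j < n \<and> \<bar>Re (u * \<zeta> ^ j)\<bar> \<le> l}) \<le> 5 * l * real n + L"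
proof -
  obtain q \<beta> where q: "\<zeta> ^ q = cis \<beta>" "\<beta> \<noteq> 0" "\<bar>\<beta>\<bar> < l"
    by (rule non_torsion_power_near_1[OF \<zeta> l])
  \<comment> \<open>The copies of the strip are spaced by the angle \<open>g \<beta>\<close>, which lies between \<open>4 l\<close> and \<open>5 l\<close>:
    large enough for disjointness, and small enough for \<open>m\<close> copies to fit into an angle of 1.\<close>
  define g where "g = nat \<lfloor>4 * l / \<bar>\<beta>\<bar>\<rfloor> + 1"
  have g: "4 * l / \<bar>\<beta>\<bar> < real g" "real g \<le> 4 * l / \<bar>\<beta>\<bar> + 1"
    using l q unfolding g_def by (auto simp: of_nat_nat) linarith+
  have g1: "4 * l < real g * \<bar>\<beta>\<bar>" using g q by (simp add: field_simps)
  have g2: "real g * \<bar>\<beta>\<bar> \<le> 5 * l"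
  proof -
    have "real g * \<bar>\<beta>\<bar> \<le> (4 * l / \<bar>\<beta>\<bar> + 1) * \<bar>\<beta>\<bar>" using g by (intro mult_right_mono) auto
    also have "\<dots> = 4 * l + \<bar>\<beta>\<bar>" using q by (simp add: field_simps)
    finally show ?thesis using q by simp
  qed
  define m where "m = nat \<lfloor>1 / (5 * l)\<rfloor> + 1"
  have m: "1 / (5 * l) \<le> real m" "real m - 1 \<le> 1 / (5 * l)"
    using l unfolding m_def by (auto simp: of_nat_nat) linarith+
  have m0: "m > 0" by (simp add: m_def)
  have step: False if u: "norm u = 1" and i: "i < i'" "i' < m"
    and k: "j + q * g * i = j' + q * g * i'" "\<bar>Re (u * \<zeta> ^ j)\<bar> \<le> l" "\<bar>Re (u * \<zeta> ^ j')\<bar> \<le> l" for u i i' j j'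
  proof -
    define d where "d = i' - i"
    have d: "d > 0" "i' = i + d" using i by (auto simp: d_def)
    have "j = j' + q * (g * d)" using k(1) d by (simp add: algebra_simps)
    then have "\<zeta> ^ j = \<zeta> ^ j' * (\<zeta> ^ q) ^ (g * d)" by (simp add: power_add power_mult)
    also have "\<dots> = \<zeta> ^ j' * cis (real (g * d) * \<beta>)" by (simp only: q(1) Complex.DeMoivre)
    finally have zj: "\<zeta> ^ j = \<zeta> ^ j' * cis (real (g * d) * \<beta>)" .
    define x where "x = real (g * d) * \<bar>\<beta>\<bar>"
    have "norm (u * \<zeta> ^ j') = 1" using u \<zeta> by (simp add: norm_mult norm_power non_torsion_def)
    then have "\<bar>sin (real (g * d) * \<beta> - 0)\<bar> \<le> 2 * l"
      by (rule strip_sin_bound) (use k zj in \<open>auto simp: mult.assoc\<close>)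
    then have s: "\<bar>sin x\<bar> \<le> 2 * l" by (cases "\<beta> \<ge> 0") (auto simp: x_def)
    have xd: "x = real d * (real g * \<bar>\<beta>\<bar>)" by (simp add: x_def)
    have x1: "4 * l < x"
    proof -
      have "1 * (real g * \<bar>\<beta>\<bar>) \<le> real d * (real g * \<bar>\<beta>\<bar>)" using d by (intro mult_right_mono) auto
      then show ?thesis using g1 xd by simp
    qed
    have "x \<le> real d * (5 * l)" unfolding xd using g2 by (intro mult_left_mono) auto
    also have "\<dots> \<le> (1 / (5 * l)) * (5 * l)"
      using m d i l by (intro mult_right_mono) auto
    finally have x2: "x \<le> 1" using l by simp
    have "x / 2 < sin x" using x1 x2 l by (intro sin_ge_half) auto
    then show False using s x1 by linarith
  qed
  have "real (card {j. j < n \<and> \<bar>Re (u * \<zeta> ^ j)\<bar> \<le> l}) \<le> 5 * l * real n + real (q * g)"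
    if u: "norm u = 1" for u n
  proof -
    define J where "J = {j. j < n \<and> \<bar>Re (u * \<zeta> ^ j)\<bar> \<le> l}"
    have fJ: "finite J" by (simp add: J_def)
    have "inj_on (\<lambda>(i, j). j + q * g * i) ({..<m} \<times> J)"
    proof (rule inj_onI, clarsimp)
      fix i j i' j' assume a: "i < m" "j \<in> J" "i' < m" "j' \<in> J" "j + q * g * i = j' + q * g * i'"
      have "\<not> i < i'" using step[OF u, of i i' j j'] a by (auto simp: J_def)
      moreover have "\<not> i' < i" using step[OF u, of i' i j' j] a by (auto simp: J_def)
      ultimately show "i = i' \<and> j = j'" using a by auto
    qed
    then have "card ({..<m} \<times> J) = card ((\<lambda>(i, j). j + q * g * i) ` ({..<m} \<times> J))"
      by (simp add: card_image)
    also have "\<dots> \<le> card {..<n + q * g * m}"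
    proof (rule card_mono)
      have "j + q * g * i < n + q * g * m" if "j < n" "i < m" for i j
        using that by (intro add_less_le_mono mult_le_mono) auto
      then show "(\<lambda>(i, j). j + q * g * i) ` ({..<m} \<times> J) \<subseteq> {..<n + q * g * m}"
        by (auto simp: J_def)
    qed simp
    finally have "m * card J \<le> n + q * g * m" by (simp add: card_cartesian_product)
    then have "real m * real (card J) \<le> real n + real (q * g) * real m"
      by (metis of_nat_add of_nat_le_iff of_nat_mult)
    then have "real (card J) \<le> real n / real m + real (q * g)"
      using m0 by (simp add: field_simps)
    also have "real n / real m \<le> real n * (5 * l)"
    proof -
      have "1 / real m \<le> 5 * l" using m(1) m0 l by (simp add: field_simps)
      then have "real n * (1 / real m) \<le> real n * (5 * l)" by (intro mult_left_mono) auto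
      then show ?thesis by simp
    qed
    finally show ?thesis by (simp add: J_def mult.commute)
  qed
  then show ?thesis by blast
qed

text \<open>There are only countably many roots of unity.\<close>

lemma ex_non_torsion: "\<exists>\<zeta>. non_torsion \<zeta>"
proof -
  have "countable (\<Union>m\<in>{0<..}. {z::complex. z ^ m = 1})"
    by (intro countable_UN countableI_type countable_finite) (auto intro!: finite_roots_unity)
  moreover have "uncountable (sphere (0::complex) 1)"
    by (rule connected_uncountable[of _ 1 "-1"]) (auto intro: connected_sphere)
  ultimately obtain z where "z \<in> sphere 0 1" "z \<notin> (\<Union>m\<in>{0<..}. {z::complex. z ^ m = 1})"
    by (meson countable_subset subsetI)
  then show ?thesis by (intro exI[of _ z]) (auto simp: non_torsion_def)
qed

abbreviation close_pairs :: "complex set \<Rightarrow> complex \<Rightarrow> real \<Rightarrow> real" where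
  "close_pairs L u \<rho> \<equiv> real (card {(x, y) \<in> L \<times> L. \<bar>Re (u * (x - y))\<bar> < \<rho>})"

lemma maximal_separated_subset:
  fixes t :: "'a \<Rightarrow> 'b::metric_space"
  assumes "finite B" "\<sigma> > 0"
  shows "\<exists>S\<subseteq>B. (\<forall>x\<in>S. \<forall>y\<in>S. x \<noteq> y \<longrightarrow> \<sigma> \<le> dist (t x) (t y)) \<and> (\<forall>x\<in>B. \<exists>s\<in>S. dist (t x) (t s) < \<sigma>)"
  using assms(1)
proof (induction B)
  case (insert b B)
  then obtain S where S: "S \<subseteq> B" "\<forall>x\<in>S. \<forall>y\<in>S. x \<noteq> y \<longrightarrow> \<sigma> \<le> dist (t x) (t y)"
    "\<forall>x\<in>B. \<exists>s\<in>S. dist (t x) (t s) < \<sigma>" by blast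
  show ?case
  proof (cases "\<exists>s\<in>S. dist (t b) (t s) < \<sigma>")
    case True
    then show ?thesis using S by (intro exI[of _ S]) auto
  next
    case False
    then show ?thesis using S assms(2)
      by (intro exI[of _ "insert b S"]) (auto simp: not_less dist_commute)
  qed
qed auto

text \<open>Group the points around a maximal separated subset \<open>S\<close>. Two points of the same group are close,
  and by the Cauchy-Schwarz inequality few groups would produce many such pairs.\<close>

lemma separated_subset_from_close_pairs:
  fixes t :: "'a \<Rightarrow> 'b::metric_space"
  assumes B: "finite B" and \<sigma>: "\<sigma> > 0"
  shows "\<exists>S\<subseteq>B. (\<forall>x\<in>S. \<forall>y\<in>S. x \<noteq> y \<longrightarrow> \<sigma> \<le> dist (t x) (t y)) \<and>
     (real (card B))\<^sup>2 \<le> real (card S) * real (card {(x, y) \<in> B \<times> B. dist (t x) (t y) < 2 * \<sigma>})"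
proof -
  obtain S where S: "S \<subseteq> B" "\<forall>x\<in>S. \<forall>y\<in>S. x \<noteq> y \<longrightarrow> \<sigma> \<le> dist (t x) (t y)"
    "\<forall>x\<in>B. \<exists>s\<in>S. dist (t x) (t s) < \<sigma>"
    using maximal_separated_subset[OF B \<sigma>, of t] by blast
  then obtain h where h: "\<And>x. x \<in> B \<Longrightarrow> h x \<in> S \<and> dist (t x) (t (h x)) < \<sigma>" by metis
  have fS: "finite S" using S B finite_subset by blast
  define c where "c s = {x \<in> B. h x = s}" for s
  have fc: "finite (c s)" for s using B by (simp add: c_def)
  have "card B = card (\<Union>s\<in>S. c s)"
    by (rule arg_cong[of _ _ card]) (use h in \<open>auto simp: c_def\<close>)
  also have "\<dots> = (\<Sum>s\<in>S. card (c s))"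
    by (rule card_UN_disjoint) (use fS fc in \<open>auto simp: c_def\<close>)
  finally have cB: "real (card B) = (\<Sum>s\<in>S. real (card (c s)))" by simp
  have "(real (card B))\<^sup>2 \<le> (\<Sum>s\<in>S. (real (card (c s)))\<^sup>2) * real (card S)"
    unfolding cB by (rule sum_squared_le_sum_of_squares)
  also have "(\<Sum>s\<in>S. (real (card (c s)))\<^sup>2) = real (\<Sum>s\<in>S. card (c s \<times> c s))"
    by (simp add: card_cartesian_product power2_eq_square)
  also have "(\<Sum>s\<in>S. card (c s \<times> c s)) = card (\<Union>s\<in>S. c s \<times> c s)"
    by (rule card_UN_disjoint[symmetric]) (use fS fc in \<open>auto simp: c_def\<close>)
  also have "\<dots> \<le> card {(x, y) \<in> B \<times> B. dist (t x) (t y) < 2 * \<sigma>}"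
  proof (rule card_mono)
    show "finite {(x, y) \<in> B \<times> B. dist (t x) (t y) < 2 * \<sigma>}"
      by (rule finite_subset[of _ "B \<times> B"]) (use B in auto)
    have "dist (t x) (t y) < 2 * \<sigma>" if "x \<in> B" "y \<in> B" "h x = h y" for x y
      using h[OF that(1)] h[OF that(2)] that(3) dist_triangle2[of "t x" "t y" "t (h y)"] by simp
    then show "(\<Union>s\<in>S. c s \<times> c s) \<subseteq> {(x, y) \<in> B \<times> B. dist (t x) (t y) < 2 * \<sigma>}"
      by (auto simp: c_def)
  qed
  finally have "(real (card B))\<^sup>2 \<le> real (card {(x, y) \<in> B \<times> B. dist (t x) (t y) < 2 * \<sigma>}) * real (card S)"
    by (simp add: mult_right_mono)
  then show ?thesis using S by (intro exI[of _ S]) (simp add: mult.commute)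
qed

lemma prod_le_power_of_average:
  fixes E :: "nat \<Rightarrow> real" and A :: real
  assumes E: "\<And>j. j < N \<Longrightarrow> 0 \<le> E j" and A: "(\<Sum>j<N. E j) \<le> N * A"
  shows "(\<Prod>j<N. E j) \<le> A ^ N"
proof (cases "N = 0")
  case False
  have "(\<Prod>j<N. E j) powr (1 / N) \<le> (\<Sum>j<N. E j / N)"
    using arith_geom_mean[of "{..<N}" E] E False by (auto simp: lessThan_empty_iff)
  also have "\<dots> \<le> A" using A False by (simp add: sum_divide_distrib[symmetric] field_simps)
  finally have "((\<Prod>j<N. E j) powr (1 / N)) ^ N \<le> A ^ N" by (intro power_mono) auto
  moreover have "((\<Prod>j<N. E j) powr (1 / N)) ^ N = (\<Prod>j<N. E j)"
  proof (cases "(\<Prod>j<N. E j) = 0")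
    case False
    then have "(\<Prod>j<N. E j) > 0" using E by (metis lessThan_iff less_eq_real_def prod_nonneg)
    then have "((\<Prod>j<N. E j) powr (1 / N)) ^ N = ((\<Prod>j<N. E j) powr (1 / N)) powr N"
      by (intro powr_realpow[symmetric]) (simp only: powr_gt_zero)
    with \<open>(\<Prod>j<N. E j) > 0\<close> show ?thesis using \<open>N \<noteq> 0\<close> by (simp add: powr_powr)
  next
    case True
    then show ?thesis unfolding True using \<open>N \<noteq> 0\<close> by simp
  qed
  ultimately show ?thesis by simp
qed simp

section \<open>Homogeneous families of words\<close>

lemma power_times_geometric_tendsto_0:
  fixes x :: real
  assumes "0 < x" "x < 1"
  shows "(\<lambda>n. (real n + 1) ^ k * x ^ n) \<longlonglongrightarrow> 0"
proof (cases "k = 0")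
  case True
  then show ?thesis using assms by (simp add: LIMSEQ_realpow_zero)
next
  case False
  define y where "y = root k x"
  have y: "0 < y" "y < 1" "y ^ k = x" using assms False by (auto simp: y_def)
  have "(\<lambda>n. real n * y ^ n + y ^ n) \<longlonglongrightarrow> 0 + 0"
    using y by (intro tendsto_add powser_times_n_limit_0 LIMSEQ_realpow_zero) auto
  then have "(\<lambda>n. (real n * y ^ n + y ^ n) ^ k) \<longlonglongrightarrow> 0 ^ k" by (intro tendsto_power) simp
  moreover have "(real n * y ^ n + y ^ n) ^ k = (real n + 1) ^ k * x ^ n" for n
  proof -
    have "(real n * y ^ n + y ^ n) ^ k = ((real n + 1) * y ^ n) ^ k" by (simp add: algebra_simps)
    also have "\<dots> = (real n + 1) ^ k * x ^ n"
      by (simp add: power_mult_distrib y(3)[symmetric] flip: power_mult) (simp add: mult.commute)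
    finally show ?thesis .
  qed
  ultimately show ?thesis using False by (simp add: zero_power)
qed

context planar_ifs
begin

text \<open>Composing with a conjugating map exchanges the roles of the exponents \<open>P\<close> and \<open>Q\<close>, so the linear
  part of a word is always a monomial of this kind even though the linear parts need not commute.\<close>

lemma linear_parts_of_words:
  "snd ` sim_lin ` sim_words F n \<subseteq>
     (\<lambda>(P, Q). \<Prod>g\<in>F. snd (sim_lin g) ^ P g * cnj (snd (sim_lin g)) ^ Q g) ` ((F \<rightarrow>\<^sub>E {..n}) \<times> (F \<rightarrow>\<^sub>E {..n}))"
proof (induction n)
  case 0
  have "(\<Prod>g\<in>F. snd (sim_lin g) ^ (\<lambda>g\<in>F. 0) g * cnj (snd (sim_lin g)) ^ (\<lambda>g\<in>F. 0) g) = 1"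
    by (rule prod.neutral) simp
  then show ?case
    by (auto simp: sim_id_def image_iff intro!: bexI[of _ "\<lambda>g\<in>F. 0"])
next
  case (Suc n)
  let ?m = "\<lambda>P Q. \<Prod>g\<in>F. snd (sim_lin g) ^ P g * cnj (snd (sim_lin g)) ^ Q g"
  have up: "snd (sim_lin g) * ?m P Q = ?m (P(g := Suc (P g))) Q" if "g \<in> F" for g P Q
    using that finite_F by (simp add: prod.remove[OF finite_F that] mult_ac)
  have cn: "cnj (?m P Q) = ?m Q P" for P Q by (simp add: mult.commute)
  show ?case
  proof
    fix a assume "a \<in> snd ` sim_lin ` sim_words F (Suc n)"
    then obtain fg where fg: "fg \<in> F \<times> sim_words F n"
      "a = snd (sim_lin (case fg of (f, g) \<Rightarrow> sim_comp f g))"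
      unfolding sim_words.simps by blast
    obtain f g where f: "f \<in> F" "g \<in> sim_words F n" "a = snd (sim_lin (sim_comp f g))"
      using fg by (cases fg) (simp only: mem_Times_iff case_prod_conv fst_conv snd_conv, blast)
    then have "snd (sim_lin g) \<in> (\<lambda>(P, Q). ?m P Q) ` ((F \<rightarrow>\<^sub>E {..n}) \<times> (F \<rightarrow>\<^sub>E {..n}))"
      using Suc.IH by blast
    then obtain P Q where PQ: "P \<in> F \<rightarrow>\<^sub>E {..n}" "Q \<in> F \<rightarrow>\<^sub>E {..n}" "snd (sim_lin g) = ?m P Q" by auto
    have "\<exists>P Q. P \<in> F \<rightarrow>\<^sub>E {..n} \<and> Q \<in> F \<rightarrow>\<^sub>E {..n} \<and> a = snd (sim_lin f) * ?m P Q"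
    proof (cases "fst (sim_lin f)")
      case True
      then have "a = snd (sim_lin f) * cnj (?m P Q)"
        using f(3) PQ(3) by (cases f; cases g) simp
      then have "a = snd (sim_lin f) * ?m Q P" by (simp only: cn)
      then show ?thesis by (intro exI[of _ Q] exI[of _ P] conjI PQ(1,2))
    next
      case False
      then have "a = snd (sim_lin f) * ?m P Q"
        using f(3) PQ(3) by (cases f; cases g) simp
      then show ?thesis by (intro exI[of _ P] exI[of _ Q] conjI PQ(1,2))
    qed
    then obtain P Q where PQ: "P \<in> F \<rightarrow>\<^sub>E {..n}" "Q \<in> F \<rightarrow>\<^sub>E {..n}" "a = snd (sim_lin f) * ?m P Q" by blast
    have "a = ?m (P(f := Suc (P f))) Q" using up[OF f(1)] PQ(3) by simp
    moreover have "P(f := Suc (P f)) \<in> F \<rightarrow>\<^sub>E {..Suc n}"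
    proof (rule PiE_I)
      fix x assume "x \<in> F"
      then have "P x \<le> n" "P f \<le> n" using PiE_mem[OF PQ(1)] f(1) by blast+
      then show "(P(f := Suc (P f))) x \<in> {..Suc n}" by simp
    next
      fix x assume "x \<notin> F"
      then show "(P(f := Suc (P f))) x = undefined" using PiE_arb[OF PQ(1)] f(1) by auto
    qed
    moreover have "Q \<in> F \<rightarrow>\<^sub>E {..Suc n}"
      using PiE_mono[of F "\<lambda>_. {..n}" "\<lambda>_. {..Suc n}"] PQ(2) by auto
    ultimately show "a \<in> (\<lambda>(P, Q). ?m P Q) ` ((F \<rightarrow>\<^sub>E {..Suc n}) \<times> (F \<rightarrow>\<^sub>E {..Suc n}))"
      by (intro image_eqI[of _ _ "(P(f := Suc (P f)), Q)"]) auto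
  qed
qed

lemma card_linear_parts_of_words: "card (sim_lin ` sim_words F n) \<le> 2 * (n + 1) ^ (2 * card F)"
proof -
  define X where "X = (F \<rightarrow>\<^sub>E {..n}) \<times> (F \<rightarrow>\<^sub>E {..n})"
  have fX: "finite X" unfolding X_def using finite_F by (intro finite_cartesian_product finite_PiE) auto
  have cX: "card X = (n + 1) ^ (2 * card F)"
    unfolding X_def using finite_F
    by (simp add: card_cartesian_product card_PiE power_add[symmetric] mult_2)
  have "card (sim_lin ` sim_words F n) \<le> card ((UNIV :: bool set) \<times> snd ` sim_lin ` sim_words F n)"
    by (rule card_mono) (auto simp: finite_sim_words intro: rev_image_eqI)
  also have "\<dots> = 2 * card (snd ` sim_lin ` sim_words F n)" by (simp add: card_cartesian_product)
  also have "card (snd ` sim_lin ` sim_words F n) \<le> card X"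
    using linear_parts_of_words[of n] fX unfolding X_def[symmetric]
    by (meson card_image_le card_mono finite_imageI le_trans)
  finally show ?thesis using cX by simp
qed

text \<open>Words of a fixed length \<open>n\<close> fall into few classes with a common linear part. In each class choose a maximal family of pieces
  with separated images under \<open>h\<close>. The remaining pieces lie close to chosen ones, so the chosen
  pieces of all classes, enlarged by a constant factor, cover \<open>h ` K\<close>; some class must contribute
  at least an average share to the length of this cover, and the polynomial number of classes is
  absorbed by \<open>\<epsilon>\<close>. The finite set \<open>T\<close> is used to give the common linear part the property
  \<open>Q\<close>: the correcting word depends on the class only, and costs a bounded factor.

  The map \<open>h\<close> is the identity or an orthogonal projection to a line.\<close>

lemma homogeneous_family:
  fixes h :: "complex \<Rightarrow> complex"
  assumes h: "\<And>x y. h (x - y) = h x - h y" "\<And>x. norm (h x) \<le> norm x"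
    and pos: "positive_length (h ` K)"
    and T: "finite T" "T \<subseteq> G" "\<And>f. f \<in> G \<Longrightarrow> \<exists>u\<in>T. Q (lin_comp (sim_lin f) (sim_lin u))"
    and \<epsilon>: "\<epsilon> > 0" and C: "C > 0"
  obtains p a B where "Q (p, a)" "0 < norm a" "norm a < 1" "finite B"
    "\<And>b. b \<in> B \<Longrightarrow> (p, a, b) \<in> G"
    "norm a powr (-(1 - \<epsilon>)) \<le> card B"
    "\<And>b b'. b \<in> B \<Longrightarrow> b' \<in> B \<Longrightarrow> b \<noteq> b' \<Longrightarrow> C * norm a \<le> norm (h b - h b')"
proof -
  obtain c where c: "c > 0" and cov: "\<forall>(I :: ((bool \<times> complex) \<times> planar_sim) set) U. finite I \<longrightarrow>
      h ` K \<subseteq> (\<Union>i\<in>I. U i) \<longrightarrow> (\<forall>i\<in>I. bounded (U i)) \<longrightarrow> c \<le> (\<Sum>i\<in>I. diameter (U i))"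
    using positive_length_finite_cover[OF pos] by (elim exE conjE)
  obtain R where R: "0 < R" "R < 1" "\<And>n f. f \<in> sim_words F n \<Longrightarrow> sim_ratio f \<le> R ^ n"
    using sim_words_ratio_le by blast
  define \<tau> where "\<tau> = Min (sim_ratio ` T)"
  have Tne: "T \<noteq> {}" using T(3)[OF sim_id_in_G] by auto
  have "\<tau> \<in> sim_ratio ` T" unfolding \<tau>_def using T Tne by (intro Min_in) auto
  then have \<tau>0: "\<tau> > 0" using T G_ratio by auto
  have \<tau>: "\<tau> \<le> sim_ratio u" if "u \<in> T" for u
    unfolding \<tau>_def using that T by (intro Min_le) auto
  define D where "D = 2 * (C + diam_K)"
  have D: "D > 0" using C diam_K_nonneg by (simp add: D_def)
  \<comment> \<open>\<open>n\<close> is so large that \<open>R powr (\<epsilon> n)\<close> times the number of classes is small.\<close>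
  define k where "k = 2 * card F"
  have "R powr \<epsilon> < R powr 0" using R \<epsilon> by (intro powr_less_mono') auto
  then have "(\<lambda>n. (real n + 1) ^ k * (R powr \<epsilon>) ^ n) \<longlonglongrightarrow> 0"
    using R by (intro power_times_geometric_tendsto_0) auto
  then have "eventually (\<lambda>n. (real n + 1) ^ k * (R powr \<epsilon>) ^ n < c * \<tau> / (2 * D)) sequentially"
    using c D \<tau>0 by (intro order_tendstoD) auto
  then have "eventually (\<lambda>n. n > 0 \<and> (real n + 1) ^ k * (R powr \<epsilon>) ^ n < c * \<tau> / (2 * D)) sequentially"
    by (rule eventually_conj[OF eventually_gt_at_top])
  from eventually_happens'[OF sequentially_bot this]
  obtain n where "n > 0 \<and> (real n + 1) ^ k * (R powr \<epsilon>) ^ n < c * \<tau> / (2 * D)"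
    by (elim exE)
  then have n: "n > 0" "(real n + 1) ^ k * (R powr \<epsilon>) ^ n < c * \<tau> / (2 * D)" by simp_all
  define W where "W = sim_words F n"
  define Ls where "Ls = sim_lin ` W"
  have fLs: "finite Ls" by (simp add: Ls_def W_def finite_sim_words)
  have WG: "W \<subseteq> G" unfolding W_def by (rule sim_words_subset_G)
  have "\<exists>u\<in>T. Q (lin_comp l (sim_lin u))" if "l \<in> Ls" for l
    using that T(3) WG by (auto simp: Ls_def)
  then obtain u where u: "\<And>l. l \<in> Ls \<Longrightarrow> u l \<in> T \<and> Q (lin_comp l (sim_lin (u l)))" by metis
  obtain p0 where p0: "p0 \<in> K" using K_nonempty by auto
  define g where "g f = sim_comp f (u (sim_lin f))" for f
  define y where "y f = h (sim_app (g f) p0)" for f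
  have uG: "u (sim_lin f) \<in> G" if "f \<in> W" for f
    using that u[of "sim_lin f"] T by (auto simp: Ls_def)
  have gG: "g f \<in> G" if "f \<in> W" for f
    unfolding g_def using that WG uG by (intro G_comp) auto
  have "\<forall>l\<in>Ls. \<exists>S\<subseteq>{f \<in> W. sim_lin f = l}. (\<forall>x\<in>S. \<forall>z\<in>S. x \<noteq> z \<longrightarrow> C * norm (snd l) \<le> dist (y x) (y z)) \<and>
     (\<forall>x\<in>{f \<in> W. sim_lin f = l}. \<exists>s\<in>S. dist (y x) (y s) < C * norm (snd l))"
  proof (intro ballI maximal_separated_subset)
    fix l assume "l \<in> Ls"
    show "finite {f \<in> W. sim_lin f = l}" by (simp add: W_def finite_sim_words)
    obtain f where "f \<in> W" "l = sim_lin f" using \<open>l \<in> Ls\<close> by (auto simp: Ls_def)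
    then show "0 < C * norm (snd l)" using G_ratio(1)[of f] WG C by (auto simp: sim_ratio_def)
  qed
  from bchoice[OF this] obtain V where V0: "\<forall>l\<in>Ls. V l \<subseteq> {f \<in> W. sim_lin f = l} \<and>
     (\<forall>x\<in>V l. \<forall>z\<in>V l. x \<noteq> z \<longrightarrow> C * norm (snd l) \<le> dist (y x) (y z)) \<and>
     (\<forall>x\<in>{f \<in> W. sim_lin f = l}. \<exists>s\<in>V l. dist (y x) (y s) < C * norm (snd l))"
    by (elim exE)
  have V: "V l \<subseteq> {f \<in> W. sim_lin f = l}" if "l \<in> Ls" for l
    using bspec[OF V0 that] by (rule conjunct1)
  have V2: "C * norm (snd l) \<le> dist (y x) (y z)" if "l \<in> Ls" "x \<in> V l" "z \<in> V l" "x \<noteq> z" for l x z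
    using conjunct1[OF conjunct2[OF bspec[OF V0 that(1)]]] that(2-) by blast
  have V3: "\<exists>s\<in>V l. dist (y x) (y s) < C * norm (snd l)" if "l \<in> Ls" "x \<in> W" "sim_lin x = l" for l x
    using conjunct2[OF conjunct2[OF bspec[OF V0 that(1)]]] that(2-) by blast
  have fV: "finite (V l)" if "l \<in> Ls" for l
    using V[OF that] by (rule finite_subset) (simp add: W_def finite_sim_words)
  define rd where "rd l = (C + diam_K) * norm (snd l :: complex)" for l :: "bool \<times> complex"
  have rd0: "rd l \<ge> 0" for l using C diam_K_nonneg by (simp add: rd_def)
  have "c \<le> (\<Sum>i\<in>Sigma Ls V. diameter (cball (y (snd i)) (rd (fst i))))"
  proof (rule cov[rule_format])
    show "finite (Sigma Ls V)" using fLs fV by auto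
    show "h ` K \<subseteq> (\<Union>i\<in>Sigma Ls V. cball (y (snd i)) (rd (fst i)))"
    proof
      fix z assume "z \<in> h ` K"
      then obtain x where x: "x \<in> K" "z = h x" by auto
      then obtain f x' where f: "f \<in> W" "x' \<in> K" "x = sim_app f x'"
        using sim_words_cover[of n] unfolding W_def by blast
      define l where "l = sim_lin f"
      have l: "l \<in> Ls" using f by (auto simp: l_def Ls_def)
      obtain s where s: "s \<in> V l" "dist (y f) (y s) < C * norm (snd l)"
        using V3[OF l f(1)] l_def by auto
      have "dist z (y f) \<le> dist x (sim_app (g f) p0)"
        unfolding x(2) y_def dist_norm h(1)[symmetric] by (rule h(2))
      also have "\<dots> = sim_ratio f * dist x' (sim_app (u (sim_lin f)) p0)"
        unfolding f(3) g_def sim_app_comp by (rule dist_sim_app)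
      also have "\<dots> \<le> sim_ratio f * diam_K"
        using f p0 uG WG G_ratio[of f] by (intro mult_left_mono dist_le_diam_K G_app) auto
      finally have "dist z (y f) \<le> norm (snd l) * diam_K" by (simp add: l_def sim_ratio_def)
      then have "dist (y s) z \<le> rd l"
        using s(2) dist_triangle[of z "y s" "y f"] unfolding rd_def by (simp add: algebra_simps dist_commute)
      then show "z \<in> (\<Union>i\<in>Sigma Ls V. cball (y (snd i)) (rd (fst i)))"
        using l s(1) by (intro UN_I[of "(l, s)"]) auto
    qed
  qed auto
  also have "\<dots> = (\<Sum>i\<in>Sigma Ls V. 2 * rd (fst i))"
    using rd0 by (intro sum.cong) (auto simp: diameter_cball not_less)
  also have "\<dots> = (\<Sum>l\<in>Ls. \<Sum>f\<in>V l. 2 * rd l)"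
    using fLs fV by (subst sum.Sigma) (auto simp: case_prod_beta)
  also have "\<dots> = (\<Sum>l\<in>Ls. real (card (V l)) * norm (snd l) * D)"
    by (intro sum.cong refl) (simp add: rd_def D_def algebra_simps)
  finally have csum: "c \<le> (\<Sum>l\<in>Ls. real (card (V l)) * norm (snd l) * D)" .
  have Ls0: "Ls \<noteq> {}" using csum c by auto
  then have cL: "card Ls > 0" using fLs by (simp add: card_gt_0_iff)
  have "\<exists>l\<in>Ls. c / card Ls \<le> real (card (V l)) * norm (snd l) * D"
  proof (rule ccontr)
    assume "\<not> ?thesis"
    then have "(\<Sum>l\<in>Ls. real (card (V l)) * norm (snd l) * D) < (\<Sum>l\<in>Ls. c / card Ls)"
      by (intro sum_strict_mono fLs Ls0) (auto simp: not_le)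
    then show False using csum cL by simp
  qed
  then obtain l where l: "l \<in> Ls" "c / card Ls \<le> real (card (V l)) * norm (snd l) * D" by blast
  obtain f0 where f0: "f0 \<in> W" "sim_lin f0 = l" using l by (auto simp: Ls_def)
  define p where "p = fst (lin_comp l (sim_lin (u l)))"
  define a where "a = snd (lin_comp l (sim_lin (u l)))"
  have lin_g: "sim_lin (g f) = (p, a)" if "f \<in> V l" for f
    using that V[OF l(1)] by (auto simp: g_def sim_lin_comp p_def a_def)
  have Q: "Q (p, a)" using u[OF l(1)] by (simp add: p_def a_def)
  have na: "norm a = norm (snd l) * sim_ratio (u l)"
    unfolding a_def sim_ratio_def by (cases l; cases "u l") (simp add: norm_mult)
  have ul: "u l \<in> T" using u[OF l(1)] by simp
  have nl: "0 < norm (snd l)" "norm (snd l) \<le> R ^ n"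
    using f0 G_ratio(1)[of f0] WG R(3)[of f0 n] by (auto simp: sim_ratio_def W_def)
  have ru: "0 < sim_ratio (u l)" "sim_ratio (u l) \<le> 1" using G_ratio[of "u l"] ul T by auto
  have a0: "0 < norm a" using na nl ru by simp
  have al: "norm a \<le> norm (snd l)" using na nl ru by (simp add: mult_left_le)
  have Rn: "R ^ n < 1" using R n(1) by (simp add: power_less_one_iff)
  have a1: "norm a < 1" using al nl Rn by linarith
  define B where "B = (\<lambda>f. snd (snd (g f))) ` V l"
  have trans: "sim_app (g f) p0 - sim_app (g f') p0 = snd (snd (g f)) - snd (snd (g f'))"
    if "f \<in> V l" "f' \<in> V l" for f f'
    using lin_g[OF that(1)] lin_g[OF that(2)] by (cases "g f"; cases "g f'") auto
  have sep: "C * norm a \<le> norm (h (snd (snd (g f))) - h (snd (snd (g f'))))"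
    if "f \<in> V l" "f' \<in> V l" "f \<noteq> f'" for f f'
  proof -
    have "C * norm a \<le> C * norm (snd l)" using al C by simp
    also have "\<dots> \<le> dist (y f) (y f')" by (rule V2[OF l(1) that])
    also have "\<dots> = norm (h (snd (snd (g f))) - h (snd (snd (g f'))))"
      unfolding y_def dist_norm h(1)[symmetric] trans[OF that(1,2)] ..
    finally show ?thesis .
  qed
  have "inj_on (\<lambda>f. snd (snd (g f))) (V l)"
  proof (rule inj_onI, rule ccontr)
    fix f f' assume "f \<in> V l" "f' \<in> V l" "snd (snd (g f)) = snd (snd (g f'))" "f \<noteq> f'"
    with sep[of f f'] C a0 show False by (simp add: mult_le_0_iff not_less)
  qed
  then have cB: "card B = card (V l)" unfolding B_def by (rule card_image)
  show thesis
  proof (rule that[OF Q a0 a1])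
    show "finite B" using fV[OF l(1)] by (simp add: B_def)
    show "(p, a, b) \<in> G" if b: "b \<in> B" for b
    proof -
      obtain f where f: "f \<in> V l" "b = snd (snd (g f))" using b by (auto simp: B_def)
      have "g f = (p, a, b)" using lin_g[OF f(1)] f(2) by (cases "g f") simp
      moreover have "g f \<in> G" using gG[of f] f(1) V[OF l(1)] by blast
      ultimately show ?thesis by simp
    qed
    show "C * norm a \<le> norm (h b - h b')" if bb: "b \<in> B" "b' \<in> B" "b \<noteq> b'" for b b'
    proof -
      obtain f f' where "f \<in> V l" "f' \<in> V l" "b = snd (snd (g f))" "b' = snd (snd (g f'))"
        using bb(1,2) unfolding B_def by blast
      with bb(3) sep[of f f'] show ?thesis by blast
    qed
    have "real (card Ls) \<le> 2 * (real n + 1) ^ k"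
      using card_linear_parts_of_words[of n] unfolding Ls_def W_def k_def
      by (metis (mono_tags, lifting) of_nat_1 of_nat_add of_nat_le_iff of_nat_mult of_nat_numeral of_nat_power)
    then have "c / (2 * (real n + 1) ^ k) \<le> c / card Ls"
      using c cL by (intro divide_left_mono) auto
    also have "\<dots> \<le> real (card (V l)) * norm (snd l) * D" by (rule l)
    finally have "c \<le> real (card (V l)) * norm (snd l) * D * (2 * (real n + 1) ^ k)"
      by (simp add: divide_le_eq)
    then have 1: "c * \<tau> \<le> real (card (V l)) * norm (snd l) * D * (2 * (real n + 1) ^ k) * \<tau>"
      using \<tau>0 by (intro mult_right_mono) auto
    have "norm a powr \<epsilon> \<le> (R ^ n) powr \<epsilon>" using a0 al nl \<epsilon> by (intro powr_mono2) auto
    also have "\<dots> = (R powr \<epsilon>) ^ n" using R by (simp add: powr_power flip: powr_realpow powr_powr) (simp add: powr_powr mult.commute)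
    finally have "norm a powr \<epsilon> * ((real n + 1) ^ k * (2 * D)) \<le> (R powr \<epsilon>) ^ n * ((real n + 1) ^ k * (2 * D))"
      using D by (intro mult_right_mono) auto
    also have "\<dots> \<le> c * \<tau>" using n(2) D by (simp add: field_simps)
    also note 1
    finally have "norm a powr \<epsilon> * ((real n + 1) ^ k * (2 * D)) \<le>
        (real (card (V l)) * norm (snd l) * \<tau>) * ((real n + 1) ^ k * (2 * D))"
      by (simp add: mult_ac)
    then have 2: "norm a powr \<epsilon> \<le> real (card (V l)) * norm (snd l) * \<tau>"
      using D by (subst (asm) mult_le_cancel_right) (auto simp: zero_less_mult_iff)
    also have "norm (snd l) * \<tau> \<le> norm a" unfolding na using \<tau>[OF ul] nl by simp
    then have "real (card (V l)) * norm (snd l) * \<tau> \<le> real (card (V l)) * norm a"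
      by (simp add: mult.assoc mult_left_mono)
    finally have "norm a powr \<epsilon> / norm a \<le> real (card B)" using a0 cB by (simp add: divide_le_eq)
    also have "norm a powr \<epsilon> / norm a = norm a powr (-(1 - \<epsilon>))"
      using a0 powr_diff[of "norm a" \<epsilon> 1] by simp
    finally show "norm a powr (-(1 - \<epsilon>)) \<le> card B" .
  qed
qed

end

section \<open>Correcting the rotation of a word\<close>

lemma sgn_cnj_if: "sgn (cnj_if p z) = cnj_if p (sgn z)"
  by (cases p) (simp_all add: sgn_div_norm scaleR_conv_of_real)

lemma sgn_complex_power: "sgn (z ^ n) = sgn z ^ n" for z :: complex
  by (induction n) (simp_all add: sgn_mult)

lemma non_torsion_power: "non_torsion \<zeta> \<Longrightarrow> n > 0 \<Longrightarrow> non_torsion (\<zeta> ^ n)"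
  unfolding non_torsion_def by (auto simp: norm_power simp flip: power_mult)

lemma non_torsion_torsion_mult:
  assumes "norm \<omega> = 1" "\<not> non_torsion \<omega>" "non_torsion \<zeta>"
  shows "non_torsion (\<omega> * \<zeta>)"
  unfolding non_torsion_def
proof (intro conjI allI impI notI)
  show "norm (\<omega> * \<zeta>) = 1" using assms by (simp add: norm_mult non_torsion_def)
  fix k :: nat assume k: "k > 0" "(\<omega> * \<zeta>) ^ k = 1"
  obtain m where m: "m > 0" "\<omega> ^ m = 1" using assms unfolding non_torsion_def by auto
  have "1 = ((\<omega> * \<zeta>) ^ k) ^ m" using k by simp
  also have "\<dots> = (\<omega> ^ m) ^ k * \<zeta> ^ (k * m)"
    by (simp add: power_mult_distrib flip: power_mult) (simp add: mult.commute)
  also have "\<dots> = \<zeta> ^ (k * m)" using m by simp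
  finally show False using assms(3) k m unfolding non_torsion_def by (metis nat_0_less_mult_iff)
qed

context planar_ifs
begin

lemma G_coeff_nonzero: "(p, a, b) \<in> G \<Longrightarrow> a \<noteq> 0"
  using G_ratio(1)[of "(p, a, b)"] by (auto simp: sim_ratio_def)

text \<open>Reflections are removed by composing with one fixed orientation-reversing word \<open>s\<close>, and a
  rotation of finite order becomes one of infinite order by composing with \<open>a\<^sub>0 z + b\<^sub>0\<close>.\<close>

lemma finite_correctors_non_torsion:
  assumes u0: "(False, a0, b0) \<in> G" "non_torsion (sgn a0)"
  shows "\<exists>T. finite T \<and> T \<subseteq> G \<and>
    (\<forall>f\<in>G. \<exists>u\<in>T. \<not> fst (sim_lin (sim_comp f u)) \<and> non_torsion (sgn (snd (sim_lin (sim_comp f u)))))"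
proof -
  have pres: "\<exists>u\<in>{sim_id, (False, a0, b0)}. \<not> fst (sim_lin (sim_comp f u)) \<and> non_torsion (sgn (snd (sim_lin (sim_comp f u))))"
    if f: "f \<in> G" "\<not> fst (sim_lin f)" for f
  proof (cases "non_torsion (sgn (snd (sim_lin f)))")
    case True
    then show ?thesis using f by (intro bexI[of _ sim_id]) auto
  next
    case False
    obtain a b where fab: "f = (False, a, b)" using f(2) by (cases f) auto
    then have "norm (sgn a) = 1" using G_coeff_nonzero f(1) by (simp add: norm_sgn)
    then have "non_torsion (sgn a * sgn a0)"
      using False fab u0 by (intro non_torsion_torsion_mult) auto
    then show ?thesis using fab by (intro bexI[of _ "(False, a0, b0)"]) (auto simp: sgn_mult)
  qed
  show ?thesis
  proof (cases "\<exists>s\<in>G. fst (sim_lin s)")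
    case False
    then show ?thesis using pres sim_id_in_G u0
      by (intro exI[of _ "{sim_id, (False, a0, b0)}"] conjI) blast+
  next
    case True
    then obtain s where s: "s \<in> G" "fst (sim_lin s)" by blast
    define T where "T = {sim_id, (False, a0, b0)} \<union> sim_comp s ` {sim_id, (False, a0, b0)}"
    have "\<exists>u\<in>T. \<not> fst (sim_lin (sim_comp f u)) \<and> non_torsion (sgn (snd (sim_lin (sim_comp f u))))"
      if f: "f \<in> G" for f
    proof (cases "fst (sim_lin f)")
      case False
      then show ?thesis using pres[OF f] unfolding T_def by blast
    next
      case True
      have "\<not> fst (sim_lin (sim_comp f s))" using True s by (cases f; cases s) auto
      from pres[OF G_comp[OF f s(1)] this]
      obtain u where "u \<in> {sim_id, (False, a0, b0)}"
        "\<not> fst (sim_lin (sim_comp f (sim_comp s u))) \<and> non_torsion (sgn (snd (sim_lin (sim_comp f (sim_comp s u)))))"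
        unfolding sim_comp_assoc by blast
      then show ?thesis unfolding T_def by blast
    qed
    moreover have "T \<subseteq> G" unfolding T_def using s u0 sim_id_in_G G_comp by blast
    ultimately show ?thesis by (intro exI[of _ T]) (auto simp: T_def)
  qed
qed

text \<open>If there are reflections in the system, fix one with direction \<open>s\<close>. Relative to the axis given by
  \<open>s\<close>, every generator has a direction of finite order, because up to this normalisation it is the
  direction of an orientation-preserving word of length at most 2. The normalised direction
  \<open>\<beta>\<close> is multiplicative up to conjugation, so a common multiple \<open>m\<close> of the orders of the generators
  works for all words.\<close>

lemma finite_linear_directions:
  assumes tors: "\<And>a b. (False, a, b) \<in> G \<Longrightarrow> \<not> non_torsion (sgn a)"
  shows "finite ((\<lambda>f. (fst (sim_lin f), sgn (snd (sim_lin f)))) ` G)"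
proof -
  define \<alpha> where "\<alpha> f = sgn (snd (sim_lin f))" for f
  define R where "R f = fst (sim_lin f)" for f
  have \<alpha>_comp: "\<alpha> (sim_comp f g) = \<alpha> f * cnj_if (R f) (\<alpha> g)" and R_comp: "R (sim_comp f g) = (R f \<noteq> R g)" for f g
    unfolding \<alpha>_def R_def by (cases f; cases g; simp add: sgn_mult sgn_cnj_if)+
  have \<alpha>1: "norm (\<alpha> f) = 1" if "f \<in> G" for f
    using that G_coeff_nonzero by (cases f) (auto simp: \<alpha>_def norm_sgn)
  have tors': "\<exists>m>0. \<alpha> f ^ m = 1" if "f \<in> G" "\<not> R f" for f
    using that tors \<alpha>1[OF that(1)] by (cases f) (auto simp: non_torsion_def \<alpha>_def R_def)
  obtain s where s: "norm s = 1" "\<And>f. f \<in> F \<Longrightarrow> R f \<Longrightarrow> \<exists>m>0. (\<alpha> f * cnj s) ^ m = 1"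
  proof (cases "\<exists>g\<in>F. R g")
    case True
    then obtain g where g: "g \<in> F" "R g" by blast
    have gG: "g \<in> G" using g F_subset_G by blast
    show thesis
    proof (rule that[of "\<alpha> g"])
      show "norm (\<alpha> g) = 1" using gG by (rule \<alpha>1)
      fix f assume f: "f \<in> F" "R f"
      have "\<exists>m>0. \<alpha> (sim_comp f g) ^ m = 1"
        using f g F_subset_G by (intro tors' G_comp) (auto simp: R_comp)
      then show "\<exists>m>0. (\<alpha> f * cnj (\<alpha> g)) ^ m = 1" using f by (simp add: \<alpha>_comp)
    qed
  next
    case False
    then show thesis using that[of 1] by auto
  qed
  have ss: "s * cnj s = 1" using s(1) by (simp add: complex_norm_square[symmetric])
  define \<beta> where "\<beta> f = (if R f then \<alpha> f * cnj s else \<alpha> f)" for f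
  have "\<exists>m>0. \<beta> f ^ m = 1" if "f \<in> F" for f
    using s(2)[OF that] tors'[OF subsetD[OF F_subset_G that]] by (cases "R f") (simp_all add: \<beta>_def)
  then obtain mm where mm: "\<And>f. f \<in> F \<Longrightarrow> mm f > 0 \<and> \<beta> f ^ mm f = 1" by metis
  define m where "m = (\<Prod>f\<in>F. mm f)"
  have m: "m > 0" unfolding m_def using mm by (simp add: prod_pos)
  have \<beta>F: "\<beta> f ^ m = 1" if f: "f \<in> F" for f
  proof -
    obtain k where "m = mm f * k" using dvd_prodI[OF finite_F f, of mm] unfolding m_def by (auto elim: dvdE)
    then show ?thesis using mm[OF f] by (simp add: power_mult)
  qed
  have \<beta>G: "\<beta> f ^ m = 1" if "f \<in> G" for f
    using that
  proof (induction rule: G_induct)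
    case id
    show ?case by (simp add: \<beta>_def R_def \<alpha>_def sim_id_def)
  next
    case (comp f g)
    have "\<beta> (sim_comp f g) = \<beta> f * cnj_if (R f) (\<beta> g)"
    proof (cases "R f"; cases "R g")
      assume RR: "R f" "R g"
      have "\<beta> f * cnj_if (R f) (\<beta> g) = \<alpha> f * cnj (\<alpha> g) * (s * cnj s)"
        using RR by (simp add: \<beta>_def)
      then show ?thesis using RR ss by (simp add: \<beta>_def R_comp \<alpha>_comp)
    qed (simp_all add: \<beta>_def R_comp \<alpha>_comp)
    then have "\<beta> (sim_comp f g) ^ m = \<beta> f ^ m * cnj_if (R f) (\<beta> g ^ m)"
      by (simp add: power_mult_distrib)
    then show ?case using \<beta>F[OF comp(1)] comp by simp
  qed
  have "(\<lambda>f. (R f, \<alpha> f)) ` G \<subseteq> UNIV \<times> ({z. z ^ m = 1} \<union> (\<lambda>w. w * s) ` {z. z ^ m = 1})"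
  proof
    fix x assume "x \<in> (\<lambda>f. (R f, \<alpha> f)) ` G"
    then obtain f where f: "f \<in> G" "x = (R f, \<alpha> f)" by blast
    show "x \<in> UNIV \<times> ({z. z ^ m = 1} \<union> (\<lambda>w. w * s) ` {z. z ^ m = 1})"
    proof (cases "R f")
      case True
      have "\<alpha> f = \<beta> f * s" using True ss by (simp add: \<beta>_def mult_ac)
      then show ?thesis using \<beta>G[OF f(1)] f(2) by auto
    next
      case False
      then show ?thesis using \<beta>G[OF f(1)] f(2) by (auto simp: \<beta>_def)
    qed
  qed
  moreover have "finite {z::complex. z ^ m = 1}" using m by (intro finite_roots_unity) auto
  ultimately have "finite ((\<lambda>f. (R f, \<alpha> f)) ` G)"
    by (elim finite_subset) auto
  then show ?thesis by (simp add: R_def \<alpha>_def)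
qed

text \<open>A word with a reflection becomes a positive homothety when it is composed with itself, and one
  without reflection when it is composed with a suitable power of itself. Only finitely many
  directions occur, so finitely many such correcting words suffice.\<close>

lemma finite_correctors_torsion:
  assumes tors: "\<And>a b. (False, a, b) \<in> G \<Longrightarrow> \<not> non_torsion (sgn a)"
  shows "\<exists>T. finite T \<and> T \<subseteq> G \<and>
    (\<forall>f\<in>G. \<exists>u\<in>T. \<not> fst (sim_lin (sim_comp f u)) \<and> sgn (snd (sim_lin (sim_comp f u))) = 1)"
proof -
  define val where "val f = (fst (sim_lin f), sgn (snd (sim_lin f)))" for f
  have val_comp: "val (sim_comp f u) = (fst (val f) \<noteq> fst (val u), snd (val f) * cnj_if (fst (val f)) (snd (val u)))" for f u
    unfolding val_def by (cases f; cases u) (simp add: sgn_mult sgn_cnj_if)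
  have ex: "\<exists>u\<in>G. val (sim_comp f u) = (False, 1)" if f: "f \<in> G" for f
  proof (cases f)
    case (fields p a b)
    have a0: "a \<noteq> 0" using G_coeff_nonzero f fields by blast
    show ?thesis
    proof (cases p)
      case True
      have "sgn a * cnj (sgn a) = 1" using a0 by (simp add: complex_norm_square[symmetric] norm_sgn)
      then have "val (sim_comp f f) = (False, 1)"
        unfolding val_comp using fields True by (simp add: val_def)
      then show ?thesis using f by blast
    next
      case False
      then have fF: "(False, a, b) \<in> G" using f fields by simp
      obtain m where m: "m > 0" "sgn a ^ m = 1"
        using tors[OF fF] a0 by (auto simp: non_torsion_def norm_sgn)
      obtain b' where b': "(False, a ^ (m - 1), b') \<in> G" using G_power[OF fF] by blast
      have "sgn a * sgn (a ^ (m - 1)) = sgn a ^ m"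
        unfolding sgn_complex_power using m(1) by (metis Suc_diff_1 power_Suc)
      then have "val (sim_comp f (False, a ^ (m - 1), b')) = (False, 1)"
        unfolding val_comp using fields False m by (simp add: val_def)
      then show ?thesis using b' by blast
    qed
  qed
  have fin: "finite (val ` G)" using finite_linear_directions[OF tors] by (simp add: val_def)
  have "\<exists>u\<in>G. \<forall>f\<in>G. val f = v \<longrightarrow> val (sim_comp f u) = (False, 1)" if "v \<in> val ` G" for v
  proof -
    obtain f where f: "f \<in> G" "v = val f" using \<open>v \<in> _\<close> by blast
    obtain u where "u \<in> G" "val (sim_comp f u) = (False, 1)" using ex[OF f(1)] by blast
    then show ?thesis using f unfolding val_comp by (intro bexI[of _ u]) auto
  qed
  then obtain U where U: "\<And>v. v \<in> val ` G \<Longrightarrow> U v \<in> G \<and> (\<forall>f\<in>G. val f = v \<longrightarrow> val (sim_comp f (U v)) = (False, 1))"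
    by metis
  have "\<exists>u\<in>U ` val ` G. \<not> fst (sim_lin (sim_comp f u)) \<and> sgn (snd (sim_lin (sim_comp f u))) = 1"
    if f: "f \<in> G" for f
  proof -
    have "val (sim_comp f (U (val f))) = (False, 1)" using U[of "val f"] f by blast
    then show ?thesis using f by (intro bexI[of _ "U (val f)"]) (auto simp: val_def)
  qed
  moreover have "U ` val ` G \<subseteq> G" using U by blast
  moreover have "finite (U ` val ` G)" using fin by (rule finite_imageI)
  ultimately show ?thesis by (intro exI[of _ "U ` val ` G"] conjI ballI)
qed

end

section \<open>Averaged projections of iterated families\<close>

text \<open>The translation parts of all \<open>n\<close>-fold compositions of the maps \<open>z \<mapsto> a z + b\<close> with
  \<open>b \<in> B\<close>; the linear part of these compositions is \<open>a ^ n\<close>.\<close>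

fun level_sums :: "complex \<Rightarrow> complex set \<Rightarrow> nat \<Rightarrow> complex set" where
  "level_sums a B 0 = {0}"
| "level_sums a B (Suc n) = (\<lambda>(b, c). b + a * c) ` (B \<times> level_sums a B n)"

text \<open>The gap \<open>d + 1\<close>, in units of the ratio, exceeds the diameter \<open>d\<close> of \<open>K\<close>. Hence the images of \<open>K\<close>
  under the maps of the family remain at distance at least \<open>norm a\<close> from each other, which makes
  the separation pass to all levels of the iteration.\<close>

locale separated_family =
  fixes K :: "complex set" and d :: real and a :: complex and B :: "complex set"
  assumes K_ne: "K \<noteq> {}"
    and diam: "\<And>x y. x \<in> K \<Longrightarrow> y \<in> K \<Longrightarrow> norm (x - y) \<le> d"
    and a: "a \<noteq> 0" "norm a < 1"
    and finite_B: "finite B" and B_ne: "B \<noteq> {}"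
    and inv: "\<And>b x. b \<in> B \<Longrightarrow> x \<in> K \<Longrightarrow> a * x + b \<in> K"
    and sep: "\<And>b b'. b \<in> B \<Longrightarrow> b' \<in> B \<Longrightarrow> b \<noteq> b' \<Longrightarrow> (d + 1) * norm a \<le> norm (b - b')"
begin

abbreviation "Lv \<equiv> level_sums a B"

lemma finite_level: "finite (Lv n)"
  by (induction n) (auto simp: finite_B)

lemma level_inv: "c \<in> Lv n \<Longrightarrow> x \<in> K \<Longrightarrow> a ^ n * x + c \<in> K"
proof (induction n arbitrary: c)
  case (Suc n)
  then obtain b c' where c: "c = b + a * c'" "b \<in> B" "c' \<in> Lv n" by auto
  have "a * (a ^ n * x + c') + b \<in> K" using c Suc by (intro inv) auto
  then show ?case using c by (simp add: algebra_simps)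
qed simp

lemma level_diam:
  assumes "c \<in> Lv n" "c' \<in> Lv n"
  shows "norm (c - c') \<le> d"
proof -
  obtain x where x: "x \<in> K" using K_ne by auto
  have "norm ((a ^ n * x + c) - (a ^ n * x + c')) \<le> d"
    using assms x by (intro diam level_inv)
  then show ?thesis by simp
qed

lemma level_gap:
  assumes "b \<in> B" "b' \<in> B" "b \<noteq> b'" "c \<in> Lv n" "c' \<in> Lv n"
  shows "norm a \<le> norm ((b + a * c) - (b' + a * c'))"
proof -
  have "(d + 1) * norm a \<le> norm (b - b')" using assms by (intro sep)
  moreover have "norm (a * (c - c')) \<le> norm a * d"
    unfolding norm_mult using assms by (intro mult_left_mono level_diam) auto
  moreover have "norm (b - b') \<le> norm ((b + a * c) - (b' + a * c')) + norm (a * (c - c'))"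
  proof -
    have eq: "b - b' = ((b + a * c) - (b' + a * c')) - a * (c - c')" by (simp add: algebra_simps)
    show ?thesis unfolding eq by (rule norm_triangle_ineq4)
  qed
  ultimately have "(d + 1) * norm a \<le> norm ((b + a * c) - (b' + a * c')) + norm a * d" by linarith
  moreover have "(d + 1) * norm a = norm a * d + norm a" by (simp add: distrib_right)
  ultimately show ?thesis by linarith
qed

lemma level_inj: "inj_on (\<lambda>(b, c). b + a * c) (B \<times> Lv n)"
proof (rule inj_onI, clarify)
  fix b c b' c' assume *: "b \<in> B" "c \<in> Lv n" "b' \<in> B" "c' \<in> Lv n" "b + a * c = b' + a * c'"
  have "b = b'"
  proof (rule ccontr)
    assume "b \<noteq> b'"
    from level_gap[OF *(1,3) this *(2,4)] show False using *(5) a by simp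
  qed
  moreover from this have "a * c = a * c'" using *(5) by simp
  ultimately show "b = b' \<and> c = c'" using a by simp
qed

lemma card_level: "card (Lv n) = card B ^ n"
  by (induction n) (simp_all add: card_image[OF level_inj] card_cartesian_product)

lemma sum_level: "(\<Sum>x\<in>Lv (Suc n). f x) = (\<Sum>b\<in>B. \<Sum>c\<in>Lv n. f (b + a * c))"
  unfolding level_sums.simps sum.reindex[OF level_inj] sum.cartesian_product by (simp add: case_prod_beta)

text \<open>The discrete 1-energy of the points of level \<open>n\<close>. The terms with \<open>x = y\<close> vanish, because
  \<open>1 / 0 = 0\<close>.\<close>

definition energy :: "nat \<Rightarrow> real" where
  "energy n = (\<Sum>x\<in>Lv n. \<Sum>y\<in>Lv n. 1 / norm (x - y))"

text \<open>Pairs in the same first-level piece reproduce the energy of the previous level, scaled by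
  \<open>1 / norm a\<close>; by \<open>level_gap\<close> all other pairs contribute at most \<open>1 / norm a\<close> each.\<close>

lemma energy_Suc: "energy (Suc n) \<le> card B / norm a * energy n + (real (card B) ^ Suc n)\<^sup>2 / norm a"
proof -
  have le: "1 / norm ((b + a * c) - (b' + a * c')) \<le>
      (if b = b' then 1 / norm a * (1 / norm (c - c')) else 0) + 1 / norm a"
    if "b \<in> B" "b' \<in> B" "c \<in> Lv n" "c' \<in> Lv n" for b b' c c'
  proof (cases "b = b'")
    case True
    then have "norm ((b + a * c) - (b' + a * c')) = norm a * norm (c - c')"
      by (simp flip: norm_mult add: right_diff_distrib)
    then show ?thesis using True by simp
  next
    case False
    then have "norm a \<le> norm ((b + a * c) - (b' + a * c'))" using that by (intro level_gap)
    then show ?thesis using False a by (simp add: frac_le)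
  qed
  have "energy (Suc n) = (\<Sum>b\<in>B. \<Sum>c\<in>Lv n. \<Sum>b'\<in>B. \<Sum>c'\<in>Lv n. 1 / norm ((b + a * c) - (b' + a * c')))"
    unfolding energy_def sum_level ..
  also have "\<dots> \<le> (\<Sum>b\<in>B. \<Sum>c\<in>Lv n. \<Sum>b'\<in>B. \<Sum>c'\<in>Lv n.
      (if b = b' then 1 / norm a * (1 / norm (c - c')) else 0) + 1 / norm a)"
    by (intro sum_mono le)
  also have "\<dots> = (\<Sum>b\<in>B. \<Sum>c\<in>Lv n. \<Sum>b'\<in>B. (if b = b' then \<Sum>c'\<in>Lv n. 1 / norm a * (1 / norm (c - c')) else 0) + card (Lv n) / norm a)"
    by (intro sum.cong refl) (auto simp: sum.distrib)
  also have "\<dots> = (\<Sum>b\<in>B. \<Sum>c\<in>Lv n. (\<Sum>c'\<in>Lv n. 1 / norm a * (1 / norm (c - c'))) + card B * (card (Lv n) / norm a))"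
    using finite_B by (intro sum.cong refl) (simp add: sum.distrib)
  also have "\<dots> = card B * (energy n / norm a) + card B * (card (Lv n) * (card B * (card (Lv n) / norm a)))"
  proof -
    have "(\<Sum>c\<in>Lv n. \<Sum>c'\<in>Lv n. 1 / norm a * (1 / norm (c - c'))) = energy n / norm a"
      by (simp add: energy_def sum_divide_distrib mult.commute)
    then show ?thesis by (simp add: sum.distrib distrib_left)
  qed
  also have "\<dots> = card B / norm a * energy n + (real (card B) ^ Suc n)\<^sup>2 / norm a"
    by (simp add: card_level power2_eq_square mult_ac)
  finally show ?thesis .
qed

text \<open>Divided by the number of pairs, the energy is multiplied by at most \<open>x\<close> from one level to the
  next, before \<open>1 / norm a\<close> is added. It is used with \<open>x = norm a powr -\<epsilon>\<close>.\<close>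

lemma energy_bound:
  assumes x: "1 \<le> x" "1 \<le> real (card B) * norm a * x"
  shows "energy n \<le> (real (card B) ^ n)\<^sup>2 * (real n * x ^ n) / norm a"
proof (induction n)
  case 0
  then show ?case by (simp add: energy_def)
next
  case (Suc n)
  define M where "M = real (card B)"
  define r where "r = norm a"
  have r: "r > 0" using a by (simp add: r_def)
  have M: "M > 0" using finite_B B_ne by (simp add: M_def card_gt_0_iff)
  have "energy (Suc n) \<le> M / r * energy n + (M ^ Suc n)\<^sup>2 / r"
    using energy_Suc[of n] by (simp add: M_def r_def)
  also have "\<dots> \<le> M / r * ((M ^ n)\<^sup>2 * (real n * x ^ n) / r) + (M ^ Suc n)\<^sup>2 / r"
    using Suc.IH M r by (intro add_right_mono mult_left_mono) (auto simp: M_def r_def)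
  also have "M / r * ((M ^ n)\<^sup>2 * (real n * x ^ n) / r) \<le> M / r * ((M ^ n)\<^sup>2 * (real n * x ^ n) / r) * (M * r * x)"
    using x(2) M r x(1) mult_left_mono[OF x(2), of "M / r * ((M ^ n)\<^sup>2 * (real n * x ^ n) / r)"]
    by (simp add: M_def r_def)
  also have "\<dots> = (M ^ Suc n)\<^sup>2 * (real n * x ^ Suc n) / r"
    using r by (simp add: power2_eq_square field_simps)
  also have "(M ^ Suc n)\<^sup>2 / r \<le> (M ^ Suc n)\<^sup>2 * x ^ Suc n / r"
  proof -
    have "(M ^ Suc n)\<^sup>2 * 1 \<le> (M ^ Suc n)\<^sup>2 * x ^ Suc n"
      using x(1) by (intro mult_left_mono one_le_power) auto
    then show ?thesis using r by (intro divide_right_mono) auto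
  qed
  finally have "energy (Suc n) \<le> (M ^ Suc n)\<^sup>2 * (real n * x ^ Suc n) / r + (M ^ Suc n)\<^sup>2 * x ^ Suc n / r"
    by simp
  also have "\<dots> = (M ^ Suc n)\<^sup>2 * (real (Suc n) * x ^ Suc n) / r"
    by (simp add: algebra_simps add_divide_distrib)
  finally show ?case by (simp add: M_def r_def)
qed

end

text \<open>Marstrand's estimate along an orbit of directions: the pair \<open>x \<noteq> y\<close> has a short projection for a
  proportion of at most \<open>5 \<rho> / norm (x - y)\<close> of the rotations. The errors of the finitely many pairs
  are absorbed by the factor 2 once \<open>N\<close> is large, uniformly in \<open>u\<close>.\<close>

lemma close_pairs_along_rotation:
  fixes L :: "complex set"
  assumes \<zeta>: "non_torsion \<zeta>" and L: "finite L" "L \<noteq> {}" and \<rho>: "\<rho> > 0"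
  shows "\<exists>N0>0. \<forall>u N. norm u = 1 \<longrightarrow> N \<ge> N0 \<longrightarrow>
      (\<Sum>j<N. close_pairs L (u * \<zeta> ^ j) \<rho>) \<le>
      real N * (2 * (real (card L) + 5 * \<rho> * (\<Sum>x\<in>L. \<Sum>y\<in>L. 1 / norm (x - y))))"
proof -
  have "\<forall>l. \<exists>c. l > 0 \<longrightarrow> (\<forall>u n. norm u = 1 \<longrightarrow>
      real (card {j. j < n \<and> \<bar>Re (u * \<zeta> ^ j)\<bar> \<le> l}) \<le> 5 * l * real n + c)"
    using rotation_strip_frequency[OF \<zeta>] by simp
  from choice[OF this] obtain c where c0: "\<forall>l. l > 0 \<longrightarrow> (\<forall>u n. norm u = 1 \<longrightarrow>
      real (card {j. j < n \<and> \<bar>Re (u * \<zeta> ^ j)\<bar> \<le> l}) \<le> 5 * l * real n + c l)" by (elim exE)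
  then have c: "real (card {j. j < n \<and> \<bar>Re (u * \<zeta> ^ j)\<bar> \<le> l}) \<le> 5 * l * real n + c l"
    if "l > 0" "norm u = 1" for l u n using that by blast
  define S where "S = (\<Sum>x\<in>L. \<Sum>y\<in>L. \<bar>c (\<rho> / norm (x - y))\<bar>)"
  have cL: "real (card L) > 0" using L by (simp add: card_gt_0_iff)
  define N0 where "N0 = nat \<lceil>S\<rceil> + 1"
  have pair: "real (card {j. j < N \<and> \<bar>Re (u * \<zeta> ^ j * (x - y))\<bar> < \<rho>}) \<le>
      (if x = y then real N else 0) + 5 * \<rho> * (1 / norm (x - y)) * N + \<bar>c (\<rho> / norm (x - y))\<bar>"
    if u: "norm u = 1" for u x y N
  proof (cases "x = y")
    case True
    have "card {j. j < N \<and> \<bar>Re (u * \<zeta> ^ j * (x - y))\<bar> < \<rho>} \<le> card {..<N}"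
      by (rule card_mono) auto
    then show ?thesis using True by simp
  next
    case False
    define n where "n = norm (x - y)"
    have n: "n > 0" using False by (simp add: n_def)
    define w where "w = u * ((x - y) / of_real n)"
    have w: "norm w = 1" using u n by (simp add: w_def norm_mult norm_divide n_def)
    have "card {j. j < N \<and> \<bar>Re (u * \<zeta> ^ j * (x - y))\<bar> < \<rho>} \<le> card {j. j < N \<and> \<bar>Re (w * \<zeta> ^ j)\<bar> \<le> \<rho> / n}"
    proof (rule card_mono)
      show "{j. j < N \<and> \<bar>Re (u * \<zeta> ^ j * (x - y))\<bar> < \<rho>} \<subseteq> {j. j < N \<and> \<bar>Re (w * \<zeta> ^ j)\<bar> \<le> \<rho> / n}"
      proof clarify
        fix j assume j: "\<bar>Re (u * \<zeta> ^ j * (x - y))\<bar> < \<rho>"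
        have "w * \<zeta> ^ j = (u * \<zeta> ^ j * (x - y)) / of_real n" by (simp add: w_def)
        then have "\<bar>Re (w * \<zeta> ^ j)\<bar> = \<bar>Re (u * \<zeta> ^ j * (x - y))\<bar> / n"
          using n by (simp only: Re_divide_of_real abs_divide abs_of_pos)
        then show "\<bar>Re (w * \<zeta> ^ j)\<bar> \<le> \<rho> / n" using j n by (simp add: divide_right_mono)
      qed
    qed simp
    also have "real \<dots> \<le> 5 * (\<rho> / n) * real N + c (\<rho> / n)"
      using \<rho> n by (intro c w) auto
    finally show ?thesis using False by (simp add: n_def)
  qed
  have "(\<Sum>j<N. close_pairs L (u * \<zeta> ^ j) \<rho>) \<le>
      real N * (2 * (real (card L) + 5 * \<rho> * (\<Sum>x\<in>L. \<Sum>y\<in>L. 1 / norm (x - y))))"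
    if u: "norm u = 1" and N: "N \<ge> N0" for u N
  proof -
    let ?P = "\<lambda>j x y. \<bar>Re (u * \<zeta> ^ j * (x - y))\<bar> < \<rho>"
    have "(\<Sum>j<N. real (card {(x, y) \<in> L \<times> L. ?P j x y})) = (\<Sum>j<N. \<Sum>x\<in>L. \<Sum>y\<in>L. if ?P j x y then 1 else 0)"
    proof (rule sum.cong[OF refl])
      fix j
      have "real (card {(x, y) \<in> L \<times> L. ?P j x y}) = (\<Sum>z\<in>L \<times> L. if (case z of (x, y) \<Rightarrow> ?P j x y) then 1 else 0)"
        using L by (subst sum.If_cases) (auto intro!: arg_cong[of _ _ card])
      also have "\<dots> = (\<Sum>x\<in>L. \<Sum>y\<in>L. if ?P j x y then 1 else 0)"
        unfolding sum.cartesian_product by (rule sum.cong) auto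
      finally show "real (card {(x, y) \<in> L \<times> L. ?P j x y}) = (\<Sum>x\<in>L. \<Sum>y\<in>L. if ?P j x y then 1 else 0)" .
    qed
    also have "\<dots> = (\<Sum>x\<in>L. \<Sum>y\<in>L. \<Sum>j<N. if ?P j x y then 1 else 0)"
      by (subst sum.swap, rule sum.cong[OF refl], rule sum.swap)
    also have "\<dots> = (\<Sum>x\<in>L. \<Sum>y\<in>L. real (card {j. j < N \<and> ?P j x y}))"
      by (intro sum.cong refl, subst sum.If_cases) (auto intro!: arg_cong[of _ _ card])
    also have "\<dots> \<le> (\<Sum>x\<in>L. \<Sum>y\<in>L. (if x = y then real N else 0) + 5 * \<rho> * (1 / norm (x - y)) * N + \<bar>c (\<rho> / norm (x - y))\<bar>)"
      by (intro sum_mono pair u)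
    also have "\<dots> = real (card L) * real N + 5 * \<rho> * (\<Sum>x\<in>L. \<Sum>y\<in>L. 1 / norm (x - y)) * N + S"
      using L unfolding S_def by (simp add: sum.distrib sum_distrib_left sum_distrib_right)
    also have "S \<le> real N * real (card L)"
    proof -
      have "S \<le> real N * 1" using N unfolding N0_def by linarith
      also have "\<dots> \<le> real N * real (card L)" using cL by (intro mult_left_mono) auto
      finally show ?thesis .
    qed
    also have "real (card L) * real N + 5 * \<rho> * (\<Sum>x\<in>L. \<Sum>y\<in>L. 1 / norm (x - y)) * N + real N * real (card L)
       \<le> real N * (2 * (real (card L) + 5 * \<rho> * (\<Sum>x\<in>L. \<Sum>y\<in>L. 1 / norm (x - y))))"
    proof -
      have "0 \<le> 5 * \<rho> * (\<Sum>x\<in>L. \<Sum>y\<in>L. 1 / norm (x - y)) * N"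
        using \<rho> by (intro mult_nonneg_nonneg sum_nonneg) auto
      then show ?thesis by (simp add: algebra_simps)
    qed
    finally show ?thesis by simp
  qed
  then show ?thesis by (intro exI[of _ N0]) (simp add: N0_def)
qed

text \<open>Marstrand's estimate at scale \<open>norm a ^ n\<close> for the points of level \<open>n\<close>. The energy exceeds its
  ideal value by a factor of at most about \<open>n (norm a powr (- n \<epsilon>))\<close>. Giving away another
  \<open>norm a powr (- n \<epsilon>)\<close> pays for the factor \<open>n\<close> and for all constants when \<open>n\<close> is large.\<close>

lemma (in separated_family) iterate_with_few_close_pairs:
  assumes \<epsilon>: "0 < \<epsilon>" "\<epsilon> < 1" and C: "C > 0"
    and M: "norm a powr (-(1 - \<epsilon>)) \<le> card B"
  obtains n A where "n > 0" "A > 0" "(real (card (Lv n)))\<^sup>2 / A = norm (a ^ n) powr (-(1 - 2 * \<epsilon>))"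
    "\<And>\<zeta>. non_torsion \<zeta> \<Longrightarrow> \<exists>N0>0. \<forall>u N. norm u = 1 \<longrightarrow> N \<ge> N0 \<longrightarrow>
      (\<Sum>j<N. close_pairs (Lv n) (u * \<zeta> ^ j) (2 * (C * norm (a ^ n)))) \<le> real N * A"
proof -
  define r where "r = norm a"
  have r: "0 < r" "r < 1" using a by (auto simp: r_def)
  define m where "m = real (card B)"
  have m: "m > 0" "r powr (-(1 - \<epsilon>)) \<le> m" using finite_B B_ne M by (auto simp: m_def r_def card_gt_0_iff)
  define y where "y = r powr \<epsilon>"
  have "r powr \<epsilon> < r powr 0" using r \<epsilon> by (intro powr_less_mono') auto
  then have y: "0 < y" "y < 1" using r by (auto simp: y_def)
  have mry: "y \<le> m * r"
  proof -
    have "y = r powr (-(1 - \<epsilon>)) * r" using r powr_add[of r "-(1 - \<epsilon>)" 1] by (simp add: y_def)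
    also have "\<dots> \<le> m * r" using m r by (intro mult_right_mono) auto
    finally show ?thesis .
  qed
  \<comment> \<open>\<open>q (n + 1)\<close> bounds the constants and the factor \<open>n\<close> in the energy.\<close>
  define q where "q = 1 + 20 * C / r"
  have q: "q > 1" using C r by (simp add: q_def)
  have "(\<lambda>n. (real n + 1) ^ 1 * y ^ n) \<longlonglongrightarrow> 0" using y by (rule power_times_geometric_tendsto_0)
  then have "eventually (\<lambda>n. (real n + 1) ^ 1 * y ^ n < 1 / (2 * q)) sequentially"
    using q by (intro order_tendstoD) auto
  then have "eventually (\<lambda>n. n > 0 \<and> (real n + 1) ^ 1 * y ^ n < 1 / (2 * q)) sequentially"
    by (rule eventually_conj[OF eventually_gt_at_top])
  from eventually_happens'[OF sequentially_bot this]
  obtain n where n0: "n > 0 \<and> (real n + 1) ^ 1 * y ^ n < 1 / (2 * q)" by (elim exE)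
  then have n: "n > 0" "(real n + 1) * y ^ n < 1 / (2 * q)" by simp_all
  define A where "A = (m ^ n)\<^sup>2 * (r ^ n) powr (1 - 2 * \<epsilon>)"
  have A: "A > 0" using m r by (simp add: A_def)
  have rn: "(r ^ n) powr (1 - 2 * \<epsilon>) * (y ^ n)\<^sup>2 = r ^ n"
  proof -
    have "(y ^ n)\<^sup>2 = (r ^ n) powr (2 * \<epsilon>)"
      using r by (simp add: y_def powr_realpow[symmetric] powr_powr power2_eq_square powr_add[symmetric]) (simp add: algebra_simps)
    then have "(r ^ n) powr (1 - 2 * \<epsilon>) * (y ^ n)\<^sup>2 = (r ^ n) powr ((1 - 2 * \<epsilon>) + 2 * \<epsilon>)"
      by (simp only: powr_add)
    then show ?thesis using r by simp
  qed
  have E: "energy n \<le> (m ^ n)\<^sup>2 * (real n * (1 / y) ^ n) / r"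
    unfolding m_def r_def
  proof (rule energy_bound)
    show "1 \<le> 1 / y" using y by simp
    show "1 \<le> real (card B) * norm a * (1 / y)" using mry y by (simp add: m_def r_def)
  qed
  define \<rho> where "\<rho> = 2 * (C * r ^ n)"
  have main: "2 * (real (card (Lv n)) + 5 * \<rho> * energy n) \<le> A"
  proof -
    have rpos: "r ^ n > 0" "m ^ n > 0" "y ^ n > 0" using r m y by auto
    have 1: "m ^ n \<le> (m ^ n)\<^sup>2 * (r ^ n / y ^ n)"
    proof -
      have "y ^ n \<le> (m * r) ^ n" using mry y by (intro power_mono) auto
      then have "1 \<le> m ^ n * (r ^ n / y ^ n)" using rpos by (simp add: power_mult_distrib)
      then have "m ^ n * 1 \<le> m ^ n * (m ^ n * (r ^ n / y ^ n))" using rpos by (intro mult_left_mono) auto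
      then show ?thesis by (simp add: power2_eq_square)
    qed
    have "5 * \<rho> * energy n \<le> 5 * \<rho> * ((m ^ n)\<^sup>2 * (real n * (1 / y) ^ n) / r)"
      using E C rpos by (intro mult_left_mono) (auto simp: \<rho>_def)
    also have "\<dots> = (m ^ n)\<^sup>2 * (r ^ n / y ^ n) * (10 * C / r * real n)"
      using rpos r by (simp add: \<rho>_def power_one_over field_simps)
    finally have "real (card (Lv n)) + 5 * \<rho> * energy n \<le> (m ^ n)\<^sup>2 * (r ^ n / y ^ n) * (1 + 10 * C / r * real n)"
      using 1 by (simp add: card_level m_def distrib_left)
    also have "\<dots> \<le> (m ^ n)\<^sup>2 * (r ^ n / y ^ n) * (q * (real n + 1))"
    proof (rule mult_left_mono)
      define z where "z = C / r"
      have "0 \<le> z" "0 \<le> z * real n" using C r by (auto simp: z_def)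
      moreover have "10 * C / r * real n = 10 * (z * real n)" "q = 1 + 20 * z" by (simp_all add: q_def z_def)
      ultimately show "1 + 10 * C / r * real n \<le> q * (real n + 1)" by (simp add: algebra_simps)
    qed (use rpos in auto)
    also have "\<dots> = (m ^ n)\<^sup>2 * ((r ^ n) powr (1 - 2 * \<epsilon>) * y ^ n) * (q * (real n + 1))"
    proof -
      have "r ^ n / y ^ n = (r ^ n) powr (1 - 2 * \<epsilon>) * (y ^ n)\<^sup>2 / y ^ n" by (simp only: rn)
      then have "r ^ n / y ^ n = (r ^ n) powr (1 - 2 * \<epsilon>) * y ^ n"
        using rpos by (simp add: power2_eq_square)
      then show ?thesis by (simp only:)
    qed
    also have "\<dots> = A * (q * ((real n + 1) * y ^ n))" by (simp add: A_def)
    also have "\<dots> \<le> A * (q * (1 / (2 * q)))" using A q n by (intro mult_left_mono) auto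
    also have "\<dots> = A / 2" using q by simp
    finally show ?thesis by simp
  qed
  show thesis
  proof (rule that[OF n(1) A])
    show "(real (card (Lv n)))\<^sup>2 / A = norm (a ^ n) powr (-(1 - 2 * \<epsilon>))"
      using m r by (simp add: A_def card_level m_def norm_power r_def[symmetric] powr_minus field_simps flip: powr_add)
    fix \<zeta> assume \<zeta>: "non_torsion \<zeta>"
    have ne: "Lv n \<noteq> {}" using card_level[of n] m by (auto simp: m_def)
    have \<rho>0: "\<rho> > 0" using C r by (simp add: \<rho>_def)
    from close_pairs_along_rotation[OF \<zeta> finite_level ne \<rho>0]
    obtain N0 where N0: "N0 > 0" "\<forall>u N. norm u = 1 \<longrightarrow> N \<ge> N0 \<longrightarrow>
      (\<Sum>j<N. close_pairs (Lv n) (u * \<zeta> ^ j) \<rho>) \<le>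
      real N * (2 * (real (card (Lv n)) + 5 * \<rho> * (\<Sum>x\<in>Lv n. \<Sum>y\<in>Lv n. 1 / norm (x - y))))"
      by (elim exE conjE)
    have "(\<Sum>j<N. close_pairs (Lv n) (u * \<zeta> ^ j) \<rho>) \<le> real N * A"
      if "norm u = 1" "N \<ge> N0" for u N
    proof -
      have "real N * (2 * (real (card (Lv n)) + 5 * \<rho> * energy n)) \<le> real N * A"
        using main by (intro mult_left_mono) auto
      with N0(2)[rule_format, OF that] show ?thesis unfolding energy_def by linarith
    qed
    then show "\<exists>N0>0. \<forall>u N. norm u = 1 \<longrightarrow> N \<ge> N0 \<longrightarrow>
      (\<Sum>j<N. close_pairs (Lv n) (u * \<zeta> ^ j) (2 * (C * norm (a ^ n)))) \<le> real N * A"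
      using N0(1) by (auto simp: \<rho>_def r_def norm_power)
  qed
qed

section \<open>Sets whose chords avoid a direction\<close>

text \<open>The connected components, enumerated with gaps filled by the empty set.\<close>

lemma open_real_disjoint_intervals:
  fixes U :: "real set"
  assumes "open U" "bounded U"
  shows "\<exists>J :: nat \<Rightarrow> real set. U = (\<Union>n. J n) \<and> disjoint_family J \<and>
    (\<forall>n. open (J n) \<and> connected (J n) \<and> bounded (J n) \<and> ennreal (diameter (J n)) \<le> emeasure lborel (J n))"
proof -
  define D where "D = components U"
  have cD: "countable D" unfolding D_def
    using assms(1) open_components pairwise_disjoint_components[of U]
    by (intro countable_disjoint_open_subsets) (auto simp: disjnt_def pairwise_def)
  define J where "J n = (if n \<in> to_nat_on D ` D then from_nat_into D n else {})" for n
  have JD: "J n \<in> D \<or> J n = {}" for n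
    unfolding J_def using cD by (auto simp: from_nat_into_to_nat_on)
  have C: "open C \<and> connected C \<and> C \<subseteq> U" if "C \<in> D" for C
    using that assms(1) unfolding D_def
    by (metis in_components_connected in_components_subset open_components)
  have sub: "J n \<subseteq> U" "open (J n)" "connected (J n)" for n
    using JD[of n] C by auto
  have bJ: "bounded (J n)" for n using sub(1) assms(2) bounded_subset by blast
  have "U = (\<Union>n. J n)"
  proof
    show "U \<subseteq> (\<Union>n. J n)"
    proof
      fix x assume "x \<in> U"
      then obtain C where C: "C \<in> D" "x \<in> C" unfolding D_def by (metis UnionE Union_components)
      then have "J (to_nat_on D C) = C" using cD by (simp add: J_def)
      then show "x \<in> (\<Union>n. J n)" using C by auto
    qed
  qed (use sub in auto)
  moreover have "disjoint_family J"
    unfolding disjoint_family_on_def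
  proof (intro ballI impI)
    fix i j :: nat assume ij: "i \<noteq> j"
    show "J i \<inter> J j = {}"
    proof (cases "i \<in> to_nat_on D ` D \<and> j \<in> to_nat_on D ` D")
      case True
      then obtain C C' where CC: "C \<in> D" "i = to_nat_on D C" "C' \<in> D" "j = to_nat_on D C'" by auto
      then have "J i = C" "J j = C'" "C \<noteq> C'" using cD ij by (auto simp: J_def)
      then show ?thesis using CC components_nonoverlap[of C U C'] unfolding D_def by auto
    qed (auto simp: J_def)
  qed
  moreover have "ennreal (diameter (J n)) \<le> emeasure lborel (J n)" for n
  proof -
    have le: "ennreal (dist x y) \<le> emeasure lborel (J n)" if "x \<in> J n" "y \<in> J n" for x y
    proof -
      have *: "ennreal (y - x) \<le> emeasure lborel (J n)" if "x \<in> J n" "y \<in> J n" "x \<le> y" for x y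
      proof -
        have "{x..y} \<subseteq> J n" using that sub(3)[of n] by (meson atLeastAtMost_iff connected_contains_Icc)
        then have "emeasure lborel {x..y} \<le> emeasure lborel (J n)"
          using sub(2) by (intro emeasure_mono) auto
        then show ?thesis using that by simp
      qed
      show ?thesis using *[of x y] *[of y x] that by (cases "x \<le> y") (auto simp: dist_real_def)
    qed
    show ?thesis
    proof (cases "emeasure lborel (J n)")
      case (real m)
      have "diameter (J n) \<le> m" using le real
        by (intro diameter_le) (auto simp: dist_norm)
      then show ?thesis using real by (simp add: ennreal_leI)
    qed simp
  qed
  ultimately show ?thesis using sub bJ by (intro exI[of _ J] conjI allI)
qed

lemma suminf_disjoint_intervals:
  fixes J :: "nat \<Rightarrow> real set"
  assumes "disjoint_family J" "\<And>n. open (J n)" "\<And>n. ennreal (diameter (J n)) \<le> emeasure lborel (J n)"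
  shows "(\<Sum>n. emeasure lborel (J n)) = emeasure lborel (\<Union>n. J n)"
    "(\<Sum>n. ennreal (diameter (J n))) \<le> emeasure lborel (\<Union>n. J n)"
proof -
  show *: "(\<Sum>n. emeasure lborel (J n)) = emeasure lborel (\<Union>n. J n)"
    using assms by (intro suminf_emeasure) auto
  show "(\<Sum>n. ennreal (diameter (J n))) \<le> emeasure lborel (\<Union>n. J n)"
    unfolding *[symmetric] by (intro suminf_le summableI assms)
qed

lemma compact_open_superset:
  fixes A :: "real set"
  assumes "compact A" "e > 0"
  shows "\<exists>U. open U \<and> bounded U \<and> A \<subseteq> U \<and> emeasure lborel U < emeasure lborel A + ennreal e"
proof -
  have A: "A \<in> sets borel" using assms(1) by (rule borel_compact)
  obtain U where U0: "open U" "A \<subseteq> U" "emeasure lborel (U - A) < ennreal e"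
    by (rule outer_regular_lborel[OF A assms(2)])
  have "emeasure lborel U = emeasure lborel A + emeasure lborel (U - A)"
    using U0 A plus_emeasure[of A lborel "U - A"] by (auto simp: Un_absorb1)
  also have "\<dots> < emeasure lborel A + ennreal e"
    using U0(3) emeasure_compact_finite[OF assms(1)] by (simp add: ennreal_add_left_cancel_less)
  finally have U: "A \<subseteq> U" "open U" "emeasure lborel U < emeasure lborel A + ennreal e" using U0 by auto
  obtain r where r: "A \<subseteq> ball 0 r" using compact_imp_bounded[OF assms(1)] by (metis bounded_subset_ballD)
  have "emeasure lborel (U \<inter> ball 0 r) \<le> emeasure lborel U" using U by (intro emeasure_mono) auto
  then show ?thesis using U r by (intro exI[of _ "U \<inter> ball 0 r"]) (auto intro: bounded_Int)
qed


lemma emeasure_pos_of_positive_length: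
  fixes A :: "real set"
  assumes "compact A" "positive_length A"
  shows "emeasure lborel A > 0"
proof (rule ccontr)
  assume "\<not> ?thesis"
  then have A0: "emeasure lborel A = 0" by simp
  obtain c where c: "c > 0" and cov: "\<And>U :: nat \<Rightarrow> _ set. A \<subseteq> (\<Union>n. U n) \<Longrightarrow> (\<And>n. bounded (U n)) \<Longrightarrow>
     ennreal c \<le> (\<Sum>n. ennreal (diameter (U n)))"
    using assms(2) unfolding positive_length_def by blast
  obtain U where U: "open U" "bounded U" "A \<subseteq> U" "emeasure lborel U < emeasure lborel A + ennreal c"
    using compact_open_superset[OF assms(1) c] by blast
  obtain J :: "nat \<Rightarrow> real set" where J: "U = (\<Union>n. J n)" "disjoint_family J"
    "\<forall>n. open (J n) \<and> connected (J n) \<and> bounded (J n) \<and> ennreal (diameter (J n)) \<le> emeasure lborel (J n)"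
    using open_real_disjoint_intervals[OF U(1,2)] by blast
  have "ennreal c \<le> (\<Sum>n. ennreal (diameter (J n)))" using U J by (intro cov) auto
  also have "\<dots> \<le> emeasure lborel U" unfolding J(1) by (rule suminf_disjoint_intervals) (use J in auto)
  finally show False using U(4) A0 by simp
qed

text \<open>A weak form of Lebesgue's density theorem whose interval has end points in \<open>A\<close>. Cover \<open>A\<close> by an
  open set of almost the same measure; in one of its components \<open>A\<close> must be nearly full.\<close>

lemma near_full_interval:
  fixes A :: "real set"
  assumes A: "compact A" "positive_length A" and \<eta>: "0 < \<eta>"
  obtains \<alpha> \<beta> where "\<alpha> \<in> A" "\<beta> \<in> A" "\<alpha> < \<beta>" "emeasure lborel ({\<alpha><..<\<beta>} - A) \<le> ennreal (\<eta> * (\<beta> - \<alpha>))"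
proof -
  have Ab: "A \<in> sets borel" using A(1) by (rule borel_compact)
  define m where "m = measure lborel A"
  have finA: "emeasure lborel A < \<infinity>" by (rule emeasure_compact_finite[OF A(1)])
  have m: "emeasure lborel A = ennreal m" unfolding m_def using finA by (intro emeasure_eq_ennreal_measure) auto
  have m0: "m > 0" using emeasure_pos_of_positive_length[OF A] m by (metis ennreal_less_zero_iff)
  obtain U where U: "open U" "bounded U" "A \<subseteq> U" "emeasure lborel U < emeasure lborel A + ennreal (\<eta> * m)"
    using compact_open_superset[OF A(1), of "\<eta> * m"] m0 \<eta> by auto
  obtain J :: "nat \<Rightarrow> real set" where J: "U = (\<Union>n. J n)" "disjoint_family J"
    "\<forall>n. open (J n) \<and> connected (J n) \<and> bounded (J n) \<and> ennreal (diameter (J n)) \<le> emeasure lborel (J n)"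
    using open_real_disjoint_intervals[OF U(1,2)] by blast
  have JU: "(\<Sum>n. emeasure lborel (J n)) = emeasure lborel U"
    unfolding J(1) by (rule suminf_disjoint_intervals) (use J in auto)
  have JA: "(\<Sum>n. emeasure lborel (A \<inter> J n)) = emeasure lborel A"
  proof -
    have "(\<Sum>n. emeasure lborel (A \<inter> J n)) = emeasure lborel (\<Union>n. A \<inter> J n)"
      using J Ab by (intro suminf_emeasure) (auto simp: disjoint_family_on_def)
    also have "(\<Union>n. A \<inter> J n) = A" using U(3) J(1) by auto
    finally show ?thesis .
  qed
  have "\<exists>n. emeasure lborel (J n) < ennreal (1 + \<eta>) * emeasure lborel (A \<inter> J n)"
  proof (rule ccontr)
    assume "\<not> ?thesis"
    then have "(\<Sum>n. ennreal (1 + \<eta>) * emeasure lborel (A \<inter> J n)) \<le> (\<Sum>n. emeasure lborel (J n))"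
      by (intro suminf_le summableI) (auto simp: not_less)
    then have "ennreal (1 + \<eta>) * ennreal m \<le> emeasure lborel U" using JU JA m by simp
    also have "\<dots> < ennreal m + ennreal (\<eta> * m)" using U(4) m by simp
    also have "\<dots> = ennreal (1 + \<eta>) * ennreal m"
      using m0 \<eta> by (simp add: distrib_right flip: ennreal_mult ennreal_plus)
    finally show False by simp
  qed
  then obtain n where n: "emeasure lborel (J n) < ennreal (1 + \<eta>) * emeasure lborel (A \<inter> J n)" by blast
  define X where "X = A \<inter> J n"
  have Xb: "X \<in> sets lborel" "J n \<in> sets lborel" "A \<in> sets lborel" using J Ab by (auto simp: X_def)
  have finX: "emeasure lborel X < \<infinity>"
    using finA emeasure_mono[of X A lborel] Ab by (auto simp: X_def intro: le_less_trans)
  have Xpos: "emeasure lborel X > 0" using n by (auto simp: X_def zero_less_iff_neq_zero)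
  then have Xne: "X \<noteq> {}" by auto
  have bX: "bdd_below X" "bdd_above X"
    using compact_imp_bounded[OF A(1)] by (auto simp: X_def intro: bounded_imp_bdd_below bounded_imp_bdd_above bounded_subset)
  define \<alpha> where "\<alpha> = Inf X"
  define \<beta> where "\<beta> = Sup X"
  have cl: "\<alpha> \<in> closure X" "\<beta> \<in> closure X"
    unfolding \<alpha>_def \<beta>_def using Xne bX by (auto intro: closure_contains_Inf closure_contains_Sup)
  moreover have clX: "closure X \<subseteq> A"
    using A(1) by (intro closure_minimal) (auto simp: X_def compact_imp_closed)
  ultimately have ab: "\<alpha> \<in> A" "\<beta> \<in> A" by auto
  have Xsub: "X \<subseteq> {\<alpha>..\<beta>}" using bX by (auto simp: \<alpha>_def \<beta>_def cInf_lower cSup_upper)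
  have le: "emeasure lborel X \<le> ennreal (\<beta> - \<alpha>)"
  proof -
    have "emeasure lborel X \<le> emeasure lborel {\<alpha>..\<beta>}" using Xsub by (intro emeasure_mono) auto
    then show ?thesis by (cases "\<alpha> \<le> \<beta>") auto
  qed
  then have "\<alpha> < \<beta>" using Xpos by (metis diff_gt_0_iff_gt ennreal_less_zero_iff less_le_trans)
  moreover have "emeasure lborel ({\<alpha><..<\<beta>} - A) \<le> ennreal (\<eta> * (\<beta> - \<alpha>))"
  proof -
    have mid: "{\<alpha><..<\<beta>} \<subseteq> J n"
    proof
      fix x assume x: "x \<in> {\<alpha><..<\<beta>}"
      then obtain y z where "y \<in> X" "y < x" "z \<in> X" "x < z"
        using Xne bX unfolding \<alpha>_def \<beta>_def by (auto simp: cInf_less_iff less_cSup_iff)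
      moreover have "connected (J n)" using J by auto
      ultimately show "x \<in> J n"
        using connectedD_interval[of "J n" y z x] by (auto simp: X_def)
    qed
    have "emeasure lborel ({\<alpha><..<\<beta>} - A) \<le> emeasure lborel (J n - X)"
      using mid Xb by (intro emeasure_mono) (auto simp: X_def)
    also have "\<dots> = emeasure lborel (J n) - emeasure lborel X"
      using Xb finX by (intro emeasure_Diff) (auto simp: X_def)
    also have "\<dots> \<le> ennreal (1 + \<eta>) * emeasure lborel X - emeasure lborel X"
      using n by (intro ennreal_minus_mono) (auto simp: X_def)
    also have "\<dots> \<le> ennreal \<eta> * emeasure lborel X"
    proof (cases "emeasure lborel X")
      case (real x)
      then show ?thesis using \<eta> by (simp add: distrib_right ennreal_minus flip: ennreal_mult)
    qed (use finX in simp)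
    also have "\<dots> \<le> ennreal \<eta> * ennreal (\<beta> - \<alpha>)" by (intro mult_left_mono le) auto
    also have "\<dots> = ennreal (\<eta> * (\<beta> - \<alpha>))" using \<eta> \<open>\<alpha> < \<beta>\<close> by (simp add: ennreal_mult)
    finally show ?thesis .
  qed
  ultimately show thesis using that ab by blast
qed

text \<open>The extension of McShane.\<close>

lemma lipschitz_extension_real:
  fixes g :: "real \<Rightarrow> real"
  assumes A: "A \<noteq> {}" and g: "\<And>s t. s \<in> A \<Longrightarrow> t \<in> A \<Longrightarrow> \<bar>g s - g t\<bar> \<le> L * \<bar>s - t\<bar>" and L: "L \<ge> 0"
  obtains G where "\<And>s. s \<in> A \<Longrightarrow> G s = g s" "\<And>s t. \<bar>G s - G t\<bar> \<le> L * \<bar>s - t\<bar>"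
proof -
  define G where "G t = (INF s\<in>A. g s + L * \<bar>t - s\<bar>)" for t
  obtain s0 where s0: "s0 \<in> A" using A by auto
  have tri: "L * \<bar>t - s\<bar> \<le> L * \<bar>t - u\<bar> + L * \<bar>u - s\<bar>" for t s u
    using mult_left_mono[OF _ L, of "\<bar>t - s\<bar>" "\<bar>t - u\<bar> + \<bar>u - s\<bar>"] by (simp add: distrib_left)
  have bdd: "bdd_below ((\<lambda>s. g s + L * \<bar>t - s\<bar>) ` A)" for t
  proof (rule bdd_belowI2)
    fix s assume s: "s \<in> A"
    show "g s0 - L * \<bar>t - s0\<bar> \<le> g s + L * \<bar>t - s\<bar>"
      using g[OF s0 s] tri[of s0 s t] by (simp add: abs_minus_commute)
  qed
  have one: "G s \<le> G t + L * \<bar>s - t\<bar>" for s t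
  proof -
    have "G s - L * \<bar>s - t\<bar> \<le> G t"
      unfolding G_def[of t]
    proof (rule cINF_greatest[OF A])
      fix u assume u: "u \<in> A"
      have "G s \<le> g u + L * \<bar>s - u\<bar>" unfolding G_def by (rule cINF_lower[OF bdd u])
      then show "G s - L * \<bar>s - t\<bar> \<le> g u + L * \<bar>t - u\<bar>" using tri[of s u t] by linarith
    qed
    then show ?thesis by simp
  qed
  show thesis
  proof (rule that)
    fix s assume s: "s \<in> A"
    have "G s \<le> g s + L * \<bar>s - s\<bar>" unfolding G_def by (rule cINF_lower[OF bdd s])
    moreover have "g s \<le> G s" unfolding G_def
      by (rule cINF_greatest[OF A]) (use g[OF s] in \<open>force simp: abs_le_iff\<close>)
    ultimately show "G s = g s" by simp
  next
    fix s t
    show "\<bar>G s - G t\<bar> \<le> L * \<bar>s - t\<bar>" using one[of s t] one[of t s] by (simp add: abs_le_iff abs_minus_commute)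
  qed
qed

text \<open>Extend \<open>g\<close> to a Lipschitz function \<open>G\<close> on the whole interval. The image under \<open>G\<close> contains the
  interval between \<open>g \<alpha>\<close> and \<open>g \<beta>\<close>, and only a part of small length can come from the complement
  of \<open>A\<close>; the rest belongs to \<open>g ` A\<close>.\<close>

lemma positive_length_lipschitz_image:
  fixes A :: "real set" and g :: "real \<Rightarrow> real"
  assumes \<alpha>\<beta>: "\<alpha> \<in> A" "\<beta> \<in> A" "\<alpha> < \<beta>" and A: "compact A"
    and gap: "emeasure lborel ({\<alpha><..<\<beta>} - A) \<le> ennreal (\<eta> * (\<beta> - \<alpha>))"
    and g: "\<And>s t. s \<in> A \<Longrightarrow> t \<in> A \<Longrightarrow> \<bar>g s - g t\<bar> \<le> L * \<bar>s - t\<bar>" and L: "L > 0"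
    and inc: "\<kappa> * (\<beta> - \<alpha>) \<le> \<bar>g \<beta> - g \<alpha>\<bar>" and \<kappa>: "\<kappa> > 0" "\<eta> \<ge> 0" "4 * L * \<eta> \<le> \<kappa>"
  shows "positive_length (g ` A)"
proof -
  obtain G where G: "\<And>s. s \<in> A \<Longrightarrow> G s = g s" "\<And>s t. \<bar>G s - G t\<bar> \<le> L * \<bar>s - t\<bar>"
    by (rule lipschitz_extension_real[of A g L]) (use \<alpha>\<beta> g L in auto)
  have contG: "continuous_on UNIV G"
  proof (rule continuous_on_subset[of UNIV])
    have "L-lipschitz_on UNIV G" using G(2) L by (auto simp: lipschitz_on_def dist_real_def)
    then show "continuous_on UNIV G" by (rule lipschitz_on_continuous_on)
  qed simp
  define O' where "O' = {\<alpha><..<\<beta>} - A"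
  have O': "open O'" "bounded O'"
    unfolding O'_def using A by (auto intro: open_Diff compact_imp_closed bounded_diff)
  obtain J :: "nat \<Rightarrow> real set" where J: "O' = (\<Union>n. J n)" "disjoint_family J"
    "\<forall>n. open (J n) \<and> connected (J n) \<and> bounded (J n) \<and> ennreal (diameter (J n)) \<le> emeasure lborel (J n)"
    using open_real_disjoint_intervals[OF O'] by blast
  have Jsum: "(\<Sum>n. ennreal (diameter (J n))) \<le> ennreal (\<eta> * (\<beta> - \<alpha>))"
    using suminf_disjoint_intervals(2)[of J] J gap by (simp add: O'_def)
  have dG: "ennreal (diameter (G ` J n)) \<le> ennreal L * ennreal (diameter (J n))" and bG: "bounded (G ` J n)" for n
  proof -
    have bJ: "bounded (J n)" using J by auto
    have le: "\<bar>G x - G y\<bar> \<le> L * diameter (J n)" if "x \<in> J n" "y \<in> J n" for x y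
    proof -
      have "\<bar>x - y\<bar> \<le> diameter (J n)" using diameter_bounded_bound[OF bJ that] by (simp add: dist_real_def)
      then show ?thesis using G(2)[of x y] L mult_left_mono[of "\<bar>x - y\<bar>" "diameter (J n)" L] by linarith
    qed
    show "bounded (G ` J n)" unfolding bounded_two_points using le by (auto simp: dist_real_def)
    have "diameter (G ` J n) \<le> L * diameter (J n)"
      by (rule diameter_le) (use le L diameter_ge_0[OF bJ] in auto)
    then show "ennreal (diameter (G ` J n)) \<le> ennreal L * ennreal (diameter (J n))"
      using L diameter_ge_0[OF bJ] by (simp add: ennreal_leI flip: ennreal_mult)
  qed
  define lo where "lo = min (g \<alpha>) (g \<beta>)"
  define hi where "hi = max (g \<alpha>) (g \<beta>)"
  have hilo: "\<kappa> * (\<beta> - \<alpha>) \<le> hi - lo" using inc by (auto simp: hi_def lo_def)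
  have range: "{lo..<hi} \<subseteq> G ` {\<alpha>..\<beta>}"
  proof
    fix y assume y: "y \<in> {lo..<hi}"
    have c: "connected (G ` {\<alpha>..\<beta>})"
      using contG by (intro connected_continuous_image) (auto intro: continuous_on_subset)
    have "lo \<in> G ` {\<alpha>..\<beta>}" "hi \<in> G ` {\<alpha>..\<beta>}"
      using G(1) \<alpha>\<beta> unfolding lo_def hi_def
      by (auto simp: min_def max_def image_iff intro: bexI[of _ \<alpha>] bexI[of _ \<beta>])
    then show "y \<in> G ` {\<alpha>..\<beta>}" using connectedD_interval[OF c, of lo hi y] y by auto
  qed
  have "ennreal (\<kappa> * (\<beta> - \<alpha>) / 4) \<le> (\<Sum>n. ennreal (diameter (V n)))"
    if V: "g ` A \<subseteq> (\<Union>n. V n)" "\<And>n. bounded (V n)" for V :: "nat \<Rightarrow> real set"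
  proof -
    have "{lo..<hi} \<subseteq> (\<Union>n. V n) \<union> (\<Union>n. G ` J n)"
    proof
      fix y assume "y \<in> {lo..<hi}"
      then obtain t where t: "t \<in> {\<alpha>..\<beta>}" "y = G t" using range by blast
      show "y \<in> (\<Union>n. V n) \<union> (\<Union>n. G ` J n)"
      proof (cases "t \<in> A")
        case True
        then show ?thesis using V(1) G(1) t by auto
      next
        case False
        then have "t \<in> O'" using t \<alpha>\<beta> by (auto simp: O'_def less_le)
        then show ?thesis using J(1) t by auto
      qed
    qed
    then have "ennreal (hi - lo) \<le> 2 * (\<Sum>n. ennreal (diameter (V n))) + 2 * (\<Sum>n. ennreal (diameter (G ` J n)))"
      by (rule half_length_le_two_cover_diameters) (use V bG in auto)
    also have "(\<Sum>n. ennreal (diameter (G ` J n))) \<le> (\<Sum>n. ennreal L * ennreal (diameter (J n)))"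
      by (intro suminf_le summableI dG)
    also have "\<dots> = ennreal L * (\<Sum>n. ennreal (diameter (J n)))" by simp
    also have "\<dots> \<le> ennreal L * ennreal (\<eta> * (\<beta> - \<alpha>))" by (intro mult_left_mono Jsum) auto
    also have "\<dots> = ennreal (L * \<eta> * (\<beta> - \<alpha>))" using L \<kappa> \<alpha>\<beta> by (simp add: mult.assoc flip: ennreal_mult)
    also have "\<dots> \<le> ennreal (\<kappa> * (\<beta> - \<alpha>) / 4)"
      using mult_right_mono[OF \<kappa>(3), of "\<beta> - \<alpha>"] \<alpha>\<beta> by (intro ennreal_leI) simp
    finally have *: "ennreal (hi - lo) \<le> 2 * (\<Sum>n. ennreal (diameter (V n))) + 2 * ennreal (\<kappa> * (\<beta> - \<alpha>) / 4)"
      by (simp add: add_left_mono mult_left_mono)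
    show ?thesis
    proof (cases "\<Sum>n. ennreal (diameter (V n))")
      case (real x)
      have pos: "0 \<le> \<kappa> * (\<beta> - \<alpha>)" using \<kappa> \<alpha>\<beta> by simp
      have q: "ennreal (2 * x + 2 * q) = 2 * ennreal x + 2 * ennreal q" if "0 \<le> q" for q
        using real that by (simp add: ennreal_mult)
      have "ennreal (2 * x + 2 * (\<kappa> * (\<beta> - \<alpha>) / 4)) = 2 * ennreal x + 2 * ennreal (\<kappa> * (\<beta> - \<alpha>) / 4)"
        using pos by (intro q) simp
      then have "ennreal (hi - lo) \<le> ennreal (2 * x + 2 * (\<kappa> * (\<beta> - \<alpha>) / 4))"
        using * by (simp only: real)
      then have "hi - lo \<le> 2 * x + 2 * (\<kappa> * (\<beta> - \<alpha>) / 4)"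
        using real pos by (subst (asm) ennreal_le_iff) auto
      then have "\<kappa> * (\<beta> - \<alpha>) / 4 \<le> x" using hilo by simp
      then show ?thesis using real by (simp add: ennreal_leI)
    qed simp
  qed
  moreover have "\<kappa> * (\<beta> - \<alpha>) / 4 > 0" using \<kappa> \<alpha>\<beta> by simp
  ultimately show ?thesis unfolding positive_length_def by blast
qed

text \<open>The assumption says that no chord is nearly parallel to \<open>v\<close>, so \<open>K\<close> is the graph of a Lipschitz
  function over a set \<open>A\<close> of positive length. If all chords are parallel, \<open>K\<close> lies in a line.
  Otherwise take chords with independent directions \<open>e\<close> and \<open>e1\<close> and an interval with end points in
  \<open>A\<close> in which \<open>A\<close> is nearly full. The chord between the corresponding points of \<open>K\<close> has a long
  projection in direction \<open>e\<close> or in direction \<open>e1\<close>, and \<open>positive_length_lipschitz_image\<close> applies.\<close>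

lemma chord_with_positive_projection:
  fixes K :: "complex set"
  assumes K: "compact K" "positive_length K" and v: "norm v = 1" and c: "c > 0"
    and steep: "\<And>x y. x \<in> K \<Longrightarrow> y \<in> K \<Longrightarrow> c * norm (x - y) \<le> \<bar>Im (cnj v * (x - y))\<bar>"
  shows "\<exists>x\<in>K. \<exists>y\<in>K. x \<noteq> y \<and> positive_length ((\<lambda>z. Re (cnj (sgn (x - y)) * z)) ` K)"
proof -
  obtain x0 where "x0 \<in> K" using positive_length_not_subset_singleton[OF K(2)] by blast
  then obtain y0 where xy: "x0 \<in> K" "y0 \<in> K" "x0 \<noteq> y0"
    using positive_length_not_subset_singleton[OF K(2), of x0] by blast
  define e where "e = sgn (x0 - y0)"
  have e: "norm e = 1" using xy by (simp add: e_def norm_sgn)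
  show ?thesis
  proof (cases "\<forall>x\<in>K. \<forall>y\<in>K. Im (cnj e * (x - y)) = 0")
    case True
    have "positive_length ((\<lambda>z. Re (cnj e * z)) ` K)"
    proof (rule positive_length_image[OF K(2), of 1])
      fix x y assume "x \<in> K" "y \<in> K"
      then have "Im (cnj e * (x - y)) = 0" using True by blast
      then have "norm (cnj e * (x - y)) = \<bar>Re (cnj e * (x - y))\<bar>" by (simp add: cmod_eq_Re)
      also have "\<dots> = dist (Re (cnj e * x)) (Re (cnj e * y))"
        by (simp only: dist_real_def right_diff_distrib minus_complex.simps)
      finally show "dist x y \<le> 1 * dist (Re (cnj e * x)) (Re (cnj e * y))"
        using e by (simp add: norm_mult dist_norm)
    qed simp
    then show ?thesis using xy unfolding e_def by blast
  next
    case False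
    then obtain x1 y1 where xy1: "x1 \<in> K" "y1 \<in> K" "Im (cnj e * (x1 - y1)) \<noteq> 0" by blast
    then have ne1: "x1 \<noteq> y1" by auto
    define e1 where "e1 = sgn (x1 - y1)"
    have e1: "norm e1 = 1" using ne1 by (simp add: e1_def norm_sgn)
    define k where "k = cnj e * e1"
    have nk: "norm k = 1" using e e1 by (simp add: k_def norm_mult)
    have k2: "Im k \<noteq> 0"
    proof -
      have "k = (cnj e * (x1 - y1)) / of_real (norm (x1 - y1))"
        by (simp add: k_def e1_def sgn_eq)
      then have "Im k = Im (cnj e * (x1 - y1)) / norm (x1 - y1)" by (simp only: Im_divide_of_real)
      then show ?thesis using xy1(3) ne1 by simp
    qed
    \<comment> \<open>\<open>Im k\<close> is, up to sign, the sine of the angle between the two chords.\<close>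
    define \<kappa> where "\<kappa> = \<bar>Im k\<bar> / 4"
    have \<kappa>: "\<kappa> > 0" using k2 by (simp add: \<kappa>_def)
    have dich: "\<kappa> * norm w \<le> \<bar>Re (cnj e * w)\<bar> \<or> \<kappa> * norm w \<le> \<bar>Re (cnj e1 * w)\<bar>" for w
    proof (rule ccontr)
      assume "\<not> ?thesis"
      then have lt: "\<bar>Re (cnj e * w)\<bar> < \<kappa> * norm w" "\<bar>Re (cnj e1 * w)\<bar> < \<kappa> * norm w" by auto
      define z where "z = cnj e * w"
      have nz: "norm z = norm w" using e by (simp add: z_def norm_mult)
      have "cnj k * z = (e * cnj e) * (cnj e1 * w)" by (simp add: k_def z_def)
      also have "e * cnj e = 1" using e by (simp add: complex_norm_square[symmetric])
      finally have "Re (cnj e1 * w) = Re k * Re z + Im k * Im z" by (simp add: complex_eq_iff)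
      then have im: "Im k * Im z = Re (cnj e1 * w) - Re k * Re z" by simp
      have "\<bar>Im k\<bar> * \<bar>Im z\<bar> \<le> \<bar>Re (cnj e1 * w)\<bar> + \<bar>Re k\<bar> * \<bar>Re z\<bar>"
        unfolding abs_mult[symmetric] im by (rule abs_triangle_ineq4)
      also have "\<bar>Re k\<bar> * \<bar>Re z\<bar> \<le> 1 * \<bar>Re z\<bar>"
        using abs_Re_le_cmod[of k] nk by (intro mult_right_mono) auto
      finally have "\<bar>Im k\<bar> * \<bar>Im z\<bar> < 2 * (\<kappa> * norm w)" using lt by (simp add: z_def)
      moreover have "\<bar>Im k\<bar> * \<bar>Re z\<bar> \<le> \<bar>Re z\<bar>"
        using abs_Im_le_cmod[of k] nk mult_right_mono[of "\<bar>Im k\<bar>" 1 "\<bar>Re z\<bar>"] by simp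
      moreover have "\<bar>Im k\<bar> * norm w \<le> \<bar>Im k\<bar> * (\<bar>Re z\<bar> + \<bar>Im z\<bar>)"
        unfolding nz[symmetric] by (intro mult_left_mono cmod_le) auto
      ultimately have "\<bar>Im k\<bar> * norm w < 3 * (\<kappa> * norm w)"
        using lt(1) by (simp add: z_def distrib_left)
      moreover have "\<bar>Im k\<bar> * norm w = 4 * (\<kappa> * norm w)" by (simp add: \<kappa>_def)
      moreover have "0 \<le> \<kappa> * norm w" using \<kappa> by simp
      ultimately show False by linarith
    qed
    define H where "H z = Im (cnj v * z)" for z
    have Hdiff: "H x - H y = Im (cnj v * (x - y))" for x y
      by (simp only: H_def right_diff_distrib minus_complex.simps)
    have H1: "\<bar>H x - H y\<bar> \<le> norm (x - y)" for x y
      using abs_Im_le_cmod[of "cnj v * (x - y)"] v unfolding Hdiff by (simp add: norm_mult)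
    have H2: "norm (x - y) \<le> (1 / c) * \<bar>H x - H y\<bar>" if "x \<in> K" "y \<in> K" for x y
      using steep[OF that] c unfolding Hdiff by (simp add: field_simps)
    define A where "A = H ` K"
    have cA: "compact A" unfolding A_def
    proof (rule compact_continuous_image[OF _ K(1)])
      show "continuous_on K H" unfolding H_def by (intro continuous_intros)
    qed
    have pA: "positive_length A" unfolding A_def
      by (rule positive_length_image[OF K(2), of "1 / c"]) (use H2 c in \<open>auto simp: dist_norm\<close>)
    define \<eta> where "\<eta> = \<kappa> * c / 4"
    have \<eta>: "\<eta> > 0" using \<kappa> c by (simp add: \<eta>_def)
    obtain \<alpha> \<beta> where ab: "\<alpha> \<in> A" "\<beta> \<in> A" "\<alpha> < \<beta>" "emeasure lborel ({\<alpha><..<\<beta>} - A) \<le> ennreal (\<eta> * (\<beta> - \<alpha>))"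
      by (rule near_full_interval[OF cA pA \<eta>])
    have "\<forall>t\<in>A. \<exists>x. x \<in> K \<and> H x = t" by (auto simp: A_def)
    from bchoice[OF this] obtain f where f0: "\<forall>t\<in>A. f t \<in> K \<and> H (f t) = t" by (elim exE)
    then have f: "f t \<in> K \<and> H (f t) = t" if "t \<in> A" for t using that by blast
    have fH: "f (H x) = x" if "x \<in> K" for x
    proof -
      have "f (H x) \<in> K" "H (f (H x)) = H x" using f[of "H x"] that by (auto simp: A_def)
      then show ?thesis using H2[of "f (H x)" x] that by simp
    qed
    have fA: "f ` A = K" using f fH unfolding A_def by force
    have lip: "\<bar>Re (cnj u * f s) - Re (cnj u * f t)\<bar> \<le> (1 / c) * \<bar>s - t\<bar>" if "norm u = 1" "s \<in> A" "t \<in> A" for u s t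
    proof -
      have "\<bar>Re (cnj u * f s) - Re (cnj u * f t)\<bar> = \<bar>Re (cnj u * (f s - f t))\<bar>"
        by (simp only: right_diff_distrib minus_complex.simps)
      also have "\<dots> \<le> norm (f s - f t)"
        using abs_Re_le_cmod[of "cnj u * (f s - f t)"] that by (simp add: norm_mult)
      also have "\<dots> \<le> (1 / c) * \<bar>s - t\<bar>" using H2[of "f s" "f t"] f that by auto
      finally show ?thesis .
    qed
    have pos: "positive_length ((\<lambda>z. Re (cnj u * z)) ` K)"
      if u: "norm u = 1" "\<kappa> * norm (f \<beta> - f \<alpha>) \<le> \<bar>Re (cnj u * (f \<beta> - f \<alpha>))\<bar>" for u
    proof -
      have "positive_length ((\<lambda>t. Re (cnj u * f t)) ` A)"
      proof (rule positive_length_lipschitz_image[OF ab(1-3) cA ab(4), of _ "1 / c" \<kappa>])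
        have "\<beta> - \<alpha> \<le> norm (f \<beta> - f \<alpha>)" using H1[of "f \<beta>" "f \<alpha>"] f ab by auto
        then have "\<kappa> * (\<beta> - \<alpha>) \<le> \<kappa> * norm (f \<beta> - f \<alpha>)" using \<kappa> by simp
        also have "\<dots> \<le> \<bar>Re (cnj u * f \<beta>) - Re (cnj u * f \<alpha>)\<bar>"
          using u(2) by (simp only: right_diff_distrib minus_complex.simps)
        finally show "\<kappa> * (\<beta> - \<alpha>) \<le> \<bar>Re (cnj u * f \<beta>) - Re (cnj u * f \<alpha>)\<bar>" .
      qed (use lip[OF u(1)] c \<kappa> \<eta> in \<open>auto simp: \<eta>_def\<close>)
      also have "(\<lambda>t. Re (cnj u * f t)) ` A = (\<lambda>z. Re (cnj u * z)) ` K"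
        unfolding fA[symmetric] image_image ..
      finally show ?thesis .
    qed
    from dich[of "f \<beta> - f \<alpha>"] show ?thesis
    proof
      assume "\<kappa> * norm (f \<beta> - f \<alpha>) \<le> \<bar>Re (cnj e * (f \<beta> - f \<alpha>))\<bar>"
      from pos[OF e this] show ?thesis using xy unfolding e_def by blast
    next
      assume "\<kappa> * norm (f \<beta> - f \<alpha>) \<le> \<bar>Re (cnj e1 * (f \<beta> - f \<alpha>))\<bar>"
      from pos[OF e1 this] show ?thesis using xy1 ne1 unfolding e1_def by blast
    qed
  qed
qed

section \<open>Trees with separated projections\<close>

text \<open>The first \<open>k\<close> digits of \<open>t\<close> in the mixed radix system with bases \<open>M\<close> determine the integer part
  of \<open>t\<close> times the product of the first \<open>k\<close> bases.\<close>

lemma mixed_radix_digits: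
  fixes M :: "nat \<Rightarrow> nat" and t t' :: real
  assumes M: "\<And>k. M k > 0" and t: "0 \<le> t" "t < 1" and t': "0 \<le> t'" "t' < 1"
    and eq: "\<And>j. j < k \<Longrightarrow> \<lfloor>t * real (\<Prod>i\<le>j. M i)\<rfloor> mod int (M j) = \<lfloor>t' * real (\<Prod>i\<le>j. M i)\<rfloor> mod int (M j)"
  shows "\<bar>t - t'\<bar> \<le> 1 / real (\<Prod>i<k. M i)"
proof -
  have "\<lfloor>t * real (\<Prod>i<k. M i)\<rfloor> = \<lfloor>t' * real (\<Prod>i<k. M i)\<rfloor>"
    using eq
  proof (induction k)
    case 0
    have "\<lfloor>t\<rfloor> = 0" "\<lfloor>t'\<rfloor> = 0" using t t' by (simp_all add: floor_eq_iff)
    then show ?case by simp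
  next
    case (Suc k)
    have div: "\<lfloor>x * real (\<Prod>i<Suc k. M i)\<rfloor> div int (M k) = \<lfloor>x * real (\<Prod>i<k. M i)\<rfloor>" for x
    proof -
      have "\<lfloor>x * real (\<Prod>i<Suc k. M i) / real_of_int (int (M k))\<rfloor> =
          \<lfloor>x * real (\<Prod>i<Suc k. M i)\<rfloor> div int (M k)"
        by (rule floor_divide_real_eq_div) simp
      moreover have "x * real (\<Prod>i<Suc k. M i) / real_of_int (int (M k)) = x * real (\<Prod>i<k. M i)"
        using M[of k] by simp
      ultimately show ?thesis by metis
    qed
    have "\<lfloor>t * real (\<Prod>i<k. M i)\<rfloor> = \<lfloor>t' * real (\<Prod>i<k. M i)\<rfloor>"
      using Suc by simp
    then have "\<lfloor>t * real (\<Prod>i<Suc k. M i)\<rfloor> div int (M k) = \<lfloor>t' * real (\<Prod>i<Suc k. M i)\<rfloor> div int (M k)"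
      unfolding div .
    moreover have "\<lfloor>t * real (\<Prod>i<Suc k. M i)\<rfloor> mod int (M k) = \<lfloor>t' * real (\<Prod>i<Suc k. M i)\<rfloor> mod int (M k)"
      using Suc.prems[of k] unfolding lessThan_Suc_atMost by simp
    ultimately show ?case by (metis mult_div_mod_eq)
  qed
  then have "\<bar>t * real (\<Prod>i<k. M i) - t' * real (\<Prod>i<k. M i)\<bar> \<le> 1" by linarith
  then have "\<bar>t - t'\<bar> * real (\<Prod>i<k. M i) \<le> 1"
    by (simp add: abs_mult prod_nonneg flip: left_diff_distrib)
  moreover have "real (\<Prod>i<k. M i) > 0" using M by (simp add: prod_pos)
  ultimately show ?thesis by (simp add: field_simps)
qed

text \<open>If \<open>norm a < 1\<close> and \<open>\<omega>\<close> is bounded, this is the limit of \<open>f\<^sub>0 (f\<^sub>1 (\<dots> (f\<^sub>n x)))\<close> for the maps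
  \<open>f\<^sub>j z = a z + \<omega> j\<close>, whatever the starting point \<open>x\<close>.\<close>

definition address_point :: "complex \<Rightarrow> (nat \<Rightarrow> complex) \<Rightarrow> complex" where
  "address_point a \<omega> = (\<Sum>j. a ^ j * \<omega> j)"

lemma summable_address:
  fixes a :: complex
  assumes "norm a < 1" "\<And>j. norm (\<omega> j) \<le> m"
  shows "summable (\<lambda>j. a ^ j * \<omega> j)"
proof (rule summable_comparison_test)
  show "\<exists>N. \<forall>n\<ge>N. norm (a ^ n * \<omega> n) \<le> norm a ^ n * m"
    using assms by (auto simp: norm_mult norm_power intro!: mult_left_mono)
  show "summable (\<lambda>n. norm a ^ n * m)"
    using assms by (intro summable_mult2 summable_geometric) auto
qed

lemma address_point_split:
  assumes "norm a < 1" "\<And>j. norm (\<omega> j) \<le> m"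
  shows "address_point a \<omega> = (\<Sum>j<k. a ^ j * \<omega> j) + a ^ k * address_point a (\<lambda>j. \<omega> (k + j))"
proof -
  have s: "summable (\<lambda>j. a ^ j * \<omega> j)" by (rule summable_address[OF assms])
  have s': "summable (\<lambda>j. a ^ j * \<omega> (k + j))" by (rule summable_address[OF assms])
  have "(\<Sum>j. a ^ (j + k) * \<omega> (j + k)) = (\<Sum>j. a ^ k * (a ^ j * \<omega> (k + j)))"
    by (simp add: power_add mult_ac add.commute)
  also have "\<dots> = a ^ k * address_point a (\<lambda>j. \<omega> (k + j))"
    unfolding address_point_def by (rule suminf_mult[OF s'])
  finally show ?thesis
    unfolding address_point_def[of a \<omega>] suminf_split_initial_segment[OF s, of k] by simp
qed

lemma address_point_in:
  assumes a: "norm a < 1" and K: "closed K" "p0 \<in> K" and m: "\<And>j. norm (\<omega> j) \<le> m"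
    and inv: "\<And>j x. x \<in> K \<Longrightarrow> a * x + \<omega> j \<in> K"
  shows "address_point a \<omega> \<in> K"
proof -
  have fin: "(\<Sum>j<n. a ^ j * \<omega>' j) + a ^ n * p0 \<in> K" if "\<And>j x. x \<in> K \<Longrightarrow> a * x + \<omega>' j \<in> K" for n \<omega>'
    using that
  proof (induction n arbitrary: \<omega>')
    case (Suc n)
    have "(\<Sum>j<n. a ^ j * \<omega>' (Suc j)) + a ^ n * p0 \<in> K" using Suc.prems by (rule Suc.IH)
    then have "a * ((\<Sum>j<n. a ^ j * \<omega>' (Suc j)) + a ^ n * p0) + \<omega>' 0 \<in> K" by (rule Suc.prems)
    moreover have "a * ((\<Sum>j<n. a ^ j * \<omega>' (Suc j)) + a ^ n * p0) + \<omega>' 0 = (\<Sum>j<Suc n. a ^ j * \<omega>' j) + a ^ Suc n * p0"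
      unfolding sum.lessThan_Suc_shift by (simp add: distrib_left sum_distrib_left mult.assoc)
    ultimately show ?case by simp
  qed (use K in simp)
  have "(\<lambda>n. (\<Sum>j<n. a ^ j * \<omega> j) + a ^ n * p0) \<longlonglongrightarrow> address_point a \<omega> + 0 * p0"
    unfolding address_point_def using a
    by (intro tendsto_intros summable_LIMSEQ summable_address[OF a m] LIMSEQ_power_zero) auto
  then have lim: "(\<lambda>n. (\<Sum>j<n. a ^ j * \<omega> j) + a ^ n * p0) \<longlonglongrightarrow> address_point a \<omega>" by simp
  have "(\<Sum>j<n. a ^ j * \<omega> j) + a ^ n * p0 \<in> K" for n by (rule fin) (rule inv)
  then show ?thesis by (rule closed_sequentially[OF K(1) _ lim])
qed

text \<open>Send \<open>t \<in> [0, 1)\<close> to the point of \<open>K\<close> whose address consists of the mixed radix digits of \<open>t\<close>, and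
  then apply \<open>\<phi>\<close>. If the digits of two numbers first differ at place \<open>k\<close>, the numbers differ by at
  most the reciprocal of the number of nodes at level \<open>k\<close>. The two points differ by at most
  \<open>d * norm a ^ k\<close>, and their projections by at least \<open>norm a ^ (k + 1)\<close>: the gap \<open>d + 1\<close>
  beats the diameter \<open>d\<close> of the pieces. The bound on \<open>\<delta>\<close> makes the loss
  in the linearisation of \<open>\<phi>\<close> at most half of this.\<close>

lemma hausdorff_measure_pos_of_separated_tree:
  fixes K :: "complex set" and B :: "nat \<Rightarrow> complex set" and \<phi> :: "complex \<Rightarrow> real"
  assumes K: "closed K" "p0 \<in> K" "\<And>x y. x \<in> K \<Longrightarrow> y \<in> K \<Longrightarrow> norm (x - y) \<le> d"
    and a: "a \<noteq> 0" "norm a < 1"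
    and B: "\<And>k. finite (B k)" "\<And>k. B k \<noteq> {}" "\<And>k b x. b \<in> B k \<Longrightarrow> x \<in> K \<Longrightarrow> a * x + b \<in> K"
    and e: "norm e = 1"
    and sep: "\<And>k b b'. \<lbrakk>b \<in> B k; b' \<in> B k; b \<noteq> b'\<rbrakk> \<Longrightarrow>
        (d + 1) * norm a ^ Suc k \<le> \<bar>Re (cnj e * (a ^ k * (b - b')))\<bar>"
    and growth: "c > 0" "s > 0" "\<And>k. c * norm a powr (-(s * real k)) \<le> real (\<Prod>j<k. card (B j))"
    and \<phi>: "\<And>x. x \<in> K \<Longrightarrow> \<phi> x \<in> D" "\<theta> > 0" "\<delta> * d \<le> norm a / 2" "\<delta> \<ge> 0"
      "\<And>x y. x \<in> K \<Longrightarrow> y \<in> K \<Longrightarrow> \<theta> * (\<bar>Re (cnj e * (x - y))\<bar> - \<delta> * norm (x - y)) \<le> \<bar>\<phi> x - \<phi> y\<bar>"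
    and s0: "0 \<le> s0" "s0 \<le> s"
  shows "hausdorff_measure s0 D > 0"
proof -
  define r where "r = norm a"
  have r: "0 < r" "r < 1" using a by (auto simp: r_def)
  have d0: "d \<ge> 0" using K(3)[OF K(2) K(2)] by simp
  define m where "m = 2 * norm p0 + d"
  have bm: "norm b \<le> m" if "b \<in> B k" for b k
  proof -
    have "norm ((a * p0 + b) - p0) \<le> d" using that B(3) K by auto
    moreover have "norm b = norm (((a * p0 + b) - p0) + (p0 - a * p0))" by simp
    moreover have "norm (p0 - a * p0) \<le> norm p0 + norm p0"
      using a(2) norm_triangle_ineq4[of p0 "a * p0"] mult_right_mono[of "norm a" 1 "norm p0"]
      by (simp add: norm_mult)
    ultimately show ?thesis using norm_triangle_ineq[of "(a * p0 + b) - p0" "p0 - a * p0"]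
      unfolding m_def by simp
  qed
  define M where "M k = card (B k)" for k
  have M0: "M k > 0" for k using B by (simp add: M_def card_gt_0_iff)
  have "\<exists>h. bij_betw h {0..<M k} (B k)" for k unfolding M_def by (rule ex_bij_betw_nat_finite[OF B(1)])
  then obtain h where h: "\<And>k. bij_betw (h k) {0..<M k} (B k)" by metis
  define dig where "dig t k = nat (\<lfloor>t * real (\<Prod>i\<le>k. M i)\<rfloor> mod int (M k))" for t :: real and k
  have dig: "dig t k < M k" for t k
    using M0[of k] by (simp add: dig_def nat_less_iff)
  have dig_eq: "\<lfloor>t * real (\<Prod>i\<le>k. M i)\<rfloor> mod int (M k) = \<lfloor>t' * real (\<Prod>i\<le>k. M i)\<rfloor> mod int (M k)"
    if "dig t k = dig t' k" for t t' k
    using that M0[of k] by (simp add: dig_def nat_eq_iff2)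
  define \<omega> where "\<omega> t k = h k (dig t k)" for t k
  have \<omega>B: "\<omega> t k \<in> B k" for t k
    using bij_betwE[OF h] dig by (auto simp: \<omega>_def)
  define pt where "pt t k = address_point a (\<lambda>j. \<omega> t (k + j))" for t k
  have ptK: "pt t k \<in> K" for t k
    unfolding pt_def using bm[OF \<omega>B] B(3)[OF \<omega>B] by (intro address_point_in[OF a(2) K(1,2)]) auto
  have split: "pt t 0 = (\<Sum>j<k. a ^ j * \<omega> t j) + a ^ k * pt t k" for t k
    using address_point_split[OF a(2), of "\<omega> t" m k] bm[OF \<omega>B] by (simp add: pt_def)
  have split1: "pt t k = \<omega> t k + a * pt t (Suc k)" for t k
    using address_point_split[OF a(2), of "\<lambda>j. \<omega> t (k + j)" m 1] bm[OF \<omega>B] by (simp add: pt_def)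
  define C where "C = 1 / (c * (\<theta> * r / 2) powr s)"
  have C: "C > 0" using growth \<phi> r by (simp add: C_def)
  have main: "\<bar>t - t'\<bar> \<le> C * dist (\<phi> (pt t 0)) (\<phi> (pt t' 0)) powr s"
    if t: "0 \<le> t" "t < 1" "0 \<le> t'" "t' < 1" for t t'
  proof (cases "\<forall>k. dig t k = dig t' k")
    case True
    have "\<bar>t - t'\<bar> \<le> (1 / c) * (r powr s) ^ k" for k
    proof -
      have "\<bar>t - t'\<bar> \<le> 1 / real (\<Prod>i<k. M i)"
        by (rule mixed_radix_digits[OF M0 t]) (use True dig_eq in blast)
      also have "\<dots> \<le> 1 / (c * r powr (-(s * real k)))"
        using growth(3)[of k] growth(1) r M0
        by (intro divide_left_mono) (auto simp: M_def r_def prod_pos)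
      also have "\<dots> = (1 / c) * (r powr s) ^ k"
        using r by (simp add: powr_minus powr_power field_simps)
      finally show ?thesis .
    qed
    moreover have "(\<lambda>k. (1 / c) * (r powr s) ^ k) \<longlonglongrightarrow> (1 / c) * 0"
    proof -
      have "r powr s < r powr 0" using r growth(2) by (intro powr_less_mono') auto
      then have "r powr s < 1" using r by simp
      then show ?thesis by (intro tendsto_mult_left LIMSEQ_realpow_zero) auto
    qed
    ultimately have "\<bar>t - t'\<bar> \<le> 1 / c * 0"
      by (intro tendsto_lowerbound[where F = sequentially]) (auto intro: always_eventually)
    moreover have "0 \<le> C * dist (\<phi> (pt t 0)) (\<phi> (pt t' 0)) powr s" using C by simp
    ultimately show ?thesis by simp
  next
    case False
    define k where "k = (LEAST k. dig t k \<noteq> dig t' k)"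
    have k: "dig t k \<noteq> dig t' k" "\<And>j. j < k \<Longrightarrow> dig t j = dig t' j"
      unfolding k_def using LeastI_ex[of "\<lambda>k. dig t k \<noteq> dig t' k"] not_less_Least False by auto
    have "\<omega> t k \<noteq> \<omega> t' k"
      unfolding \<omega>_def using k(1) dig inj_onD[OF bij_betw_imp_inj_on[OF h]] by (metis atLeastLessThan_iff zero_le)
    then have sepk: "(d + 1) * r ^ Suc k \<le> \<bar>Re (cnj e * (a ^ k * (\<omega> t k - \<omega> t' k)))\<bar>"
      unfolding r_def by (intro sep \<omega>B)
    have "(\<Sum>j<k. a ^ j * \<omega> t j) = (\<Sum>j<k. a ^ j * \<omega> t' j)"
      by (rule sum.cong) (auto simp: \<omega>_def k(2))
    then have diff: "pt t 0 - pt t' 0 = a ^ k * (pt t k - pt t' k)"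
      using split[of t k] split[of t' k] by (simp add: right_diff_distrib)
    have n1: "norm (pt t 0 - pt t' 0) \<le> r ^ k * d"
      unfolding diff norm_mult norm_power r_def by (intro mult_left_mono K(3) ptK) auto
    define w where "w = a ^ Suc k * (pt t (Suc k) - pt t' (Suc k))"
    have w: "norm w \<le> r ^ Suc k * d"
      unfolding w_def norm_mult norm_power r_def by (intro mult_left_mono K(3) ptK) auto
    have "pt t 0 - pt t' 0 = a ^ k * (\<omega> t k - \<omega> t' k) + w"
      unfolding diff w_def split1[of t k] split1[of t' k] by (simp add: algebra_simps)
    then have "cnj e * (pt t 0 - pt t' 0) = cnj e * (a ^ k * (\<omega> t k - \<omega> t' k)) + cnj e * w"
      by (simp add: distrib_left)
    then have "Re (cnj e * (pt t 0 - pt t' 0)) = Re (cnj e * (a ^ k * (\<omega> t k - \<omega> t' k))) + Re (cnj e * w)"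
      by simp
    moreover have "\<bar>Re (cnj e * w)\<bar> \<le> r ^ Suc k * d"
      using abs_Re_le_cmod[of "cnj e * w"] w e by (simp add: norm_mult)
    ultimately have re: "r ^ Suc k \<le> \<bar>Re (cnj e * (pt t 0 - pt t' 0))\<bar>"
      using sepk by (simp add: algebra_simps)
    have "\<delta> * norm (pt t 0 - pt t' 0) \<le> \<delta> * (r ^ k * d)"
      using n1 \<phi>(4) by (rule mult_left_mono)
    also have "\<dots> = r ^ k * (\<delta> * d)" by simp
    also have "\<dots> \<le> r ^ k * (r / 2)" using \<phi>(3) r by (intro mult_left_mono) (auto simp: r_def)
    also have "\<dots> = r ^ Suc k / 2" by simp
    finally have "r ^ Suc k / 2 \<le> \<bar>Re (cnj e * (pt t 0 - pt t' 0))\<bar> - \<delta> * norm (pt t 0 - pt t' 0)"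
      using re by linarith
    then have "\<theta> * (r ^ Suc k / 2) \<le> \<theta> * (\<bar>Re (cnj e * (pt t 0 - pt t' 0))\<bar> - \<delta> * norm (pt t 0 - pt t' 0))"
      using \<phi>(2) by (intro mult_left_mono) auto
    also have "\<dots> \<le> dist (\<phi> (pt t 0)) (\<phi> (pt t' 0))"
      unfolding dist_real_def by (intro \<phi>(5) ptK)
    finally have "(\<theta> * r / 2) * r ^ k \<le> dist (\<phi> (pt t 0)) (\<phi> (pt t' 0))" by simp
    then have "((\<theta> * r / 2) * r ^ k) powr s \<le> dist (\<phi> (pt t 0)) (\<phi> (pt t' 0)) powr s"
      using \<phi>(2) r growth(2) by (intro powr_mono2) auto
    moreover have "((\<theta> * r / 2) * r ^ k) powr s = (\<theta> * r / 2) powr s * r powr (s * k)"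
    proof -
      have "(r ^ k) powr s = r powr (s * k)"
        using r by (simp add: powr_realpow[symmetric] powr_powr mult.commute)
      then show ?thesis using \<phi>(2) r by (subst powr_mult) auto
    qed
    ultimately have "C * ((\<theta> * r / 2) powr s * r powr (s * k)) \<le> C * dist (\<phi> (pt t 0)) (\<phi> (pt t' 0)) powr s"
      using C by (intro mult_left_mono) auto
    moreover have "C * ((\<theta> * r / 2) powr s * r powr (s * k)) = r powr (s * k) / c"
      using \<phi>(2) r growth(1) by (simp add: C_def)
    moreover have "\<bar>t - t'\<bar> \<le> r powr (s * k) / c"
    proof -
      have "\<bar>t - t'\<bar> \<le> 1 / real (\<Prod>i<k. M i)"
        by (rule mixed_radix_digits[OF M0 t]) (use k(2) dig_eq in blast)
      also have "\<dots> \<le> 1 / (c * r powr (-(s * real k)))"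
        using growth(3)[of k] growth(1) r M0
        by (intro divide_left_mono) (auto simp: M_def r_def prod_pos)
      also have "\<dots> = r powr (s * k) / c"
        using r by (simp add: powr_minus field_simps)
      finally show ?thesis .
    qed
    ultimately show ?thesis by linarith
  qed
  show ?thesis
    by (rule hausdorff_measure_pos_if_expanding_map[of "\<lambda>t. \<phi> (pt t 0)" D C s s0])
       (use main ptK \<phi>(1) s0 growth(2) C in auto)
qed

section \<open>Distance sets\<close>

text \<open>With \<open>w\<close> the quotient of \<open>p + q\<close> by \<open>norm p + norm q\<close> the identity
  \<open>norm p - norm q = Re (cnj w * (p - q))\<close> is exact, and \<open>w\<close> is a convex combination of \<open>sgn p\<close> and
  \<open>sgn q\<close>.\<close>

lemma norm_diff_linearised:
  fixes p q u :: complex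
  assumes "p \<noteq> 0" "q \<noteq> 0" "norm (sgn p - u) \<le> \<delta>" "norm (sgn q - u) \<le> \<delta>"
  shows "\<bar>Re (cnj u * (p - q))\<bar> - \<delta> * norm (p - q) \<le> \<bar>norm p - norm q\<bar>"
proof -
  define s where "s = norm p + norm q"
  have s: "s > 0" using assms(1,2) unfolding s_def by (intro add_pos_pos) auto
  define w where "w = (p + q) / of_real s"
  have pq: "p = of_real (norm p) * sgn p" "q = of_real (norm q) * sgn q"
    by (simp_all add: sgn_eq assms)
  have "w - u = (of_real (norm p) * (sgn p - u) + of_real (norm q) * (sgn q - u)) / of_real s"
  proof -
    have "of_real (norm p) * (sgn p - u) + of_real (norm q) * (sgn q - u) = (p + q) - of_real s * u"
      using pq by (simp add: algebra_simps s_def)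
    then show ?thesis using s by (simp add: w_def field_simps)
  qed
  then have "norm (w - u) = norm (of_real (norm p) * (sgn p - u) + of_real (norm q) * (sgn q - u)) / s"
    using s by (simp add: norm_divide)
  also have "\<dots> \<le> (norm p * \<delta> + norm q * \<delta>) / s"
  proof (rule divide_right_mono)
    show "norm (of_real (norm p) * (sgn p - u) + of_real (norm q) * (sgn q - u)) \<le> norm p * \<delta> + norm q * \<delta>"
      using assms(3,4) by (intro norm_triangle_le add_mono) (auto simp: norm_mult intro!: mult_left_mono)
  qed (use s in simp)
  also have "\<dots> = \<delta>" using s by (simp add: s_def flip: distrib_right)
  finally have wu: "norm (w - u) \<le> \<delta>" .
  have "Re (cnj w * (p - q)) = ((norm p)\<^sup>2 - (norm q)\<^sup>2) / s"
  proof -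
    have "cnj w * (p - q) = (cnj (p + q) * (p - q)) / of_real s" by (simp add: w_def)
    then have "Re (cnj w * (p - q)) = Re (cnj (p + q) * (p - q)) / s" by (simp only: Re_divide_of_real)
    also have "Re (cnj (p + q) * (p - q)) = (norm p)\<^sup>2 - (norm q)\<^sup>2"
      unfolding cmod_power2 by (simp add: power2_eq_square algebra_simps)
    finally show ?thesis .
  qed
  also have "(norm p)\<^sup>2 - (norm q)\<^sup>2 = (norm p - norm q) * s"
    by (simp add: s_def power2_eq_square algebra_simps)
  finally have w: "Re (cnj w * (p - q)) = norm p - norm q" using s by simp
  have "cnj u * (p - q) = cnj w * (p - q) - cnj (w - u) * (p - q)" by (simp add: algebra_simps)
  then have "Re (cnj u * (p - q)) = Re (cnj w * (p - q)) - Re (cnj (w - u) * (p - q))" by (simp only: minus_complex.simps)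
  moreover have "\<bar>Re (cnj (w - u) * (p - q))\<bar> \<le> \<delta> * norm (p - q)"
  proof -
    have "\<bar>Re (cnj (w - u) * (p - q))\<bar> \<le> norm (cnj (w - u) * (p - q))" by (rule abs_Re_le_cmod)
    also have "\<dots> = norm (w - u) * norm (p - q)" by (simp only: norm_mult complex_mod_cnj)
    also have "\<dots> \<le> \<delta> * norm (p - q)" using wu by (intro mult_right_mono) auto
    finally show ?thesis .
  qed
  ultimately show ?thesis using w by linarith
qed

lemma Re_of_real_mult: "Re (of_real r * z) = r * Re z"
  by simp

lemma Re_unit_mult_le: "norm u = 1 \<Longrightarrow> \<bar>Re (cnj u * z)\<bar> \<le> norm z"
  using abs_Re_le_cmod[of "cnj u * z"] by (simp add: norm_mult)

context planar_ifs
begin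

text \<open>The bound holds for all words that begin with \<open>f\<close>, which leaves room to adjust the rotation by
  appending a word \<open>u\<close>.\<close>

lemma small_piece_seen_in_one_direction:
  assumes xy: "x0 \<in> K" "y0 \<in> K" "x0 \<noteq> y0" and \<delta>: "\<delta> > 0"
  shows "\<exists>f\<in>G. \<forall>u\<in>G. \<forall>x\<in>K. sim_app (sim_comp f u) x \<noteq> y0 \<and>
    norm (sgn (sim_app (sim_comp f u) x - y0) - sgn (x0 - y0)) \<le> \<delta>"
proof -
  have "isCont sgn (x0 - y0)" using xy by (intro continuous_intros) auto
  then obtain \<eta> where \<eta>: "\<eta> > 0" "\<And>z. dist z (x0 - y0) < \<eta> \<Longrightarrow> dist (sgn z) (sgn (x0 - y0)) < \<delta>"
    using \<delta> unfolding continuous_at_eps_delta by metis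
  define r where "r = min \<eta> (norm (x0 - y0))"
  have r: "r > 0" using \<eta> xy by (simp add: r_def)
  obtain R where R: "0 < R" "R < 1" "\<And>n f. f \<in> sim_words F n \<Longrightarrow> sim_ratio f \<le> R ^ n"
    using sim_words_ratio_le by blast
  have "(\<lambda>n. R ^ n * (diam_K + 1)) \<longlonglongrightarrow> 0 * (diam_K + 1)"
    using R by (intro tendsto_mult_right LIMSEQ_realpow_zero) auto
  then have "eventually (\<lambda>n. R ^ n * (diam_K + 1) < r) sequentially"
    using r by (intro order_tendstoD) auto
  then obtain n where n: "R ^ n * (diam_K + 1) < r"
    using eventually_happens'[OF sequentially_bot] by (metis (mono_tags, lifting))
  obtain f x1 where f: "f \<in> sim_words F n" "x1 \<in> K" "x0 = sim_app f x1"
    using sim_words_cover[of n] xy(1) by blast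
  have fG: "f \<in> G" using f sim_words_subset_G by blast
  have close: "norm ((sim_app (sim_comp f u) x - y0) - (x0 - y0)) < r" if "u \<in> G" "x \<in> K" for u x
  proof -
    have "norm ((sim_app (sim_comp f u) x - y0) - (x0 - y0)) = dist (sim_app f (sim_app u x)) (sim_app f x1)"
      by (simp add: f(3) sim_app_comp dist_norm)
    also have "\<dots> = sim_ratio f * dist (sim_app u x) x1" by (rule dist_sim_app)
    also have "\<dots> \<le> R ^ n * (diam_K + 1)"
      using R f G_ratio[OF fG] dist_le_diam_K[OF G_app[OF that] f(2)] by (intro mult_mono) auto
    finally show ?thesis using n by simp
  qed
  show ?thesis
  proof (intro bexI[of _ f] ballI conjI)
    fix u x assume ux: "u \<in> G" "x \<in> K"
    show "sim_app (sim_comp f u) x \<noteq> y0" using close[OF ux] by (auto simp: r_def norm_minus_commute)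
    have "dist (sim_app (sim_comp f u) x - y0) (x0 - y0) < \<eta>"
      using close[OF ux] by (simp add: r_def dist_norm)
    then show "norm (sgn (sim_app (sim_comp f u) x - y0) - sgn (x0 - y0)) \<le> \<delta>"
      using \<eta>(2) by (fastforce simp: dist_norm)
  qed (rule fG)
qed

text \<open>The tree lies in \<open>K\<close> itself; its image under \<open>z \<mapsto> t z + b\<^sub>0\<close> is a tree in a small piece on which
  the distance to \<open>y\<^sub>0\<close> is nearly a projection. The direction of projection, pulled back through this
  map and through the first \<open>k\<close> levels, is turned by \<open>sgn t * sgn a ^ k\<close>.\<close>

lemma distance_set_from_separated_tree:
  assumes xy: "x0 \<in> K" "y0 \<in> K" "x0 \<noteq> y0"
    and t: "(False, t, b0) \<in> G"
    and dir: "\<And>x. x \<in> K \<Longrightarrow> t * x + b0 \<noteq> y0 \<and> norm (sgn (t * x + b0 - y0) - sgn (x0 - y0)) \<le> \<delta>"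
    and \<delta>: "\<delta> \<ge> 0" "\<delta> * diam_K \<le> norm a / 2"
    and a: "a \<noteq> 0" "norm a < 1"
    and B: "\<And>k. finite (B k)" "\<And>k. B k \<noteq> {}" "\<And>k b x. b \<in> B k \<Longrightarrow> x \<in> K \<Longrightarrow> a * x + b \<in> K"
    and sep: "\<And>k b b'. \<lbrakk>b \<in> B k; b' \<in> B k; b \<noteq> b'\<rbrakk> \<Longrightarrow>
        (diam_K + 1) * norm a \<le> \<bar>Re (cnj (sgn (x0 - y0)) * sgn t * sgn a ^ k * (b - b'))\<bar>"
    and growth: "c > 0" "s > 0" "\<And>k. c * norm a powr (-(s * real k)) \<le> real (\<Prod>j<k. card (B j))"
    and s0: "0 \<le> s0" "s0 \<le> s"
  shows "hausdorff_measure s0 (distance_set K) > 0"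
proof -
  have t0: "t \<noteq> 0" using G_coeff_nonzero[OF t] .
  define e where "e = sgn (x0 - y0) * cnj (sgn t)"
  have ne: "norm e = 1" using xy t0 by (simp add: e_def norm_mult norm_sgn)
  have ce: "cnj e = cnj (sgn (x0 - y0)) * sgn t" by (simp add: e_def)
  obtain p0 where p0: "p0 \<in> K" using K_nonempty by auto
  have tn: "t = of_real (norm t) * sgn t" using t0 by (simp add: sgn_eq)
  have an: "a = of_real (norm a) * sgn a" using a by (simp add: sgn_eq)
  show ?thesis
  proof (rule hausdorff_measure_pos_of_separated_tree[where K = K and B = B and a = a and e = e and d = diam_K
        and c = c and s = s and \<theta> = "norm t" and \<delta> = \<delta> and \<phi> = "\<lambda>x. norm (t * x + b0 - y0)"])
    show "closed K" using compact_K by (rule compact_imp_closed)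
    show "p0 \<in> K" by (rule p0)
    show "norm (x - y) \<le> diam_K" if "x \<in> K" "y \<in> K" for x y
      using dist_le_diam_K[OF that] by (simp add: dist_norm)
    show "(diam_K + 1) * norm a ^ Suc k \<le> \<bar>Re (cnj e * (a ^ k * (b - b')))\<bar>"
      if "b \<in> B k" "b' \<in> B k" "b \<noteq> b'" for k b b'
    proof -
      have "a ^ k = of_real (norm a ^ k) * sgn a ^ k" by (subst an) (simp add: power_mult_distrib)
      then have "cnj e * (a ^ k * (b - b')) = of_real (norm a ^ k) * (cnj (sgn (x0 - y0)) * sgn t * sgn a ^ k * (b - b'))"
        by (simp add: ce mult_ac)
      then have "\<bar>Re (cnj e * (a ^ k * (b - b')))\<bar> = norm a ^ k * \<bar>Re (cnj (sgn (x0 - y0)) * sgn t * sgn a ^ k * (b - b'))\<bar>"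
        by (simp only: Re_of_real_mult abs_mult) simp
      moreover have "norm a ^ k * ((diam_K + 1) * norm a) \<le>
          norm a ^ k * \<bar>Re (cnj (sgn (x0 - y0)) * sgn t * sgn a ^ k * (b - b'))\<bar>"
        using sep[OF that] by (intro mult_left_mono) auto
      ultimately show ?thesis by (simp add: mult_ac)
    qed
    show "norm (t * x + b0 - y0) \<in> distance_set K" if "x \<in> K" for x
    proof -
      have "t * x + b0 \<in> K" using G_app[OF t that] by simp
      then show ?thesis using xy unfolding distance_set_def
        by (intro CollectI exI[of _ "t * x + b0"] exI[of _ y0]) (simp add: dist_norm)
    qed
    show "norm t * (\<bar>Re (cnj e * (x - y))\<bar> - \<delta> * norm (x - y)) \<le> \<bar>norm (t * x + b0 - y0) - norm (t * y + b0 - y0)\<bar>"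
      if "x \<in> K" "y \<in> K" for x y
    proof -
      have d: "(t * x + b0 - y0) - (t * y + b0 - y0) = t * (x - y)" by (simp add: algebra_simps)
      have "\<bar>Re (cnj (sgn (x0 - y0)) * ((t * x + b0 - y0) - (t * y + b0 - y0)))\<bar>
          - \<delta> * norm ((t * x + b0 - y0) - (t * y + b0 - y0)) \<le> \<bar>norm (t * x + b0 - y0) - norm (t * y + b0 - y0)\<bar>"
        using dir[OF that(1)] dir[OF that(2)] by (intro norm_diff_linearised) auto
      then have 1: "\<bar>Re (cnj (sgn (x0 - y0)) * (t * (x - y)))\<bar> - \<delta> * (norm t * norm (x - y))
          \<le> \<bar>norm (t * x + b0 - y0) - norm (t * y + b0 - y0)\<bar>"
        unfolding d norm_mult .
      have "cnj (sgn (x0 - y0)) * (t * (x - y)) = of_real (norm t) * (cnj e * (x - y))"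
        by (subst tn) (simp add: ce mult_ac)
      then have 2: "\<bar>Re (cnj (sgn (x0 - y0)) * (t * (x - y)))\<bar> = norm t * \<bar>Re (cnj e * (x - y))\<bar>"
        by (simp only: Re_of_real_mult abs_mult abs_norm_cancel)
      have 3: "m * (R - \<delta> * n) = m * R - \<delta> * (m * n)" for m R n :: real by (simp add: algebra_simps)
      show ?thesis using 1 unfolding 2 3 .
    qed
  qed (use p0 a B ne growth \<delta> s0 t0 in auto)
qed


lemma separated_family_of_G:
  assumes "a \<noteq> 0" "norm a < 1" "finite B" "B \<noteq> {}" "\<And>b. b \<in> B \<Longrightarrow> (False, a, b) \<in> G"
    "\<And>b b'. b \<in> B \<Longrightarrow> b' \<in> B \<Longrightarrow> b \<noteq> b' \<Longrightarrow> (diam_K + 1) * norm a \<le> norm (b - b')"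
  shows "separated_family K diam_K a B"
proof
  show "norm (x - y) \<le> diam_K" if "x \<in> K" "y \<in> K" for x y
    using dist_le_diam_K[OF that] by (simp add: dist_norm)
  show "a * x + b \<in> K" if "b \<in> B" "x \<in> K" for b x
    using G_app[OF assms(5)[OF that(1)] that(2)] by simp
qed (use assms K_nonempty in auto)

text \<open>The homogeneous family is selected in the plane, without regard to projections, and then iterated.
  The number \<open>A\<close> is a bound for the average number of close pairs, and the quotient of the square of
  \<open>card B\<close> by \<open>A\<close> is the resulting typical number of separated projections. The assumption on
  powers keeps the property \<open>Q\<close> of the rotation under iteration.\<close>

lemma family_with_few_close_pairs:
  assumes T: "finite T" "T \<subseteq> G"
      "\<And>f. f \<in> G \<Longrightarrow> \<exists>u\<in>T. \<not> fst (sim_lin (sim_comp f u)) \<and> Q (sgn (snd (sim_lin (sim_comp f u))))"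
    and Q: "\<And>z n. Q z \<Longrightarrow> n > 0 \<Longrightarrow> Q (z ^ n)"
    and \<epsilon>: "0 < \<epsilon>" "\<epsilon> < 1" and C: "C > 0"
  obtains a B A where "Q (sgn a)" "a \<noteq> 0" "norm a < 1" "finite B" "B \<noteq> {}"
    "\<And>b x. b \<in> B \<Longrightarrow> x \<in> K \<Longrightarrow> a * x + b \<in> K"
    "A > 0" "(real (card B))\<^sup>2 / A = norm a powr (-(1 - 2 * \<epsilon>))"
    "\<And>\<zeta>. non_torsion \<zeta> \<Longrightarrow> \<exists>N0>0. \<forall>u N. norm u = 1 \<longrightarrow> N \<ge> N0 \<longrightarrow>
      (\<Sum>j<N. close_pairs B (u * \<zeta> ^ j) (2 * (C * norm a))) \<le> real N * A"
proof -
  define d where "d = diam_K + 1"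
  have d0: "d > 0" using diam_K_nonneg by (simp add: d_def)
  have T': "\<exists>u\<in>T. (\<lambda>(p, a). \<not> p \<and> Q (sgn a)) (lin_comp (sim_lin f) (sim_lin u))" if "f \<in> G" for f
    using T(3)[OF that] unfolding sim_lin_comp by (simp add: case_prod_beta)
  have pos: "positive_length ((\<lambda>z::complex. z) ` K)" using positive_length_K by simp
  obtain p a B where fam: "(\<lambda>(p, a). \<not> p \<and> Q (sgn a)) (p, a)" "0 < norm a" "norm a < 1" "finite B"
    "\<And>b. b \<in> B \<Longrightarrow> (p, a, b) \<in> G"
    "norm a powr (-(1 - \<epsilon>)) \<le> card B"
    "\<And>b b'. b \<in> B \<Longrightarrow> b' \<in> B \<Longrightarrow> b \<noteq> b' \<Longrightarrow> d * norm a \<le> norm (b - b')"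
    by (rule homogeneous_family[of "\<lambda>z. z", OF _ _ pos T(1,2) T' \<epsilon>(1) d0]) auto
  have p: "\<not> p" "Q (sgn a)" using fam(1) by auto
  have "0 < norm a powr (-(1 - \<epsilon>))" using fam(2) by simp
  then have "real (card B) > 0" using fam(6) by linarith
  then have Bne: "B \<noteq> {}" by auto
  interpret separated_family K diam_K a B
    using fam p Bne by (intro separated_family_of_G) (auto simp: d_def)
  obtain n A where nA: "n > 0" "A > 0" "(real (card (Lv n)))\<^sup>2 / A = norm (a ^ n) powr (-(1 - 2 * \<epsilon>))"
    "\<And>\<zeta>. non_torsion \<zeta> \<Longrightarrow> \<exists>N0>0. \<forall>u N. norm u = 1 \<longrightarrow> N \<ge> N0 \<longrightarrow>
      (\<Sum>j<N. close_pairs (Lv n) (u * \<zeta> ^ j) (2 * (C * norm (a ^ n)))) \<le> real N * A"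
    by (rule iterate_with_few_close_pairs[OF \<epsilon> C fam(6)]) (rule that)
  show thesis
  proof (rule that[of "a ^ n" "Lv n" A])
    show "Q (sgn (a ^ n))" unfolding sgn_complex_power using p nA(1) by (intro Q)
    show "norm (a ^ n) < 1" using fam(2,3) nA(1) by (simp add: norm_power power_less_one_iff)
    have "card (Lv n) > 0" unfolding card_level using \<open>real (card B) > 0\<close> by simp
    then show "Lv n \<noteq> {}" by auto
    show "a ^ n * x + b \<in> K" if "b \<in> Lv n" "x \<in> K" for b x by (rule level_inv[OF that])
  qed (use nA fam(2) finite_level in auto)
qed

lemma many_projections_separated:
  fixes B :: "complex set"
  assumes B: "finite B" "B \<noteq> {}" and \<sigma>: "\<sigma> > 0"
  obtains S where "S \<subseteq> B" "S \<noteq> {}"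
    "\<And>b b'. b \<in> S \<Longrightarrow> b' \<in> S \<Longrightarrow> b \<noteq> b' \<Longrightarrow> \<sigma> \<le> \<bar>Re (u * (b - b'))\<bar>"
    "(real (card B))\<^sup>2 \<le> real (card S) * close_pairs B u (2 * \<sigma>)"
proof -
  have d: "dist (Re (u * x)) (Re (u * y)) = \<bar>Re (u * (x - y))\<bar>" for x y
    by (simp only: dist_real_def right_diff_distrib minus_complex.simps)
  obtain S where S: "S \<subseteq> B" "\<forall>x\<in>S. \<forall>y\<in>S. x \<noteq> y \<longrightarrow> \<sigma> \<le> \<bar>Re (u * (x - y))\<bar>"
    "(real (card B))\<^sup>2 \<le> real (card S) * close_pairs B u (2 * \<sigma>)"
    using separated_subset_from_close_pairs[OF B(1) \<sigma>, of "\<lambda>z. Re (u * z)"] unfolding d by blast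
  have "(real (card B))\<^sup>2 > 0" using B by (simp add: card_gt_0_iff)
  then have "S \<noteq> {}" using S(3) by auto
  with S that show thesis by blast
qed

text \<open>At level \<open>k\<close> choose a subset of the family with separated projections in the direction that is relevant
  there. Its size is at least the square of \<open>card B\<close> divided by the number \<open>E k\<close> of close pairs. The
  averages of \<open>E\<close> over the first \<open>N\<close> levels are at most \<open>A\<close>, hence so are the geometric means, and the
  product of the sizes is as large as required for all \<open>N \<ge> N\<^sub>0\<close>. This holds for every
  direction, so any pair \<open>x\<^sub>0\<close>, \<open>y\<^sub>0\<close> will do.\<close>

lemma distance_set_of_dense_rotations:
  assumes G0: "(False, a0, b0) \<in> G" "non_torsion (sgn a0)" and s0: "0 \<le> s0" "s0 < 1"
  shows "hausdorff_measure s0 (distance_set K) > 0"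
proof -
  from finite_correctors_non_torsion[OF G0] obtain T where T: "finite T" "T \<subseteq> G"
    "\<forall>f\<in>G. \<exists>u\<in>T. \<not> fst (sim_lin (sim_comp f u)) \<and> non_torsion (sgn (snd (sim_lin (sim_comp f u))))"
    by (elim exE conjE)
  define \<epsilon> where "\<epsilon> = (1 - s0) / 4"
  define s where "s = 1 - 2 * \<epsilon>"
  have \<epsilon>: "0 < \<epsilon>" "\<epsilon> < 1" and s: "0 < s" "s0 \<le> s" using s0 by (auto simp: \<epsilon>_def s_def field_simps)
  define C where "C = diam_K + 1"
  have C: "C > 0" using diam_K_nonneg by (simp add: C_def)
  obtain a B A where fam: "non_torsion (sgn a)" "a \<noteq> 0" "norm a < 1" "finite B" "B \<noteq> {}"
    "\<And>b x. b \<in> B \<Longrightarrow> x \<in> K \<Longrightarrow> a * x + b \<in> K"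
    "A > 0" "(real (card B))\<^sup>2 / A = norm a powr (-(1 - 2 * \<epsilon>))"
    "\<And>\<zeta>. non_torsion \<zeta> \<Longrightarrow> \<exists>N0>0. \<forall>u N. norm u = 1 \<longrightarrow> N \<ge> N0 \<longrightarrow>
      (\<Sum>j<N. close_pairs B (u * \<zeta> ^ j) (2 * (C * norm a))) \<le> real N * A"
    by (rule family_with_few_close_pairs[where Q = non_torsion, OF T(1,2)],
        (rule bspec[OF T(3)]; assumption), (rule non_torsion_power; assumption),
        rule \<epsilon>(1), rule \<epsilon>(2), rule C, rule that)
  from fam(9)[OF fam(1)] obtain N0 :: nat where N0: "N0 > 0"
    "\<forall>u N. norm u = 1 \<longrightarrow> N \<ge> N0 \<longrightarrow>
      (\<Sum>j<N. close_pairs B (u * sgn a ^ j) (2 * (C * norm a))) \<le> real N * A"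
    by (elim exE conjE)
  obtain x0 y0 where xy: "x0 \<in> K" "y0 \<in> K" "x0 \<noteq> y0" by (rule two_points_K)
  define \<delta> where "\<delta> = norm a / (2 * C)"
  have \<delta>: "\<delta> > 0" "\<delta> * diam_K \<le> norm a / 2"
  proof -
    show "\<delta> > 0" using fam(2) C by (simp add: \<delta>_def)
    then have "\<delta> * diam_K \<le> \<delta> * C" by (intro mult_left_mono) (auto simp: C_def)
    then show "\<delta> * diam_K \<le> norm a / 2" using C by (simp add: \<delta>_def)
  qed
  obtain f where f: "f \<in> G" "\<forall>u\<in>G. \<forall>x\<in>K. sim_app (sim_comp f u) x \<noteq> y0 \<and>
    norm (sgn (sim_app (sim_comp f u) x - y0) - sgn (x0 - y0)) \<le> \<delta>"
    using small_piece_seen_in_one_direction[OF xy \<delta>(1)] by blast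
  obtain u where u: "u \<in> T" "\<not> fst (sim_lin (sim_comp f u))" using T(3) f(1) by blast
  obtain t c0 where fu: "sim_comp f u = (False, t, c0)"
    using u(2) by (cases "sim_comp f u") auto
  have uG: "u \<in> G" using u T by blast
  have tG: "(False, t, c0) \<in> G" using G_comp[OF f(1) uG] fu by simp
  define w where "w = cnj (sgn (x0 - y0)) * sgn t"
  have w: "norm w = 1" using xy G_coeff_nonzero[OF tG] by (simp add: w_def norm_mult norm_sgn)
  have na: "C * norm a > 0" using C fam(2) by simp
  define E where "E j = close_pairs B (w * sgn a ^ j) (2 * (C * norm a))" for j
  have "\<forall>j. \<exists>S. S \<subseteq> B \<and> S \<noteq> {} \<and>
    (\<forall>b\<in>S. \<forall>b'\<in>S. b \<noteq> b' \<longrightarrow> C * norm a \<le> \<bar>Re (w * sgn a ^ j * (b - b'))\<bar>) \<and>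
    (real (card B))\<^sup>2 \<le> real (card S) * E j"
  proof
    fix j
    obtain S where "S \<subseteq> B" "S \<noteq> {}"
      "\<And>b b'. b \<in> S \<Longrightarrow> b' \<in> S \<Longrightarrow> b \<noteq> b' \<Longrightarrow> C * norm a \<le> \<bar>Re (w * sgn a ^ j * (b - b'))\<bar>"
      "(real (card B))\<^sup>2 \<le> real (card S) *
        close_pairs B (w * sgn a ^ j) (2 * (C * norm a))"
      by (rule many_projections_separated[OF fam(4,5) na, where u = "w * sgn a ^ j"], rule that)
    then show "\<exists>S. S \<subseteq> B \<and> S \<noteq> {} \<and>
      (\<forall>b\<in>S. \<forall>b'\<in>S. b \<noteq> b' \<longrightarrow> C * norm a \<le> \<bar>Re (w * sgn a ^ j * (b - b'))\<bar>) \<and>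
      (real (card B))\<^sup>2 \<le> real (card S) * E j"
      unfolding E_def by (intro exI[of _ S] conjI ballI impI)
  qed
  from choice[OF this] obtain S where S0: "\<forall>j. S j \<subseteq> B \<and> S j \<noteq> {} \<and>
    (\<forall>b\<in>S j. \<forall>b'\<in>S j. b \<noteq> b' \<longrightarrow> C * norm a \<le> \<bar>Re (w * sgn a ^ j * (b - b'))\<bar>) \<and>
    (real (card B))\<^sup>2 \<le> real (card (S j)) * E j" by (elim exE)
  have SB: "S j \<subseteq> B" and Sne: "S j \<noteq> {}"
    and Scard: "(real (card B))\<^sup>2 \<le> real (card (S j)) * E j" for j using S0 by auto
  have Ssep: "C * norm a \<le> \<bar>Re (w * sgn a ^ j * (b - b'))\<bar>" if "b \<in> S j" "b' \<in> S j" "b \<noteq> b'" for j b b'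
    using S0 that by blast
  have Sfin: "finite (S j)" for j using SB fam(4) finite_subset by blast
  have S1: "card (S j) \<ge> 1" for j using Sfin Sne by (simp add: Suc_le_eq card_gt_0_iff)
  have cB: "(real (card B))\<^sup>2 > 0" using fam(4,5) by (simp add: card_gt_0_iff)
  have E0: "E j > 0" for j
  proof (rule ccontr)
    assume "\<not> E j > 0"
    then have "E j = 0" by (simp add: E_def)
    then show False using Scard[of j] cB by simp
  qed
  define r where "r = norm a"
  have r: "0 < r" "r < 1" using fam by (auto simp: r_def)
  have big: "r powr (-(s * real N)) \<le> real (\<Prod>j<N. card (S j))" if N: "N \<ge> N0" for N
  proof -
    have "(\<Sum>j<N. E j) \<le> real N * A" unfolding E_def using N0(2) w N by blast
    then have EA: "(\<Prod>j<N. E j) \<le> A ^ N" using E0 by (intro prod_le_power_of_average) (auto simp: less_imp_le)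
    have "((real (card B))\<^sup>2) ^ N = (\<Prod>j<N. (real (card B))\<^sup>2)" by simp
    also have "\<dots> \<le> (\<Prod>j<N. real (card (S j)) * E j)" using Scard by (intro prod_mono) auto
    also have "\<dots> = real (\<Prod>j<N. card (S j)) * (\<Prod>j<N. E j)" by (simp add: prod.distrib)
    also have "\<dots> \<le> real (\<Prod>j<N. card (S j)) * A ^ N" using EA by (intro mult_left_mono of_nat_0_le_iff)
    finally have "((real (card B))\<^sup>2) ^ N / A ^ N \<le> real (\<Prod>j<N. card (S j))"
      using fam(7) by (simp add: divide_le_eq)
    moreover have "((real (card B))\<^sup>2) ^ N / A ^ N = (r powr (-s)) ^ N"
      using fam(8) by (simp add: r_def s_def flip: power_divide)
    moreover have "(r powr (-s)) ^ N = r powr (-(s * real N))"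
      using r by (simp add: powr_power mult.commute)
    ultimately show ?thesis by simp
  qed
  \<comment> \<open>For \<open>k < N0\<close> the first \<open>k\<close> levels may have a single node each; \<open>c\<close> makes the required bound at most 1.\<close>
  define c where "c = r powr (s * real N0)"
  have c: "0 < c" "c \<le> 1" using r s by (auto simp: c_def intro: powr_le1)
  have growth: "c * r powr (-(s * real k)) \<le> real (\<Prod>j<k. card (S j))" for k
  proof (cases "k \<ge> N0")
    case True
    have "c * r powr (-(s * real k)) \<le> 1 * r powr (-(s * real k))" using c by (intro mult_right_mono) auto
    then show ?thesis using big[OF True] by simp
  next
    case False
    have "c * r powr (-(s * real k)) = r powr (s * (real N0 - real k))"
      unfolding c_def powr_add[symmetric] by (simp add: algebra_simps)
    also have "\<dots> \<le> 1" using r s False by (intro powr_le1) auto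
    also have "1 \<le> real (\<Prod>j<k. card (S j))"
    proof -
      have "1 \<le> (\<Prod>j<k. card (S j))" by (intro prod_ge_1 S1)
      then show ?thesis by linarith
    qed
    finally show ?thesis .
  qed
  show ?thesis
  proof (rule distance_set_from_separated_tree[OF xy tG _ _ \<delta>(2) fam(2,3), of S c s])
    show "t * x + c0 \<noteq> y0 \<and> norm (sgn (t * x + c0 - y0) - sgn (x0 - y0)) \<le> \<delta>" if "x \<in> K" for x
      using f(2) uG that fu by force
    show "a * x + b \<in> K" if "b \<in> S k" "x \<in> K" for k b x using fam(6) SB that by blast
    show "(diam_K + 1) * norm a \<le> \<bar>Re (cnj (sgn (x0 - y0)) * sgn t * sgn a ^ k * (b - b'))\<bar>"
      if "b \<in> S k" "b' \<in> S k" "b \<noteq> b'" for k b b'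
      using Ssep[OF that] by (simp add: C_def w_def)
    show "c * norm a powr (-(s * real k)) \<le> real (\<Prod>j<k. card (S j))" for k
      using growth[of k] by (simp add: r_def)
  qed (use \<delta> Sfin Sne c s s0 in auto)
qed

text \<open>The projections have to be separated in the direction of a chord of \<open>K\<close>. If some direction \<open>v\<close> is
  not approximated by chords, there is a chord in whose direction \<open>K\<close> has a projection of positive
  length, and the pieces can be selected according to their projections. Otherwise any good direction
  \<open>v\<close> may be replaced by a chord within \<open>norm a\<close> of it; a gap of \<open>2 * (diam_K + 1)\<close> before the
  replacement leaves \<open>diam_K + 1\<close> after it. The directions that are averaged to find \<open>v\<close> are the powers
  of an arbitrary rotation of infinite order.\<close>

lemma positively_homothetic_family:
  assumes T: "finite T" "T \<subseteq> G"
      "\<And>f. f \<in> G \<Longrightarrow> \<exists>u\<in>T. \<not> fst (sim_lin (sim_comp f u)) \<and> sgn (snd (sim_lin (sim_comp f u))) = 1"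
    and \<epsilon>: "0 < \<epsilon>" "\<epsilon> < 1 / 2"
  obtains x0 y0 a B where "x0 \<in> K" "y0 \<in> K" "x0 \<noteq> y0" "sgn a = 1" "norm a < 1" "finite B"
    "\<And>b x. b \<in> B \<Longrightarrow> x \<in> K \<Longrightarrow> a * x + b \<in> K"
    "norm a powr (-(1 - 2 * \<epsilon>)) \<le> card B"
    "\<And>b b'. \<lbrakk>b \<in> B; b' \<in> B; b \<noteq> b'\<rbrakk> \<Longrightarrow> (diam_K + 1) * norm a \<le> \<bar>Re (cnj (sgn (x0 - y0)) * (b - b'))\<bar>"
proof (cases "\<exists>v c. norm v = 1 \<and> c > 0 \<and> (\<forall>x\<in>K. \<forall>y\<in>K. c * norm (x - y) \<le> \<bar>Im (cnj v * (x - y))\<bar>)")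
  case True
  then obtain v c where vc: "norm v = 1" "c > 0" "\<forall>x\<in>K. \<forall>y\<in>K. c * norm (x - y) \<le> \<bar>Im (cnj v * (x - y))\<bar>" by blast
  obtain x0 y0 where xy: "x0 \<in> K" "y0 \<in> K" "x0 \<noteq> y0"
    and pos: "positive_length ((\<lambda>z. Re (cnj (sgn (x0 - y0)) * z)) ` K)"
    using chord_with_positive_projection[OF compact_K positive_length_K vc(1,2)] vc(3) by blast
  define e where "e = sgn (x0 - y0)"
  have e: "norm e = 1" using xy by (simp add: e_def norm_sgn)
  define h where "h z = complex_of_real (Re (cnj e * z))" for z
  have hd: "h (x - y) = h x - h y" for x y
    unfolding h_def by (simp only: right_diff_distrib minus_complex.simps of_real_diff)
  have h1: "norm (h x) \<le> norm x" for x
    using Re_unit_mult_le[OF e, of x] by (simp only: h_def norm_of_real)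
  have "positive_length (complex_of_real ` (\<lambda>z. Re (cnj e * z)) ` K)"
    by (rule positive_length_image[OF pos[folded e_def], of 1]) (auto simp: dist_norm simp flip: of_real_diff)
  then have hpos: "positive_length (h ` K)" by (simp add: image_image h_def)
  have T': "\<exists>u\<in>T. (\<lambda>(p, a). \<not> p \<and> sgn a = 1) (lin_comp (sim_lin f) (sim_lin u))" if "f \<in> G" for f
    using T(3)[OF that] unfolding sim_lin_comp by (simp add: case_prod_beta)
  have d0: "diam_K + 1 > 0" using diam_K_nonneg by simp
  obtain p a B where fam: "(\<lambda>(p, a). \<not> p \<and> sgn a = 1) (p, a)" "0 < norm a" "norm a < 1" "finite B"
    "\<And>b. b \<in> B \<Longrightarrow> (p, a, b) \<in> G"
    "norm a powr (-(1 - 2 * \<epsilon>)) \<le> card B"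
    "\<And>b b'. b \<in> B \<Longrightarrow> b' \<in> B \<Longrightarrow> b \<noteq> b' \<Longrightarrow> (diam_K + 1) * norm a \<le> norm (h b - h b')"
    by (rule homogeneous_family[of h, OF hd h1 hpos T(1,2) T' _ d0, of "2 * \<epsilon>"]) (use \<epsilon> in auto)
  have p: "\<not> p" "sgn a = 1" using fam(1) by auto
  show thesis
  proof (rule that[OF xy p(2) fam(3,4)])
    show "a * x + b \<in> K" if "b \<in> B" "x \<in> K" for b x
      using G_app[OF fam(5)[OF that(1)] that(2)] p by simp
    show "norm a powr (-(1 - 2 * \<epsilon>)) \<le> card B" by (rule fam(6))
    show "(diam_K + 1) * norm a \<le> \<bar>Re (cnj (sgn (x0 - y0)) * (b - b'))\<bar>"
      if "b \<in> B" "b' \<in> B" "b \<noteq> b'" for b b'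
      using fam(7)[OF that] unfolding hd[symmetric] by (simp only: h_def e_def norm_of_real)
  qed
next
  case False
  have \<epsilon>1: "\<epsilon> < 1" using \<epsilon> by simp
  define C where "C = 2 * (diam_K + 1)"
  have C: "C > 0" using diam_K_nonneg by (simp add: C_def)
  obtain a B A where fam: "sgn a = 1" "a \<noteq> 0" "norm a < 1" "finite B" "B \<noteq> {}"
    "\<And>b x. b \<in> B \<Longrightarrow> x \<in> K \<Longrightarrow> a * x + b \<in> K"
    "A > 0" "(real (card B))\<^sup>2 / A = norm a powr (-(1 - 2 * \<epsilon>))"
    "\<And>\<zeta>. non_torsion \<zeta> \<Longrightarrow> \<exists>N0>0. \<forall>u N. norm u = 1 \<longrightarrow> N \<ge> N0 \<longrightarrow>
      (\<Sum>j<N. close_pairs B (u * \<zeta> ^ j) (2 * (C * norm a))) \<le> real N * A"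
    by (rule family_with_few_close_pairs[where Q = "\<lambda>z. z = 1", OF T(1,2)],
        (rule T(3); assumption), simp only: power_one, rule \<epsilon>(1), rule \<epsilon>1, rule C, rule that)
  obtain \<zeta> where \<zeta>: "non_torsion \<zeta>" using ex_non_torsion by blast
  from fam(9)[OF \<zeta>] obtain N :: nat where N: "N > 0" "\<forall>u M. norm u = 1 \<longrightarrow> M \<ge> N \<longrightarrow>
      (\<Sum>j<M. close_pairs B (u * \<zeta> ^ j) (2 * (C * norm a))) \<le> real M * A"
    by (elim exE conjE)
  define E where "E j = close_pairs B (1 * \<zeta> ^ j) (2 * (C * norm a))" for j
  have sumE: "(\<Sum>j<N. E j) \<le> real N * A" unfolding E_def by (rule N(2)[rule_format, OF norm_one order_refl])
  have "\<exists>j<N. E j \<le> A"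
  proof (rule ccontr)
    assume "\<not> ?thesis"
    then have "(\<Sum>j<N. A) < (\<Sum>j<N. E j)" using N(1) by (intro sum_strict_mono) (auto simp: not_le lessThan_empty_iff)
    then show False using sumE by simp
  qed
  then obtain j where j: "E j \<le> A" by blast
  define v where "v = cnj (\<zeta> ^ j)"
  have v: "norm v = 1" using \<zeta> by (simp add: v_def non_torsion_def norm_power)
  have na: "C * norm a > 0" using C fam(2) by simp
  have vz: "cnj v = \<zeta> ^ j" by (simp add: v_def)
  obtain S where S: "S \<subseteq> B" "S \<noteq> {}"
      "\<And>b b'. b \<in> S \<Longrightarrow> b' \<in> S \<Longrightarrow> b \<noteq> b' \<Longrightarrow> C * norm a \<le> \<bar>Re (cnj v * (b - b'))\<bar>"
      "(real (card B))\<^sup>2 \<le> real (card S) *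
        close_pairs B (cnj v) (2 * (C * norm a))"
    by (rule many_projections_separated[OF fam(4,5) na, where u = "cnj v"], rule that)
  have SE: "(real (card B))\<^sup>2 \<le> real (card S) * E j"
    using S(4) unfolding vz E_def mult_1 .
  define \<eta> where "\<eta> = norm a / 2"
  have \<eta>: "\<eta> > 0" using fam(2) by (simp add: \<eta>_def)
  obtain x y where xy: "x \<in> K" "y \<in> K" "\<bar>Im (cnj v * (x - y))\<bar> < \<eta> * norm (x - y)"
  proof -
    from False have "\<not> (\<forall>x\<in>K. \<forall>y\<in>K. \<eta> * norm (x - y) \<le> \<bar>Im (cnj v * (x - y))\<bar>)"
      using v \<eta> by blast
    then show thesis using that by (auto simp only: not_le Ball_def not_all not_imp)
  qed
  have "\<exists>x0\<in>K. \<exists>y0\<in>K. x0 \<noteq> y0 \<and> norm (sgn (x0 - y0) - v) \<le> norm a"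
  proof -
    have aux: "norm (sgn (x0 - y0) - v) \<le> norm a"
      if "\<bar>Im (cnj v * (x0 - y0))\<bar> < \<eta> * norm (x0 - y0)" "Re (cnj v * (x0 - y0)) \<ge> 0" for x0 y0
    proof -
      have ne: "x0 \<noteq> y0" using that(1) by auto
      then have n: "norm (x0 - y0) > 0" by simp
      define w where "w = cnj v * sgn (x0 - y0)"
      have "w = (cnj v * (x0 - y0)) / of_real (norm (x0 - y0))" by (simp add: w_def sgn_eq)
      then have wri: "Re w = Re (cnj v * (x0 - y0)) / norm (x0 - y0)" "Im w = Im (cnj v * (x0 - y0)) / norm (x0 - y0)"
        by (simp_all only: Re_divide_of_real Im_divide_of_real)
      have re: "Re w \<ge> 0" unfolding wri using that(2) n by simp
      have im: "\<bar>Im w\<bar> \<le> \<eta>" unfolding wri abs_divide using that(1) n by (simp add: divide_le_eq less_imp_le)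
      have nw: "norm w = 1" using v ne by (simp add: w_def norm_mult norm_sgn)
      have vv: "v * cnj v = 1" using v by (simp add: complex_norm_square[symmetric])
      have "norm (sgn (x0 - y0) - v) = norm (v * (w - 1))"
      proof -
        have "v * (w - 1) = (v * cnj v) * sgn (x0 - y0) - v" by (simp add: w_def algebra_simps)
        then show ?thesis using vv by simp
      qed
      also have "\<dots> = norm (w - 1)" using v by (simp add: norm_mult)
      also have "\<dots> \<le> \<bar>Re w - 1\<bar> + \<bar>Im w\<bar>" using cmod_le[of "w - 1"] by simp
      also have "\<bar>Re w - 1\<bar> \<le> \<bar>Im w\<bar>"
      proof -
        have sq: "(Re w)\<^sup>2 + (Im w)\<^sup>2 = 1" using nw cmod_power2[of w] by simp
        have re1: "Re w \<le> 1" using abs_Re_le_cmod[of w] nw by simp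
        have "(1 - Re w)\<^sup>2 \<le> (1 - Re w) * (1 + Re w)"
          unfolding power2_eq_square using re re1 by (intro mult_left_mono) auto
        also have "\<dots> = (Im w)\<^sup>2" using sq by (simp add: power2_eq_square algebra_simps)
        finally have "\<bar>1 - Re w\<bar> \<le> \<bar>Im w\<bar>" by (simp only: abs_le_square_iff)
        then show ?thesis by (simp only: abs_minus_commute)
      qed
      finally show ?thesis using im by (simp add: \<eta>_def)
    qed
    show ?thesis
    proof (cases "Re (cnj v * (x - y)) \<ge> 0")
      case True
      then show ?thesis using aux[OF xy(3)] xy by (intro bexI[of _ x] bexI[of _ y]) auto
    next
      case False
      have "cnj v * (y - x) = - (cnj v * (x - y))" by (simp add: algebra_simps)
      then have "Re (cnj v * (y - x)) \<ge> 0" "\<bar>Im (cnj v * (y - x))\<bar> < \<eta> * norm (y - x)"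
        using False xy(3) by (simp_all only: uminus_complex.simps abs_minus_cancel norm_minus_commute[of y x])
      then show ?thesis using aux[of y x] xy by (intro bexI[of _ y] bexI[of _ x]) auto
    qed
  qed
  then obtain x0 y0 where xy0: "x0 \<in> K" "y0 \<in> K" "x0 \<noteq> y0" "norm (sgn (x0 - y0) - v) \<le> norm a" by blast
  obtain p0 where p0: "p0 \<in> K" using K_nonempty by auto
  show thesis
  proof (rule that[OF xy0(1-3) fam(1,3)])
    show "finite S" using S(1) fam(4) finite_subset by blast
    show "a * x + b \<in> K" if "b \<in> S" "x \<in> K" for b x using fam(6) S(1) that by blast
    have "(real (card B))\<^sup>2 \<le> real (card S) * A" using SE j by (meson mult_left_mono of_nat_0_le_iff order_trans)
    then have "(real (card B))\<^sup>2 / A \<le> real (card S)" using fam(7) by (simp add: divide_le_eq)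
    then show "norm a powr (-(1 - 2 * \<epsilon>)) \<le> card S" using fam(8) by simp
    show "(diam_K + 1) * norm a \<le> \<bar>Re (cnj (sgn (x0 - y0)) * (b - b'))\<bar>"
      if b: "b \<in> S" "b' \<in> S" "b \<noteq> b'" for b b'
    proof -
      have "norm ((a * p0 + b) - (a * p0 + b')) \<le> diam_K"
        using dist_le_diam_K fam(6) S(1) b p0 unfolding dist_norm by blast
      then have bd: "norm (b - b') \<le> diam_K" by simp
      have "\<bar>Re (cnj (sgn (x0 - y0) - v) * (b - b'))\<bar> \<le> norm (cnj (sgn (x0 - y0) - v) * (b - b'))"
        by (rule abs_Re_le_cmod)
      also have "\<dots> = norm (sgn (x0 - y0) - v) * norm (b - b')" by (simp only: norm_mult complex_mod_cnj)
      also have "\<dots> \<le> norm a * diam_K" using xy0(4) bd by (intro mult_mono) auto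
      finally have 1: "\<bar>Re (cnj (sgn (x0 - y0) - v) * (b - b'))\<bar> \<le> norm a * diam_K" .
      have "cnj (sgn (x0 - y0)) * (b - b') = cnj v * (b - b') + cnj (sgn (x0 - y0) - v) * (b - b')"
        by (simp add: algebra_simps)
      then have "Re (cnj (sgn (x0 - y0)) * (b - b')) = Re (cnj v * (b - b')) + Re (cnj (sgn (x0 - y0) - v) * (b - b'))"
        by (simp only: plus_complex.simps)
      then have "C * norm a - norm a * diam_K \<le> \<bar>Re (cnj (sgn (x0 - y0)) * (b - b'))\<bar>"
        using S(3)[OF b] 1 by linarith
      moreover have "(diam_K + 1) * norm a \<le> C * norm a - norm a * diam_K"
        using norm_ge_zero[of a] by (simp add: C_def algebra_simps)
      ultimately show ?thesis by linarith
    qed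
  qed
qed

text \<open>With a positively homothetic family, and a piece that is positively homothetic to \<open>K\<close>, the direction
  of projection is the same at all levels, and one family serves for the whole tree.\<close>

lemma distance_set_of_finitely_many_rotations:
  assumes tors: "\<And>a b. (False, a, b) \<in> G \<Longrightarrow> \<not> non_torsion (sgn a)" and s0: "0 \<le> s0" "s0 < 1"
  shows "hausdorff_measure s0 (distance_set K) > 0"
proof -
  have "\<exists>T. finite T \<and> T \<subseteq> G \<and>
    (\<forall>f\<in>G. \<exists>u\<in>T. \<not> fst (sim_lin (sim_comp f u)) \<and> sgn (snd (sim_lin (sim_comp f u))) = 1)"
    by (rule finite_correctors_torsion) (rule tors)
  then obtain T where T: "finite T" "T \<subseteq> G"
    "\<forall>f\<in>G. \<exists>u\<in>T. \<not> fst (sim_lin (sim_comp f u)) \<and> sgn (snd (sim_lin (sim_comp f u))) = 1"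
    by (elim exE conjE)
  define \<epsilon> where "\<epsilon> = (1 - s0) / 4"
  define s where "s = 1 - 2 * \<epsilon>"
  have \<epsilon>: "0 < \<epsilon>" "\<epsilon> < 1 / 2" and s: "0 < s" "s0 \<le> s" using s0 by (auto simp: \<epsilon>_def s_def field_simps)
  obtain x0 y0 a B where fam: "x0 \<in> K" "y0 \<in> K" "x0 \<noteq> y0" "sgn a = 1" "norm a < 1" "finite B"
    "\<And>b x. b \<in> B \<Longrightarrow> x \<in> K \<Longrightarrow> a * x + b \<in> K"
    "norm a powr (-(1 - 2 * \<epsilon>)) \<le> card B"
    "\<And>b b'. \<lbrakk>b \<in> B; b' \<in> B; b \<noteq> b'\<rbrakk> \<Longrightarrow> (diam_K + 1) * norm a \<le> \<bar>Re (cnj (sgn (x0 - y0)) * (b - b'))\<bar>"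
    by (rule positively_homothetic_family[OF T(1,2)],
        (rule bspec[OF T(3)]; assumption), rule \<epsilon>(1), rule \<epsilon>(2), rule that)
  have a0: "a \<noteq> 0" using fam(4) by auto
  define C where "C = diam_K + 1"
  have C: "C > 0" using diam_K_nonneg by (simp add: C_def)
  define \<delta> where "\<delta> = norm a / (2 * C)"
  have \<delta>: "\<delta> > 0" "\<delta> * diam_K \<le> norm a / 2"
  proof -
    show "\<delta> > 0" using a0 C by (simp add: \<delta>_def)
    then have "\<delta> * diam_K \<le> \<delta> * C" by (intro mult_left_mono) (auto simp: C_def)
    then show "\<delta> * diam_K \<le> norm a / 2" using C by (simp add: \<delta>_def)
  qed
  obtain f where f: "f \<in> G" "\<forall>u\<in>G. \<forall>x\<in>K. sim_app (sim_comp f u) x \<noteq> y0 \<and>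
    norm (sgn (sim_app (sim_comp f u) x - y0) - sgn (x0 - y0)) \<le> \<delta>"
    using small_piece_seen_in_one_direction[OF fam(1-3) \<delta>(1)] by blast
  obtain u where u: "u \<in> T" "\<not> fst (sim_lin (sim_comp f u))" "sgn (snd (sim_lin (sim_comp f u))) = 1"
    using T(3) f(1) by blast
  obtain t c0 where fu: "sim_comp f u = (False, t, c0)"
    using u(2) by (cases "sim_comp f u") auto
  have t1: "sgn t = 1" using u(3) fu by simp
  have uG: "u \<in> G" using u T by blast
  have tG: "(False, t, c0) \<in> G" using G_comp[OF f(1) uG] fu by simp
  have "0 < norm a powr (-(1 - 2 * \<epsilon>))" using a0 by simp
  then have Bne: "B \<noteq> {}" using fam(8) by auto
  show ?thesis
  proof (rule distance_set_from_separated_tree[OF fam(1-3) tG _ _ \<delta>(2) a0 fam(5), of "\<lambda>_. B" 1 s])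
    show "t * x + c0 \<noteq> y0 \<and> norm (sgn (t * x + c0 - y0) - sgn (x0 - y0)) \<le> \<delta>" if "x \<in> K" for x
      using f(2) uG that fu by force
    show "a * x + b \<in> K" if "b \<in> B" "x \<in> K" for b x using fam(7) that by blast
    show "(diam_K + 1) * norm a \<le> \<bar>Re (cnj (sgn (x0 - y0)) * sgn t * sgn a ^ k * (b - b'))\<bar>"
      if "b \<in> B" "b' \<in> B" "b \<noteq> b'" for k :: nat and b b'
      using fam(9)[OF that] by (simp add: t1 fam(4))
    show "1 * norm a powr (-(s * real k)) \<le> real (\<Prod>j<k. card B)" for k
    proof -
      have "norm a powr (-(s * real k)) = (norm a powr (-s)) ^ k"
        using a0 by (simp add: powr_power mult.commute)
      also have "\<dots> \<le> real (card B) ^ k" using fam(8) by (intro power_mono) (auto simp: s_def)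
      finally show ?thesis by simp
    qed
  qed (use \<delta> fam(6) Bne s s0 in auto)
qed

theorem hausdorff_dim_distance_set: "hausdorff_dim (distance_set K) = 1"
proof (rule hausdorff_dim_eq_1I)
  show "distance_set K \<subseteq> {0..diam_K}"
    unfolding distance_set_def using dist_le_diam_K by auto
  show "0 \<le> diam_K" by (rule diam_K_nonneg)
  fix s0 :: real assume s0: "0 \<le> s0" "s0 < 1"
  show "0 < hausdorff_measure s0 (distance_set K)"
  proof (cases "\<exists>a b. (False, a, b) \<in> G \<and> non_torsion (sgn a)")
    case True
    then show ?thesis using distance_set_of_dense_rotations s0 by blast
  next
    case False
    then show ?thesis using distance_set_of_finitely_many_rotations s0 by blast
  qed
qed

end

theorem corollary1p10:
  fixes K :: "(real ^ 2) set"
  assumes "self_similar_set K"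
    and "hausdorff_measure 1 K > 0"
  shows "hausdorff_dim (distance_set K) = 1"
proof -
  obtain F where "planar_ifs F (to_complex ` K)"
    by (rule planar_ifs_of_self_similar_set[OF assms])
  then have "hausdorff_dim (distance_set (to_complex ` K)) = 1"
    by (rule planar_ifs.hausdorff_dim_distance_set)
  then show ?thesis by (simp add: distance_set_to_complex)
qed

end
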